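(* All doubly biorthogonal systems (for a metric $\mathbf{g}$ on a $4$-dimensional manifold) are determined by solutions $(f,g)$ to the pair of coupled second-order partial differential equations $$Y^i\left\{(\nabla_j f)(\nabla^j\nabla_i g)-(\nabla_j g)(\nabla^j\nabla_i f)\right\}=0\quad\text{for all } Y^i \text{ such that } Y^i\nabla_i f=Y^i\nabla_i g=0 .$$
   Context: $\mathbf{g}$ is a Riemannian metric on a $4$-dimensional manifold, $\nabla$ is its Levi-Civita connection, the Einstein summation convention is used, and indices are raised and lowered with $\mathbf{g}$. A local coordinate system $(x^1,x^2,x^3,x^4)$ is called doubly biorthogonal if the metric is block-diagonal in it, i.e. $g_{\alpha\beta}=0$ for $(\alpha,\beta)\in\{(1,3),(1,4),(2,3),(2,4)\}$. The unknowns $f,g$ are real-valued functions of the four coordinates, with $df$ and $dg$ linearly independent, which define a two-parameter family of $2$-surfaces $S_{a,b}=\{f=a,\ g=b\}$ ($a,b$ constants) having $df$ and $dg$ as co-normals; a doubly biorthogonal system consists of such a family together with a second family of $2$-surfaces orthogonal to it. (The function $g$ is not to be confused with the metric $\mathbf{g}$.) *)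

theory Defs
  imports "HOL-Analysis.Analysis"
begin

section \<open>Smooth 4-manifolds\<close>

text \<open>\<open>Ck_on\<close> and \<open>smooth_on\<close> are meant for open \<open>S\<close> only.\<close>

primrec Ck_on :: "nat \<Rightarrow> (real^4) set \<Rightarrow> (real^4 \<Rightarrow> 'b::real_normed_vector) \<Rightarrow> bool" where
  "Ck_on 0 S F \<longleftrightarrow> continuous_on S F"
| "Ck_on (Suc k) S F \<longleftrightarrow> F differentiable_on S \<and>
     (\<forall>i::4. Ck_on k S (\<lambda>x. frechet_derivative F (at x) (axis i 1)))"

definition smooth_on :: "(real^4) set \<Rightarrow> (real^4 \<Rightarrow> 'b::real_normed_vector) \<Rightarrow> bool" where
  "smooth_on S F \<longleftrightarrow> (\<forall>k. Ck_on k S F)"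

text \<open>A chart is a pair of a domain and a coordinate map; the values of the coordinate map
  outside the domain are irrelevant. The coordinates \<open>(x\<^sup>1, x\<^sup>2, x\<^sup>3, x\<^sup>4)\<close> of \<open>p\<close> are the components
  of \<open>snd c p\<close>.\<close>

type_synonym 'a chart = "'a set \<times> ('a \<Rightarrow> real^4)"

definition is_chart :: "'a::topological_space chart \<Rightarrow> bool" where
  "is_chart c \<longleftrightarrow> open (fst c) \<and> open (snd c ` fst c) \<and>
     homeomorphism (fst c) (snd c ` fst c) (snd c) (inv_into (fst c) (snd c))"

definition in_chart :: "'a chart \<Rightarrow> ('a \<Rightarrow> 'b) \<Rightarrow> real^4 \<Rightarrow> 'b" where
  "in_chart c F = (\<lambda>y. F (inv_into (fst c) (snd c) y))"

definition compatible :: "'a chart \<Rightarrow> 'a chart \<Rightarrow> bool" where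
  "compatible c d \<longleftrightarrow> smooth_on (snd c ` (fst c \<inter> fst d)) (in_chart c (snd d)) \<and>
     smooth_on (snd d ` (fst c \<inter> fst d)) (in_chart d (snd c))"

text \<open>A smooth structure is a maximal smooth atlas, so its members are exactly the local coordinate
  systems. The underlying 4-manifold is the whole type.\<close>

definition smooth_structure :: "'a::{t2_space, second_countable_topology} chart set \<Rightarrow> bool" where
  "smooth_structure \<A> \<longleftrightarrow> (\<forall>c\<in>\<A>. is_chart c) \<and> (\<Union>c\<in>\<A>. fst c) = UNIV \<and>
     (\<forall>c\<in>\<A>. \<forall>d\<in>\<A>. compatible c d) \<and>
     (\<forall>c. is_chart c \<and> (\<forall>d\<in>\<A>. compatible c d) \<longrightarrow> c \<in> \<A>)"

definition smooth_fun_on ::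
    "'a chart set \<Rightarrow> 'a set \<Rightarrow> ('a \<Rightarrow> 'b::real_normed_vector) \<Rightarrow> bool" where
  "smooth_fun_on \<A> W F \<longleftrightarrow> (\<forall>c\<in>\<A>. smooth_on (snd c ` (fst c \<inter> W)) (in_chart c F))"

text \<open>\<open>\<partial>F/\<partial>x\<^sup>i\<close> at the point \<open>p\<close>, in the coordinates of the chart \<open>c\<close>.\<close>

definition pd :: "'a chart \<Rightarrow> 4 \<Rightarrow> ('a \<Rightarrow> 'b::real_normed_vector) \<Rightarrow> 'a \<Rightarrow> 'b" where
  "pd c i F p = frechet_derivative (in_chart c F) (at (snd c p)) (axis i 1)"

section \<open>Riemannian metric and Levi-Civita connection\<close>

text \<open>A metric is given by its component matrices \<open>G c p $ i $ j\<close> in every local coordinate system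
  \<open>c\<close>, subject to the transformation law of a covariant 2-tensor.\<close>

type_synonym 'a tensor2 = "'a chart \<Rightarrow> 'a \<Rightarrow> real^4^4"

definition riemannian_metric :: "'a chart set \<Rightarrow> 'a tensor2 \<Rightarrow> bool" where
  "riemannian_metric \<A> G \<longleftrightarrow>
     (\<forall>c\<in>\<A>. smooth_on (snd c ` fst c) (in_chart c (G c))) \<and>
     (\<forall>c\<in>\<A>. \<forall>p\<in>fst c. transpose (G c p) = G c p \<and> (\<forall>v. v \<noteq> 0 \<longrightarrow> v \<bullet> (G c p *v v) > 0)) \<and>
     (\<forall>c\<in>\<A>. \<forall>d\<in>\<A>. \<forall>p\<in>fst c \<inter> fst d. \<forall>i j. G c p $ i $ j =
        (\<Sum>a\<in>UNIV. \<Sum>b\<in>UNIV.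
           pd c i (\<lambda>q. snd d q $ a) p * pd c j (\<lambda>q. snd d q $ b) p * G d p $ a $ b))"

text \<open>Christoffel symbols \<open>\<Gamma>\<^sup>k\<^sub>i\<^sub>j\<close> of the Levi-Civita connection.\<close>

definition christoffel :: "'a tensor2 \<Rightarrow> 'a chart \<Rightarrow> 4 \<Rightarrow> 4 \<Rightarrow> 4 \<Rightarrow> 'a \<Rightarrow> real" where
  "christoffel G c k i j p = (1/2) * (\<Sum>l\<in>UNIV. matrix_inv (G c p) $ k $ l *
     (pd c i (\<lambda>q. G c q $ j $ l) p + pd c j (\<lambda>q. G c q $ i $ l) p - pd c l (\<lambda>q. G c q $ i $ j) p))"

text \<open>\<open>nabla_covector G c j \<omega> i\<close> is \<open>\<nabla>\<^sub>j \<omega>\<^sub>i\<close>; \<open>nabla2 G c j i f\<close> is \<open>\<nabla>\<^sub>j \<nabla>\<^sub>i f\<close>; and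
  \<open>nabla2_up G c j i f\<close> is \<open>\<nabla>\<^sup>j \<nabla>\<^sub>i f\<close>.\<close>

definition nabla_covector ::
    "'a tensor2 \<Rightarrow> 'a chart \<Rightarrow> 4 \<Rightarrow> (4 \<Rightarrow> 'a \<Rightarrow> real) \<Rightarrow> 4 \<Rightarrow> 'a \<Rightarrow> real" where
  "nabla_covector G c j \<omega> i p =
     pd c j (\<omega> i) p - (\<Sum>k\<in>UNIV. christoffel G c k j i p * \<omega> k p)"

definition nabla2 :: "'a tensor2 \<Rightarrow> 'a chart \<Rightarrow> 4 \<Rightarrow> 4 \<Rightarrow> ('a \<Rightarrow> real) \<Rightarrow> 'a \<Rightarrow> real" where
  "nabla2 G c j i f p = nabla_covector G c j (\<lambda>k. pd c k f) i p"

definition nabla2_up :: "'a tensor2 \<Rightarrow> 'a chart \<Rightarrow> 4 \<Rightarrow> 4 \<Rightarrow> ('a \<Rightarrow> real) \<Rightarrow> 'a \<Rightarrow> real" where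
  "nabla2_up G c j i f p = (\<Sum>k\<in>UNIV. matrix_inv (G c p) $ j $ k * nabla2 G c k i f p)"

section \<open>Doubly biorthogonal systems\<close>

definition doubly_biorthogonal :: "'a tensor2 \<Rightarrow> 'a chart \<Rightarrow> bool" where
  "doubly_biorthogonal G c \<longleftrightarrow>
     (\<forall>p\<in>fst c. \<forall>(\<alpha>, \<beta>)\<in>{(1,3), (1,4), (2,3), (2,4)}. G c p $ \<alpha> $ \<beta> = 0)"

text \<open>The non-empty surfaces \<open>{f = a, g = b}\<close> in \<open>U\<close>, for constants \<open>a\<close> and \<open>b\<close>.\<close>

definition surfaces :: "'a set \<Rightarrow> ('a \<Rightarrow> real) \<Rightarrow> ('a \<Rightarrow> real) \<Rightarrow> 'a set set" where
  "surfaces U f g = {{p\<in>U. f p = a \<and> g p = b} | a b. True} - {{}}"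

text \<open>\<open>biorthogonal_system \<A> G U \<F>\<^sub>1 \<F>\<^sub>2\<close>: on the domain \<open>U\<close> of some doubly biorthogonal coordinate system,
  \<open>\<F>\<^sub>1\<close> and \<open>\<F>\<^sub>2\<close> are the two mutually orthogonal families of coordinate 2-surfaces.\<close>

definition biorthogonal_system ::
    "'a chart set \<Rightarrow> 'a tensor2 \<Rightarrow> 'a set \<Rightarrow> 'a set set \<Rightarrow> 'a set set \<Rightarrow> bool" where
  "biorthogonal_system \<A> G U \<F>\<^sub>1 \<F>\<^sub>2 \<longleftrightarrow>
     (\<exists>x. (U, x) \<in> \<A> \<and> doubly_biorthogonal G (U, x) \<and>
          \<F>\<^sub>1 = surfaces U (\<lambda>p. x p $ 1) (\<lambda>p. x p $ 2) \<and>
          \<F>\<^sub>2 = surfaces U (\<lambda>p. x p $ 3) (\<lambda>p. x p $ 4))"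

definition restrict_family :: "'a set \<Rightarrow> 'a set set \<Rightarrow> 'a set set" where
  "restrict_family V \<F> = {S \<inter> V | S. S \<in> \<F>} - {{}}"

text \<open>Smooth \<open>f\<close>, \<open>g\<close> on \<open>W\<close> with \<open>df\<close>, \<open>dg\<close> linearly independent at every point.\<close>

definition conormal_pair :: "'a chart set \<Rightarrow> 'a set \<Rightarrow> ('a \<Rightarrow> real) \<Rightarrow> ('a \<Rightarrow> real) \<Rightarrow> bool" where
  "conormal_pair \<A> W f g \<longleftrightarrow> smooth_fun_on \<A> W f \<and> smooth_fun_on \<A> W g \<and>
     (\<forall>c\<in>\<A>. \<forall>p\<in>fst c \<inter> W. \<forall>a b :: real.
        (\<forall>i. a * pd c i f p + b * pd c i g p = 0) \<longrightarrow> a = 0 \<and> b = 0)"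

definition biorthogonality_pde ::
    "'a chart set \<Rightarrow> 'a tensor2 \<Rightarrow> 'a set \<Rightarrow> ('a \<Rightarrow> real) \<Rightarrow> ('a \<Rightarrow> real) \<Rightarrow> bool" where
  "biorthogonality_pde \<A> G W f g \<longleftrightarrow>
     (\<forall>c\<in>\<A>. \<forall>p\<in>fst c \<inter> W. \<forall>Y :: real^4.
        (\<Sum>i\<in>UNIV. Y $ i * pd c i f p) = 0 \<and> (\<Sum>i\<in>UNIV. Y $ i * pd c i g p) = 0 \<longrightarrow>
        (\<Sum>i\<in>UNIV. Y $ i *
           ((\<Sum>j\<in>UNIV. pd c j f p * nabla2_up G c j i g p) -
            (\<Sum>j\<in>UNIV. pd c j g p * nabla2_up G c j i f p))) = 0)"

end

theory Submission imports Defs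
begin

text \<open>
  Write \<open>X = grad f\<close> and \<open>Z = grad g\<close>. The covector in the equation is \<open>\<nabla>\<^sub>X dg - \<nabla>\<^sub>Z df\<close>, the metric dual
  of the Lie bracket \<open>[X, Z]\<close>, so the equation says that the distribution spanned by \<open>X\<close> and \<open>Z\<close>,
  the orthogonal complement of the surfaces \<open>{f = a, g = b}\<close>, is involutive. In a doubly biorthogonal
  system it is spanned by the first two coordinate fields. Conversely, in coordinates with \<open>x\<^sup>1 = f\<close>
  and \<open>x\<^sup>2 = g\<close> an involutive distribution is spanned by commuting fields
  \<open>e\<^sub>j = \<partial>\<^sub>j + a\<^sub>j\<^sup>3 \<partial>\<^sub>3 + a\<^sub>j\<^sup>4 \<partial>\<^sub>4\<close> (\<open>j = 1, 2\<close>), and following the field \<open>s e\<^sub>1 + t e\<^sub>2\<close> for unit time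
  from the surface \<open>x\<^sup>1, x\<^sup>2 = const\<close> yields the required coordinates (Frobenius). The flow and its
  smooth dependence on all parameters come from a Picard iteration in which every partial derivative
  satisfies a linear iteration with the same contraction constant.
\<close>

section \<open>Calculus of C^k functions and of their uniformly convergent sequences\<close>

text \<open>The coordinate map must be smooth on one fixed ball. Differentiating the Picard
  iteration gives a linear iteration whose coefficients are the derivatives of the fields along the
  iterates; differentiating again keeps these coefficients and changes only the inhomogeneity. So
  the factor 1/2 survives at every order and the radius does not shrink. Parametrising by rays makes
  the flow a fixed point of an operator on functions of four variables; commutativity enters once,
  to show that the derivative of the flow in direction i is the i-th field. The equation is stated
  in all charts but tests only vectors tangent to the surfaces. The tensor law of the bracket
  covector carries it from one convenient chart to all others. In a chart with x^1 = f and x^2 = g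
  the derivatives of f and g are constant, so that only derivatives of the metric survive.
  Uniqueness of the second family has another source: two systems with the same first family have
  the same orthogonal planes, so x^3, x^4 of one system are locally functions of x^3, x^4 of the
  other.\<close>

definition dpart :: "4 \<Rightarrow> (real^4 \<Rightarrow> 'b::real_normed_vector) \<Rightarrow> real^4 \<Rightarrow> 'b" where
  "dpart i F x = frechet_derivative F (at x) (axis i 1)"

lemma Ck_on_Suc:
  "Ck_on (Suc k) S F \<longleftrightarrow> F differentiable_on S \<and> (\<forall>i. Ck_on k S (dpart i F))"
  by (simp add: dpart_def[abs_def])

declare Ck_on.simps(2) [simp del]

lemma sum_axis_scaleR [simp]:
  fixes c :: "'i::finite \<Rightarrow> 'b::real_vector"
  shows "(\<Sum>i\<in>UNIV. axis j (1::real) $ i *\<^sub>R c i) = c j"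
proof -
  have "axis j 1 $ i *\<^sub>R c i = (if i = j then c i else 0)" for i by (auto simp: axis_def)
  then show ?thesis by simp
qed

lemma dpart_eqI: "(F has_derivative F') (at x) \<Longrightarrow> dpart i F x = F' (axis i 1)"
  unfolding dpart_def using frechet_derivative_at by metis

lemma has_derivative_dpart:
  assumes "F differentiable at x"
  shows "(F has_derivative (\<lambda>v. \<Sum>i\<in>UNIV. (v $ i) *\<^sub>R dpart i F x)) (at x)"
proof -
  obtain F' where F': "(F has_derivative F') (at x)"
    using assms by (auto simp: differentiable_def)
  interpret bounded_linear F' by (rule has_derivative_bounded_linear[OF F'])
  have "F' v = (\<Sum>i\<in>UNIV. (v $ i) *\<^sub>R dpart i F x)" for v
  proof -
    have "F' v = F' (\<Sum>i\<in>UNIV. (v $ i) *\<^sub>R axis i 1)"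
      using basis_expansion[of v] by (simp add: scalar_mult_eq_scaleR)
    also have "\<dots> = (\<Sum>i\<in>UNIV. (v $ i) *\<^sub>R F' (axis i 1))" by (simp add: sum scaleR)
    finally show ?thesis by (simp add: dpart_eqI[OF F'])
  qed
  then have "F' = (\<lambda>v. \<Sum>i\<in>UNIV. (v $ i) *\<^sub>R dpart i F x)" by auto
  with F' show ?thesis by simp
qed

lemma has_derivative_cong_open:
  assumes "open S" "x \<in> S" "\<And>y. y \<in> S \<Longrightarrow> F y = H y"
  shows "(F has_derivative D) (at x) \<longleftrightarrow> (H has_derivative D) (at x)"
  using has_derivative_transform_within_open[OF _ assms(1,2), of F D UNIV H]
    has_derivative_transform_within_open[OF _ assms(1,2), of H D UNIV F] assms(3) by auto

lemma dpart_cong_open: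
  assumes "open S" "x \<in> S" "\<And>y. y \<in> S \<Longrightarrow> F y = H y"
  shows "dpart i F x = dpart i H x"
  by (simp add: dpart_def frechet_derivative_def has_derivative_cong_open[OF assms])

lemma differentiable_on_cong_open:
  assumes "open S" "\<And>y. y \<in> S \<Longrightarrow> F y = H y" "F differentiable_on S"
  shows "H differentiable_on S"
proof -
  have "H differentiable at x" if "x \<in> S" for x
    using assms(3) has_derivative_cong_open[of S x F H, OF assms(1) that assms(2)] that
    unfolding differentiable_on_eq_differentiable_at[OF assms(1)] differentiable_def by blast
  then show ?thesis by (simp add: differentiable_on_eq_differentiable_at[OF assms(1)])
qed

lemma Ck_on_cong:
  assumes "open S" "\<And>y. y \<in> S \<Longrightarrow> F y = H y" "Ck_on k S F"
  shows "Ck_on k S H"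
  using assms(2,3)
proof (induction k arbitrary: F H)
  case 0
  then show ?case using continuous_on_cong by fastforce
next
  case (Suc k)
  have "Ck_on k S (dpart i H)" for i
    using Suc.IH[of "dpart i F" "dpart i H"] Suc.prems dpart_cong_open[OF assms(1), of _ F H i]
    by (auto simp: Ck_on_Suc)
  moreover have "H differentiable_on S"
    using Suc.prems differentiable_on_cong_open[OF assms(1), of F H] by (auto simp: Ck_on_Suc)
  ultimately show ?case by (simp add: Ck_on_Suc)
qed

lemma Ck_on_subset: "Ck_on k S F \<Longrightarrow> T \<subseteq> S \<Longrightarrow> Ck_on k T F"
  by (induction k arbitrary: F)
     (auto simp: Ck_on_Suc intro: continuous_on_subset differentiable_on_subset)

lemma Ck_on_SucD: "Ck_on (Suc k) S F \<Longrightarrow> Ck_on k S F"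
proof (induction k arbitrary: F)
  case 0
  then show ?case by (simp add: Ck_on_Suc differentiable_imp_continuous_on)
next
  case (Suc k)
  then show ?case by (metis Ck_on_Suc)
qed

lemma Ck_on_continuous: "Ck_on k S F \<Longrightarrow> continuous_on S F"
  by (cases k) (auto simp: Ck_on_Suc differentiable_imp_continuous_on)

lemma Ck_on_local:
  assumes "\<And>x. x \<in> S \<Longrightarrow> \<exists>T. open T \<and> x \<in> T \<and> T \<subseteq> S \<and> Ck_on k T F"
  shows "Ck_on k S F"
  using assms
proof (induction k arbitrary: F)
  case 0
  then show ?case
    by (metis Ck_on.simps(1) continuous_at_imp_continuous_on continuous_on_eq_continuous_at)
next
  case (Suc k)
  have "Ck_on k S (dpart i F)" for i
    by (rule Suc.IH) (metis Ck_on_Suc Suc.prems)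
  moreover have "F differentiable (at x)" if "x \<in> S" for x
    using Suc.prems[OF that] by (metis Ck_on_Suc differentiable_on_eq_differentiable_at)
  then have "F differentiable_on S"
    by (meson differentiable_at_withinI differentiable_on_def)
  ultimately show ?case by (simp add: Ck_on_Suc)
qed

section \<open>Sequences converging uniformly with their derivatives\<close>

text \<open>A bound uniform in n is included because products of uniformly convergent sequences need
  not converge uniformly without bounds, and continuity on an open ball bounds nothing.\<close>

definition C0_conv :: "(real^4) set \<Rightarrow> (nat \<Rightarrow> real^4 \<Rightarrow> 'b::real_normed_vector) \<Rightarrow> bool" where
  "C0_conv S F \<longleftrightarrow> (\<forall>n. continuous_on S (F n)) \<and> (\<exists>B. \<forall>n. \<forall>x\<in>S. norm (F n x) \<le> B) \<and>
     uniformly_convergent_on S F"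

text \<open>The limits of the derivatives are not named; \<open>Ck_conv_limit\<close> identifies
  them afterwards. A single function is treated as a constant sequence, so one calculus serves
  both.\<close>

primrec Ck_conv ::
    "nat \<Rightarrow> (real^4) set \<Rightarrow> (nat \<Rightarrow> real^4 \<Rightarrow> 'b::real_normed_vector) \<Rightarrow> bool" where
  "Ck_conv 0 S F \<longleftrightarrow> C0_conv S F"
| "Ck_conv (Suc k) S F \<longleftrightarrow> C0_conv S F \<and> (\<forall>n. F n differentiable_on S) \<and>
     (\<forall>i. Ck_conv k S (\<lambda>n. dpart i (F n)))"

lemma Ck_conv_C0: "Ck_conv k S F \<Longrightarrow> C0_conv S F"
  by (cases k) auto

lemma Ck_conv_SucD: "Ck_conv (Suc k) S F \<Longrightarrow> Ck_conv k S F"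
proof (induction k arbitrary: F)
  case (Suc k)
  then show ?case by (metis Ck_conv.simps(2))
qed auto

lemma Ck_conv_imp_Ck_on: "Ck_conv k S F \<Longrightarrow> Ck_on k S (F n)"
proof (induction k arbitrary: F)
  case 0
  then show ?case by (simp add: C0_conv_def)
next
  case (Suc k)
  have "Ck_on k S (dpart i (F n))" for i using Suc.IH[of "\<lambda>n. dpart i (F n)"] Suc.prems by simp
  with Suc.prems show ?case by (simp add: Ck_on_Suc)
qed

lemma C0_conv_cong:
  assumes "\<And>n y. y \<in> S \<Longrightarrow> F n y = H n y" "C0_conv S F"
  shows "C0_conv S H"
proof -
  have "uniformly_convergent_on S F \<longleftrightarrow> uniformly_convergent_on S H"
    using assms(1) by (intro uniformly_convergent_cong) auto
  moreover have "continuous_on S (F n) \<longleftrightarrow> continuous_on S (H n)" for n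
    using assms(1) by (intro continuous_on_cong) auto
  moreover have "(\<forall>x\<in>S. norm (F n x) \<le> B) \<longleftrightarrow> (\<forall>x\<in>S. norm (H n x) \<le> B)" for n B
    using assms(1) by auto
  ultimately show ?thesis using assms(2) unfolding C0_conv_def by simp
qed

lemma Ck_conv_cong:
  assumes "open S" "\<And>n y. y \<in> S \<Longrightarrow> F n y = H n y" "Ck_conv k S F"
  shows "Ck_conv k S H"
  using assms(2,3)
proof (induction k arbitrary: F H)
  case 0
  then show ?case using C0_conv_cong[of S F H] by auto
next
  case (Suc k)
  have "Ck_conv k S (\<lambda>n. dpart i (H n))" for i
    using Suc.IH[of "\<lambda>n. dpart i (F n)" "\<lambda>n. dpart i (H n)"] Suc.prems
      dpart_cong_open[OF assms(1), of _ "F n" "H n" i for n] by auto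
  moreover have "H n differentiable_on S" for n
    using Suc.prems differentiable_on_cong_open[OF assms(1), of "F n" "H n"] by auto
  moreover have "C0_conv S H" using C0_conv_cong[of S F H] Suc.prems by auto
  ultimately show ?case by simp
qed

text \<open>The compact set between T and S provides the bounds that \<open>C0_conv\<close> demands
  of F and of its derivatives.\<close>

lemma Ck_on_imp_conv_const:
  assumes "Ck_on k S F" "compact K" "T \<subseteq> K" "K \<subseteq> S"
  shows "Ck_conv k T (\<lambda>_. F)"
  using assms(1)
proof (induction k arbitrary: F)
  have C0: "C0_conv T (\<lambda>_. F)" if "continuous_on S F" for F :: "real^4 \<Rightarrow> 'a"
  proof -
    have "compact (F ` K)"
      using assms that by (meson compact_continuous_image continuous_on_subset)
    then obtain B where "\<And>x. x \<in> K \<Longrightarrow> norm (F x) \<le> B"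
      by (meson compact_imp_bounded bounded_iff imageI)
    moreover have "uniformly_convergent_on T (\<lambda>_. F)"
      by (intro uniformly_convergentI[of _ _ F] uniform_limit_const)
    moreover have "continuous_on T F" using assms that continuous_on_subset by (metis order_trans)
    ultimately show ?thesis using assms(3) unfolding C0_conv_def by blast
  qed
  { case 0
    then show ?case using C0 by auto }
  { case (Suc k)
    then have "F differentiable_on T"
      using assms(3,4) by (meson Ck_on_Suc differentiable_on_subset order_trans)
    with Suc show ?case using C0[of F] by (auto simp: Ck_on_Suc differentiable_imp_continuous_on) }
qed

text \<open>Being C^k is local, and a constant sequence converges on a small ball only if its member
  is C^k there. Every closure rule for sequences thus yields the rule for functions without a second
  induction.\<close>

lemma Ck_on_via_conv:
  assumes "open S" "\<And>x r. x \<in> S \<Longrightarrow> r > 0 \<Longrightarrow> cball x r \<subseteq> S \<Longrightarrow> Ck_conv k (ball x r) (\<lambda>_. F)"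
  shows "Ck_on k S F"
proof (rule Ck_on_local)
  fix x assume "x \<in> S"
  then obtain r where r: "r > 0" "cball x r \<subseteq> S" using assms(1) open_contains_cball by blast
  then have "Ck_on k (ball x r) F"
    using Ck_conv_imp_Ck_on[OF assms(2)[OF \<open>x \<in> S\<close> r]] by simp
  then show "\<exists>T. open T \<and> x \<in> T \<and> T \<subseteq> S \<and> Ck_on k T F"
    using r ball_subset_cball[of x r] by (intro exI[of _ "ball x r"]) auto
qed

lemma Ck_conv_of_Ck_on:
  "Ck_on k S F \<Longrightarrow> cball x r \<subseteq> S \<Longrightarrow> Ck_conv k (ball x r) (\<lambda>_. F)"
  using Ck_on_imp_conv_const[of k S F "cball x r" "ball x r"] by auto

lemma C0_conv_const [simp]: "C0_conv S (\<lambda>n x. c)"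
  unfolding C0_conv_def by auto

lemma Ck_conv_const [simp]: "Ck_conv k S (\<lambda>n x. c)"
proof (induction k arbitrary: c)
  case (Suc k)
  have "dpart i (\<lambda>x. c) = (\<lambda>x. 0)" for i
    by (rule ext, subst dpart_eqI[where F' = "\<lambda>_. 0"]) auto
  with Suc[of 0] show ?case by simp
qed simp

lemma Ck_on_const [simp]: "Ck_on k S (\<lambda>x. c)"
  using Ck_conv_imp_Ck_on[OF Ck_conv_const] by metis

lemma Ck_on_linear:
  assumes "bounded_linear L"
  shows "Ck_on k S L"
proof (cases k)
  case 0
  then show ?thesis using assms by (simp add: linear_continuous_on)
next
  case (Suc l)
  have "dpart i L = (\<lambda>x. L (axis i 1))" for i
    by (rule ext, rule dpart_eqI) (simp add: assms bounded_linear_imp_has_derivative)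
  then show ?thesis unfolding Suc Ck_on_Suc
    by (auto intro!: bounded_linear_imp_differentiable_on assms)
qed

lemma Ck_conv_linear:
  assumes "bounded_linear L" "bounded S"
  shows "Ck_conv k S (\<lambda>n. L)"
  using Ck_on_imp_conv_const[of k UNIV L "closure S" S] Ck_on_linear[OF assms(1)] assms(2)
  by (auto simp: closure_subset)

lemma C0_conv_bilinear:
  assumes "bounded_bilinear bop" "C0_conv S F" "C0_conv S H"
  shows "C0_conv S (\<lambda>n x. bop (F n x) (H n x))"
proof -
  interpret bounded_bilinear bop by fact
  obtain A where A: "\<And>n x. x \<in> S \<Longrightarrow> norm (F n x) \<le> A" using assms(2) C0_conv_def by meson
  obtain B where B: "\<And>n x. x \<in> S \<Longrightarrow> norm (H n x) \<le> B" using assms(3) C0_conv_def by meson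
  obtain f where f: "uniform_limit S F f sequentially"
    using assms(2) by (auto simp: C0_conv_def uniformly_convergent_on_def)
  obtain h where h: "uniform_limit S H h sequentially"
    using assms(3) by (auto simp: C0_conv_def uniformly_convergent_on_def)
  \<comment> \<open>The pointwise limits inherit the bounds, as the product theorem for uniform
    limits asks for bounded limits.\<close>
  have lb: "bounded (l ` S)" if "uniform_limit S U l sequentially"
      "\<And>n x. x \<in> S \<Longrightarrow> norm (U n x) \<le> C" for U :: "nat \<Rightarrow> real^4 \<Rightarrow> 'd::real_normed_vector" and l C
  proof -
    note * = that
    have "norm (l x) \<le> C" if x: "x \<in> S" for x
      using tendsto_uniform_limitI[OF *(1) x]
      by (rule tendsto_upperbound[OF tendsto_norm]) (use *(2)[OF x] in \<open>auto intro!: always_eventually\<close>)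
    then show ?thesis by (auto simp: bounded_iff)
  qed
  have "uniform_limit S (\<lambda>n x. bop (F n x) (H n x)) (\<lambda>x. bop (f x) (h x)) sequentially"
    by (intro bounded_uniform_limit f h lb[OF f A] lb[OF h B])
  moreover have "continuous_on S (\<lambda>x. bop (F n x) (H n x))" for n
    using assms(2,3) by (intro continuous_on) (auto simp: C0_conv_def)
  moreover obtain K where K: "K \<ge> 0" "\<And>a b. norm (bop a b) \<le> norm a * norm b * K"
    using nonneg_bounded by blast
  have "norm (bop (F n x) (H n x)) \<le> A * B * K" if "x \<in> S" for n x
  proof -
    have "norm (bop (F n x) (H n x)) \<le> norm (F n x) * norm (H n x) * K" by (rule K)
    also have "\<dots> \<le> A * B * K"
      using A[OF that, of n] B[OF that, of n] K(1)
      by (intro mult_right_mono mult_mono) (auto intro: order_trans[OF norm_ge_zero])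
    finally show ?thesis .
  qed
  ultimately show ?thesis unfolding C0_conv_def uniformly_convergent_on_def by blast
qed

lemma C0_conv_add:
  assumes "C0_conv S F" "C0_conv S H"
  shows "C0_conv S (\<lambda>n x. F n x + H n x)"
proof -
  obtain A where A: "\<And>n x. x \<in> S \<Longrightarrow> norm (F n x) \<le> A" using assms(1) C0_conv_def by meson
  obtain B where B: "\<And>n x. x \<in> S \<Longrightarrow> norm (H n x) \<le> B" using assms(2) C0_conv_def by meson
  have "norm (F n x + H n x) \<le> A + B" if "x \<in> S" for n x
    using norm_triangle_mono[OF A[OF that] B[OF that]] .
  moreover have "uniformly_convergent_on S (\<lambda>n x. F n x + H n x)"
    using assms unfolding C0_conv_def uniformly_convergent_on_def by (blast dest: uniform_limit_add)
  ultimately show ?thesis using assms unfolding C0_conv_def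
    by (blast intro: continuous_on_add)
qed

lemma Ck_conv_add:
  assumes "open S" "Ck_conv k S F" "Ck_conv k S H"
  shows "Ck_conv k S (\<lambda>n x. F n x + H n x)"
  using assms(2,3)
proof (induction k arbitrary: F H)
  case 0
  then show ?case by (simp add: C0_conv_add)
next
  case (Suc k)
  have d: "F n differentiable at x" "H n differentiable at x" if "x \<in> S" for n x
    using Suc.prems that assms(1) by (auto simp: differentiable_on_eq_differentiable_at)
  have "dpart i (\<lambda>x. F n x + H n x) x = dpart i (F n) x + dpart i (H n) x" if "x \<in> S" for i n x
    using dpart_eqI[OF has_derivative_add[OF has_derivative_dpart[OF d(1)[OF that]]
        has_derivative_dpart[OF d(2)[OF that]]], of i n n] by simp
  moreover have "Ck_conv k S (\<lambda>n x. dpart i (F n) x + dpart i (H n) x)" for i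
    using Suc.prems by (intro Suc.IH) auto
  ultimately have "Ck_conv k S (\<lambda>n. dpart i (\<lambda>x. F n x + H n x))" for i
    using Ck_conv_cong[OF assms(1), of "\<lambda>n x. dpart i (F n) x + dpart i (H n) x"
      "\<lambda>n. dpart i (\<lambda>x. F n x + H n x)"] by auto
  with Suc.prems show ?case by (auto simp: C0_conv_add)
qed

lemma Ck_conv_sum:
  assumes "open S" "\<And>j. j \<in> J \<Longrightarrow> Ck_conv k S (F j)"
  shows "Ck_conv k S (\<lambda>n x. \<Sum>j\<in>J. F j n x)"
  using assms(2)
  by (induction J rule: infinite_finite_induct) (auto intro!: Ck_conv_add assms(1))

text \<open>Leibniz rule: each summand of a partial derivative pairs one differentiated with one
  undifferentiated factor, so the induction hypothesis applies after lowering the order of the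
  latter.\<close>

lemma Ck_conv_bilinear:
  assumes "bounded_bilinear bop" "open S" "Ck_conv k S F" "Ck_conv k S H"
  shows "Ck_conv k S (\<lambda>n x. bop (F n x) (H n x))"
  using assms(3,4)
proof (induction k arbitrary: F H)
  case 0
  then show ?case by (simp add: C0_conv_bilinear[OF assms(1)])
next
  case (Suc k)
  interpret bounded_bilinear bop by fact
  have d: "F n differentiable at x" "H n differentiable at x" if "x \<in> S" for n x
    using Suc.prems that assms(2) by (auto simp: differentiable_on_eq_differentiable_at)
  have D: "((\<lambda>x. bop (F n x) (H n x)) has_derivative
      (\<lambda>v. bop (F n x) (\<Sum>i\<in>UNIV. (v $ i) *\<^sub>R dpart i (H n) x)
         + bop (\<Sum>i\<in>UNIV. (v $ i) *\<^sub>R dpart i (F n) x) (H n x))) (at x)"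
    if "x \<in> S" for n x
    by (rule FDERIV[OF has_derivative_dpart[OF d(1)[OF that]] has_derivative_dpart[OF d(2)[OF that]]])
  have "dpart i (\<lambda>x. bop (F n x) (H n x)) x
      = bop (F n x) (dpart i (H n) x) + bop (dpart i (F n) x) (H n x)" if "x \<in> S" for i n x
    by (subst dpart_eqI[OF D[OF that]]) simp
  moreover have "Ck_conv k S (\<lambda>n x. bop (F n x) (dpart i (H n) x) + bop (dpart i (F n) x) (H n x))" for i
    using Suc.prems Ck_conv_SucD[OF Suc.prems(1)] Ck_conv_SucD[OF Suc.prems(2)]
    by (intro Ck_conv_add[OF assms(2)] Suc.IH) auto
  ultimately have "Ck_conv k S (\<lambda>n. dpart i (\<lambda>x. bop (F n x) (H n x)))" for i
    using Ck_conv_cong[OF assms(2), of "\<lambda>n x. bop (F n x) (dpart i (H n) x) + bop (dpart i (F n) x) (H n x)"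
      "\<lambda>n. dpart i (\<lambda>x. bop (F n x) (H n x))"] by auto
  moreover have "(\<lambda>x. bop (F n x) (H n x)) differentiable_on S" for n
    using D by (auto simp: differentiable_on_eq_differentiable_at[OF assms(2)] differentiable_def)
  ultimately show ?case using Suc.prems by (auto simp: C0_conv_bilinear[OF assms(1)])
qed

lemma Ck_conv_linear_comp:
  assumes "bounded_linear L" "open S" "Ck_conv k S F"
  shows "Ck_conv k S (\<lambda>n x. L (F n x))"
proof -
  \<comment> \<open>A linear map becomes bilinear by inserting a scalar factor, which is then taken
    to be the constant 1.\<close>
  have "bounded_bilinear (\<lambda>(r::real) y. L (r *\<^sub>R y))"
    using bounded_bilinear.comp[OF bounded_bilinear_scaleR bounded_linear_ident assms(1)]
    by (simp add: linear_scale[OF bounded_linear.linear[OF assms(1)]])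
  from Ck_conv_bilinear[OF this assms(2) Ck_conv_const[of k S 1] assms(3)] show ?thesis by simp
qed

lemma dpart_compose:
  assumes "H differentiable at x" "F differentiable at (H x)"
  shows "(\<lambda>x. F (H x)) differentiable at x"
    and "dpart i (\<lambda>x. F (H x)) x = (\<Sum>l\<in>UNIV. (dpart i H x $ l) *\<^sub>R dpart l F (H x))"
proof -
  have D: "((\<lambda>x. F (H x)) has_derivative
      (\<lambda>v. \<Sum>l\<in>UNIV. ((\<Sum>i\<in>UNIV. (v $ i) *\<^sub>R dpart i H x) $ l) *\<^sub>R dpart l F (H x))) (at x)"
    by (rule has_derivative_compose[OF has_derivative_dpart[OF assms(1)] has_derivative_dpart[OF assms(2)]])
  then show "(\<lambda>x. F (H x)) differentiable at x" by (auto simp: differentiable_def)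
  show "dpart i (\<lambda>x. F (H x)) x = (\<Sum>l\<in>UNIV. (dpart i H x $ l) *\<^sub>R dpart l F (H x))"
    using dpart_eqI[OF D, of i] by simp
qed

text \<open>All values of the sequence lie in one compact K, where F is bounded and uniformly
  continuous; this preserves uniform convergence. H stays fixed in the induction while F is replaced
  by its partial derivatives.\<close>

lemma Ck_conv_compose:
  assumes "open S" "open T" "compact K" "K \<subseteq> T" "Ck_on k T F" "Ck_conv k S H"
    and HK: "\<And>n x. x \<in> S \<Longrightarrow> H n x \<in> K"
  shows "Ck_conv k S (\<lambda>n x. F (H n x))"
  using assms(5,6)
proof (induction k arbitrary: F)
  have C0: "C0_conv S (\<lambda>n x. F (H n x))" if "continuous_on T F" "C0_conv S H"
    for F :: "real^4 \<Rightarrow> 'a"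
  proof -
    have cK: "continuous_on K F" using that assms(4) continuous_on_subset by blast
    then have "compact (F ` K)" using assms(3) compact_continuous_image by blast
    then obtain B where "\<And>x. x \<in> K \<Longrightarrow> norm (F x) \<le> B"
      by (meson compact_imp_bounded bounded_iff imageI)
    moreover have "uniformly_convergent_on S (\<lambda>n x. F (H n x))"
      by (rule uniformly_convergent_on_compose_uniformly_continuous_on[OF _ compact_uniformly_continuous[OF cK assms(3)]])
         (use that HK assms(3) in \<open>auto simp: C0_conv_def compact_imp_closed\<close>)
    moreover have "continuous_on S (\<lambda>x. F (H n x))" for n
      using that HK by (intro continuous_on_compose2[OF cK]) (auto simp: C0_conv_def)
    ultimately show ?thesis using HK unfolding C0_conv_def by blast
  qed
  { case 0
    then show ?case using C0 by simp }
  { case (Suc k)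
    have d: "H n differentiable at x" "F differentiable at (H n x)" if "x \<in> S" for n x
      using Suc.prems that HK[OF that, of n] assms(1,2,4)
      by (auto simp: Ck_on_Suc differentiable_on_eq_differentiable_at)
    have "Ck_conv k S (\<lambda>n x. \<Sum>l\<in>UNIV. (dpart i (H n) x $ l) *\<^sub>R dpart l F (H n x))" for i
      using Suc.prems Ck_conv_SucD[OF Suc.prems(2)] assms(1)
      by (intro Ck_conv_sum Ck_conv_bilinear[OF bounded_bilinear_scaleR] Suc.IH
          Ck_conv_linear_comp[OF bounded_linear_vec_nth]) (auto simp: Ck_on_Suc)
    then have "Ck_conv k S (\<lambda>n. dpart i (\<lambda>x. F (H n x)))" for i
      using Ck_conv_cong[OF assms(1), of "\<lambda>n x. \<Sum>l\<in>UNIV. (dpart i (H n) x $ l) *\<^sub>R dpart l F (H n x)"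
          "\<lambda>n. dpart i (\<lambda>x. F (H n x))"] dpart_compose(2)[OF d] by auto
    moreover have "(\<lambda>x. F (H n x)) differentiable_on S" for n
      using dpart_compose(1)[OF d] by (simp add: differentiable_on_eq_differentiable_at[OF assms(1)])
    moreover have "C0_conv S (\<lambda>n x. F (H n x))"
      using Suc.prems by (intro C0) (auto dest: Ck_on_continuous)
    ultimately show ?case by simp }
qed

section \<open>Closure rules for C^k functions\<close>

lemma Ck_on_add:
  "open S \<Longrightarrow> Ck_on k S F \<Longrightarrow> Ck_on k S H \<Longrightarrow> Ck_on k S (\<lambda>x. F x + H x)"
  by (rule Ck_on_via_conv) (auto intro: Ck_conv_add Ck_conv_of_Ck_on)

lemma Ck_on_sum:
  "open S \<Longrightarrow> (\<And>j. j \<in> J \<Longrightarrow> Ck_on k S (F j)) \<Longrightarrow> Ck_on k S (\<lambda>x. \<Sum>j\<in>J. F j x)"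
  by (rule Ck_on_via_conv) (auto intro!: Ck_conv_sum intro: Ck_conv_of_Ck_on)

lemma Ck_on_bilinear:
  "bounded_bilinear bop \<Longrightarrow> open S \<Longrightarrow> Ck_on k S F \<Longrightarrow> Ck_on k S H \<Longrightarrow>
    Ck_on k S (\<lambda>x. bop (F x) (H x))"
  by (rule Ck_on_via_conv) (auto intro: Ck_conv_bilinear Ck_conv_of_Ck_on)

lemmas Ck_on_mult = Ck_on_bilinear[OF bounded_bilinear_mult]
  and Ck_on_scaleR = Ck_on_bilinear[OF bounded_bilinear_scaleR]

lemma Ck_on_linear_comp:
  "bounded_linear L \<Longrightarrow> open S \<Longrightarrow> Ck_on k S F \<Longrightarrow> Ck_on k S (\<lambda>x. L (F x))"
  by (rule Ck_on_via_conv) (auto intro: Ck_conv_linear_comp Ck_conv_of_Ck_on)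

lemmas Ck_on_minus = Ck_on_linear_comp[OF bounded_linear_minus[OF bounded_linear_ident]]
  and Ck_on_nth = Ck_on_linear_comp[OF bounded_linear_vec_nth]

lemma Ck_on_diff:
  "open S \<Longrightarrow> Ck_on k S F \<Longrightarrow> Ck_on k S H \<Longrightarrow> Ck_on k S (\<lambda>x. F x - H x)"
  using Ck_on_add[OF _ _ Ck_on_minus, of S k F H] by simp

lemma Ck_on_compose:
  assumes "open S" "open T" "Ck_on k T F" "Ck_on k S H" "\<And>x. x \<in> S \<Longrightarrow> H x \<in> T"
  shows "Ck_on k S (\<lambda>x. F (H x))"
proof (rule Ck_on_via_conv[OF assms(1)])
  fix x and r :: real assume r: "cball x r \<subseteq> S"
  have "compact (H ` cball x r)"
    using Ck_on_continuous[OF assms(4)] r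
    by (intro compact_continuous_image compact_cball) (auto intro: continuous_on_subset)
  then show "Ck_conv k (ball x r) (\<lambda>_ x. F (H x))"
    using r by (intro Ck_conv_compose[OF _ assms(2) _ _ assms(3) Ck_conv_of_Ck_on[OF assms(4) r],
        of "H ` cball x r"]) (auto intro!: assms(5))
qed

lemma Ck_on_vecI:
  fixes F :: "real^4 \<Rightarrow> 'b::euclidean_space^'n"
  assumes "open S" "\<And>i. Ck_on k S (\<lambda>x. F x $ i)"
  shows "Ck_on k S F"
proof -
  have "bounded_linear (axis i :: 'b \<Rightarrow> 'b^'n)" for i
    by (rule bounded_linearI') (auto simp: axis_def vec_eq_iff)
  then have "Ck_on k S (\<lambda>x. axis i (F x $ i))" for i
    using Ck_on_linear_comp[of "axis i" S k "\<lambda>x. F x $ i"] assms by blast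
  then have "Ck_on k S (\<lambda>x. \<Sum>i\<in>UNIV. axis i (F x $ i))"
    using assms(1) by (intro Ck_on_sum)
  moreover have "(\<Sum>i\<in>UNIV. axis i (F x $ i)) = F x" for x
  proof -
    have "axis i (F x $ i) $ j = (if j = i then F x $ i else 0)" for i j by (simp add: axis_def)
    then show ?thesis by (simp add: vec_eq_iff)
  qed
  ultimately show ?thesis by simp
qed

text \<open>The derivative of 1/F contains 1/F itself only undifferentiated, so order k of the
  inverse yields order k + 1.\<close>

lemma Ck_on_inverse:
  fixes F :: "real^4 \<Rightarrow> real"
  assumes "open S" "Ck_on k S F" "\<And>x. x \<in> S \<Longrightarrow> F x \<noteq> 0"
  shows "Ck_on k S (\<lambda>x. inverse (F x))"
  using assms(2)
proof (induction k)
  case 0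
  then show ?case using assms(3) continuous_on_inverse[of S F] by simp
next
  case (Suc k)
  have d: "F differentiable at x" if "x \<in> S" for x
    using Suc.prems that assms(1) by (auto simp: Ck_on_Suc differentiable_on_eq_differentiable_at)
  have D: "((\<lambda>x. inverse (F x)) has_derivative
      (\<lambda>v. - (inverse (F x) * (\<Sum>i\<in>UNIV. (v $ i) *\<^sub>R dpart i F x) * inverse (F x)))) (at x)"
    if "x \<in> S" for x
    by (rule Deriv.has_derivative_inverse[OF assms(3)[OF that] has_derivative_dpart[OF d[OF that]]])
  have *: "dpart i (\<lambda>x. inverse (F x)) x = - (inverse (F x) * dpart i F x * inverse (F x))"
    if "x \<in> S" for x i
    using dpart_eqI[OF D[OF that], of i]
    unfolding sum_axis_scaleR .
  have C: "Ck_on k S (\<lambda>x. - (inverse (F x) * dpart i F x * inverse (F x)))" for i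
    using Suc.prems Ck_on_SucD[OF Suc.prems]
    by (intro Ck_on_minus Ck_on_mult assms(1) Suc.IH) (auto simp: Ck_on_Suc)
  have "Ck_on k S (dpart i (\<lambda>x. inverse (F x)))" for i
    by (rule Ck_on_cong[OF assms(1) *[symmetric] C])
  moreover have "(\<lambda>x. inverse (F x)) differentiable_on S"
    using D by (auto simp: differentiable_on_eq_differentiable_at[OF assms(1)] differentiable_def)
  ultimately show ?case by (simp add: Ck_on_Suc)
qed

lemma Ck_on_prod:
  fixes F :: "'j \<Rightarrow> real^4 \<Rightarrow> real"
  shows "open S \<Longrightarrow> (\<And>j. j \<in> J \<Longrightarrow> Ck_on k S (F j)) \<Longrightarrow> Ck_on k S (\<lambda>x. \<Prod>j\<in>J. F j x)"
  by (induction J rule: infinite_finite_induct) (auto intro!: Ck_on_mult)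

lemma Ck_on_det:
  fixes M :: "real^4 \<Rightarrow> real^'n^'n"
  assumes "open S" "\<And>i j. Ck_on k S (\<lambda>x. M x $ i $ j)"
  shows "Ck_on k S (\<lambda>x. det (M x))"
  unfolding det_def using assms by (intro Ck_on_sum Ck_on_mult Ck_on_prod Ck_on_const) auto

lemma matrix_inv_inverse:
  assumes "invertible A"
  shows "A ** matrix_inv A = mat 1" "matrix_inv A ** A = mat 1"
  using someI_ex[OF assms[unfolded invertible_def]] by (simp_all add: matrix_inv_def)

lemma Ck_on_matrix_inv:
  fixes M :: "real^4 \<Rightarrow> real^'n^'n"
  assumes "open S" "\<And>i j. Ck_on k S (\<lambda>x. M x $ i $ j)" "\<And>x. x \<in> S \<Longrightarrow> invertible (M x)"
  shows "Ck_on k S (\<lambda>x. matrix_inv (M x) $ i $ j)"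
proof -
  \<comment> \<open>Cramer's rule: an entry of the inverse is a determinant formed from entries of M
    and constants, divided by the determinant of M.\<close>
  have *: "matrix_inv (M x) $ i $ j
      = det (\<chi> a b. if b = i then axis j 1 $ a else M x $ a $ b) * inverse (det (M x))"
    if "x \<in> S" for x
  proof -
    have "M x ** matrix_inv (M x) = mat 1"
      using assms(3)[OF that] by (rule matrix_inv_inverse)
    then have "M x *v (matrix_inv (M x) *v axis j 1) = axis j 1"
      by (simp add: matrix_vector_mul_assoc)
    then have "matrix_inv (M x) *v axis j 1
        = (\<chi> k. det (\<chi> a b. if b = k then axis j 1 $ a else M x $ a $ b) / det (M x))"
      using cramer[of "M x"] assms(3)[OF that] invertible_det_nz by blast
    then have "(matrix_inv (M x) *v axis j 1) $ i
        = det (\<chi> a b. if b = i then axis j 1 $ a else M x $ a $ b) / det (M x)"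
      by simp
    then show ?thesis by (simp add: matrix_vector_mult_basis column_def divide_inverse)
  qed
  have "Ck_on k S (\<lambda>x. (\<chi> a b. if b = i then axis j 1 $ a else M x $ a $ b) $ a' $ b')" for a' b'
    using assms(2) by (cases "b' = i") simp_all
  then have "Ck_on k S (\<lambda>x. det (\<chi> a b. if b = i then axis j 1 $ a else M x $ a $ b) * inverse (det (M x)))"
    using assms(3) invertible_det_nz
    by (intro Ck_on_mult Ck_on_det Ck_on_inverse assms(1,2)) blast+
  then show ?thesis by (rule Ck_on_cong[OF assms(1), rotated]) (simp add: *)
qed

section \<open>Radial integral operators\<close>

text \<open>Let \<open>\<psi> x\<close> be the time-one flow of \<open>\<Sum>j\<in>I. x\<^sub>j e\<^sub>j\<close> started at \<open>y0 + rad I 0 x\<close>. The time-\<open>t\<close> flow is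
  then \<open>\<psi> (rad I t x)\<close>, so the flow equation reads \<open>\<psi> = y0 + rad I 0 + rop I 0 (e \<circ> \<psi>)\<close>, in which
  time does not occur as a variable.\<close>

definition rad :: "4 set \<Rightarrow> real \<Rightarrow> real^4 \<Rightarrow> real^4" where
  "rad I t x = (\<chi> i. if i \<in> I then t * x $ i else x $ i)"

definition rint :: "4 set \<Rightarrow> nat \<Rightarrow> (real^4 \<Rightarrow> 'b::banach) \<Rightarrow> real^4 \<Rightarrow> 'b" where
  "rint I m h x = integral {0..1} (\<lambda>t. t ^ m *\<^sub>R h (rad I t x))"

definition rop :: "4 set \<Rightarrow> nat \<Rightarrow> (4 \<Rightarrow> real^4 \<Rightarrow> 'b::banach) \<Rightarrow> real^4 \<Rightarrow> 'b" where
  "rop I m h x = (\<Sum>j\<in>I. (x $ j) *\<^sub>R rint I m (h j) x)"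

lemma rad_1 [simp]: "rad I 1 x = x"
  by (simp add: rad_def vec_eq_iff)

lemma norm_rad_le: "t \<in> {0..1} \<Longrightarrow> norm (rad I t x) \<le> norm x"
  by (rule norm_le_componentwise_cart) (auto simp: rad_def abs_mult mult_left_le_one_le)

lemma rad_in_ball: "t \<in> {0..1} \<Longrightarrow> x \<in> ball 0 \<delta> \<Longrightarrow> rad I t x \<in> ball 0 \<delta>"
  using norm_rad_le[of t I x] by auto

lemma continuous_on_rad [continuous_intros]:
  assumes "continuous_on A t" "continuous_on A x"
  shows "continuous_on A (\<lambda>y. rad I (t y) (x y))"
proof -
  have "continuous_on A (\<lambda>y. if i \<in> I then t y * x y $ i else x y $ i)" for i
    by (cases "i \<in> I") (auto intro!: continuous_intros assms)
  then show ?thesis unfolding rad_def by (intro continuous_on_vec_lambda)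
qed

lemma bounded_linear_rad: "bounded_linear (rad I t)"
  by (rule bounded_linearI') (auto simp: rad_def vec_eq_iff algebra_simps)

lemma rad_axis: "rad I t (axis i 1) = (if i \<in> I then t else 1) *\<^sub>R axis i 1"
  by (auto simp: rad_def vec_eq_iff axis_def)

lemma continuous_on_rint_integrand:
  fixes h :: "real^4 \<Rightarrow> 'b::real_normed_vector"
  assumes "continuous_on (ball 0 \<delta>) h" "x \<in> ball 0 \<delta>"
  shows "continuous_on {0..1} (\<lambda>t. t ^ m *\<^sub>R h (rad I t x))"
proof -
  have "continuous_on {0..1} (\<lambda>t. h (rad I t x))"
    by (rule continuous_on_compose2[OF assms(1)])
       (use rad_in_ball[OF _ assms(2)] in \<open>auto intro!: continuous_intros\<close>)
  then show ?thesis by (intro continuous_intros)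
qed

lemmas rint_integrable = integrable_continuous_real[OF continuous_on_rint_integrand]

text \<open>The ray ending in x never leaves the closed ball through x, since \<open>rad\<close>
  does not increase the norm. Bounding h on that ball only, and not on the whole domain, later
  permits evaluation at a point of maximal norm.\<close>

lemma norm_rint_le:
  assumes "continuous_on (ball 0 \<delta>) h" "x \<in> ball 0 \<delta>"
    and "\<And>y. norm y \<le> norm x \<Longrightarrow> norm (h y) \<le> B"
  shows "norm (rint I m h x) \<le> B"
proof -
  have B: "B \<ge> 0" using assms(3)[of x] norm_ge_zero order_trans by blast
  have "norm (rint I m h x) \<le> B * (1 - 0)" unfolding rint_def
  proof (rule integral_bound[OF _ continuous_on_rint_integrand[OF assms(1,2)]])
    fix t :: real assume t: "t \<in> {0..1}"
    have "norm (t ^ m *\<^sub>R h (rad I t x)) = t ^ m * norm (h (rad I t x))" using t by simp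
    also have "\<dots> \<le> 1 * B"
      using t B assms(3)[OF norm_rad_le[OF t]] by (intro mult_mono power_le_one) auto
    finally show "norm (t ^ m *\<^sub>R h (rad I t x)) \<le> B" by simp
  qed simp
  then show ?thesis by simp
qed

lemma rint_cong:
  assumes "\<And>y. y \<in> ball 0 \<delta> \<Longrightarrow> h y = h' y" "x \<in> ball 0 \<delta>"
  shows "rint I m h x = rint I m h' x"
  unfolding rint_def using assms(1)[OF rad_in_ball[OF _ assms(2)]]
  by (intro Henstock_Kurzweil_Integration.integral_cong) auto

lemma rint_add:
  assumes "continuous_on (ball 0 \<delta>) h" "continuous_on (ball 0 \<delta>) h'" "x \<in> ball 0 \<delta>"
  shows "rint I m (\<lambda>y. h y + h' y) x = rint I m h x + rint I m h' x"
  unfolding rint_def scaleR_add_right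
  by (intro integral_add rint_integrable[OF assms(1,3)] rint_integrable[OF assms(2,3)])

lemma rint_diff:
  assumes "continuous_on (ball 0 \<delta>) h" "continuous_on (ball 0 \<delta>) h'" "x \<in> ball 0 \<delta>"
  shows "rint I m (\<lambda>y. h y - h' y) x = rint I m h x - rint I m h' x"
  unfolding rint_def scaleR_diff_right
  by (intro integral_diff rint_integrable[OF assms(1,3)] rint_integrable[OF assms(2,3)])

lemma continuous_on_rint:
  assumes "continuous_on (ball 0 \<delta>) h"
  shows "continuous_on (ball 0 \<delta>) (rint I m h)"
proof -
  have "continuous_on (ball 0 \<delta> \<times> cbox 0 1) (\<lambda>(x, t). t ^ m *\<^sub>R h (rad I t x))"
    unfolding split_beta using rad_in_ball
    by (intro continuous_intros continuous_on_compose2[OF assms]) auto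
  from integral_continuous_on_param[OF this] show ?thesis
    unfolding rint_def[abs_def] by simp
qed

text \<open>Differentiation under the integral sign; the exponent rises exactly in the directions
  that are scaled by t.\<close>

lemma rint_dpart:
  assumes "Ck_on (Suc 0) (ball 0 \<delta>) h" "x \<in> ball 0 \<delta>"
  shows "rint I m h differentiable at x"
    and "dpart i (rint I m h) x = rint I (if i \<in> I then Suc m else m) (dpart i h) x"
proof -
  let ?S = "ball 0 \<delta> :: (real^4) set"
  define D where "D i x t = t ^ (if i \<in> I then Suc m else m) *\<^sub>R dpart i h (rad I t x)" for i x t
  have dc: "continuous_on ?S (dpart i h)" for i using assms(1) by (simp add: Ck_on_Suc)
  have hc: "continuous_on ?S h" using assms(1) Ck_on_continuous by blast
  have bl: "bounded_linear (\<lambda>v::real^4. \<Sum>i\<in>UNIV. (v $ i) *\<^sub>R D i x t)" for x t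
    by (intro bounded_linear_sum bounded_linear_compose[OF bounded_linear_scaleR_left bounded_linear_vec_nth])
  define fx where "fx x t = Blinfun (\<lambda>v::real^4. \<Sum>i\<in>UNIV. (v $ i) *\<^sub>R D i x t)" for x t
  have fx: "blinfun_apply (fx x t) = (\<lambda>v::real^4. \<Sum>i\<in>UNIV. (v $ i) *\<^sub>R D i x t)" for x t
    unfolding fx_def by (rule bounded_linear_Blinfun_apply[OF bl])
  have Dc: "continuous_on (?S \<times> cbox 0 1) (\<lambda>(x, t). D i x t)" for i
    unfolding split_beta D_def using rad_in_ball
    by (intro continuous_intros continuous_on_compose2[OF dc]) auto
  have 1: "((\<lambda>x. t ^ m *\<^sub>R h (rad I t x)) has_derivative blinfun_apply (fx x t)) (at x within ?S)"
    if "x \<in> ?S" "t \<in> cbox 0 1" for x t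
  proof -
    have "h differentiable at (rad I t x)"
      using rad_in_ball[of t x \<delta> I] that assms(1)
      by (auto simp: Ck_on_Suc differentiable_on_eq_differentiable_at)
    from has_derivative_compose[OF bounded_linear_imp_has_derivative[OF bounded_linear_rad]
        has_derivative_dpart[OF this]]
    have "((\<lambda>x. t ^ m *\<^sub>R h (rad I t x)) has_derivative
        (\<lambda>v. t ^ m *\<^sub>R (\<Sum>i\<in>UNIV. (rad I t v $ i) *\<^sub>R dpart i h (rad I t x)))) (at x within ?S)"
      by (intro has_derivative_scaleR_right) (rule has_derivative_at_withinI)
    moreover have "t ^ m *\<^sub>R (\<Sum>i\<in>UNIV. (rad I t v $ i) *\<^sub>R dpart i h (rad I t x)) = fx x t v" for v
      unfolding fx scaleR_sum_right by (intro sum.cong) (auto simp: D_def rad_def)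
    ultimately show ?thesis by simp
  qed
  have 2: "continuous_on (?S \<times> cbox 0 1) (\<lambda>(x, t). fx x t)"
  proof (rule continuous_on_blinfun_componentwise)
    fix v :: "real^4"
    have "continuous_on (?S \<times> cbox 0 1) (\<lambda>y. \<Sum>i\<in>UNIV. (v $ i) *\<^sub>R D i (fst y) (snd y))"
      using Dc by (intro continuous_on_sum continuous_on_scaleR continuous_on_const) (simp add: split_beta)
    then show "continuous_on (?S \<times> cbox 0 1) (\<lambda>y. (case y of (x, t) \<Rightarrow> fx x t) v)"
      by (simp add: split_beta fx)
  qed
  have "((\<lambda>x. integral (cbox 0 1) (\<lambda>t. t ^ m *\<^sub>R h (rad I t x))) has_derivative
      blinfun_apply (integral (cbox 0 1) (fx x))) (at x within ?S)"
    using rint_integrable[OF hc] by (intro leibniz_rule[OF 1 _ 2 assms(2)]) auto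
  then have H: "(rint I m h has_derivative blinfun_apply (integral {0..1} (fx x))) (at x)"
    unfolding rint_def[abs_def] using assms(2) by (simp add: at_within_open[OF _ open_ball])
  then show "rint I m h differentiable at x" by (auto simp: differentiable_def)
  have "fx x integrable_on {0..1}"
    by (intro integrable_continuous_real continuous_on_compose2[OF 2, of _ "\<lambda>t. (x, t)", simplified])
       (use assms(2) in \<open>auto intro!: continuous_intros\<close>)
  then have "blinfun_apply (integral {0..1} (fx x)) (axis i 1) = integral {0..1} (\<lambda>t. fx x t (axis i 1))"
    by (rule blinfun_apply_integral)
  moreover have "fx x t (axis i 1) = D i x t" for t unfolding fx sum_axis_scaleR ..
  ultimately show "dpart i (rint I m h) x = rint I (if i \<in> I then Suc m else m) (dpart i h) x"
    by (simp add: dpart_eqI[OF H] rint_def D_def)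
qed

lemma Ck_on_rint:
  "Ck_on k (ball 0 \<delta>) h \<Longrightarrow> Ck_on k (ball 0 \<delta>) (rint I m h)"
proof (induction k arbitrary: h m)
  case 0
  then show ?case by (simp add: continuous_on_rint)
next
  case (Suc k)
  then have 1: "Ck_on (Suc 0) (ball 0 \<delta>) h" by (auto simp: Ck_on_Suc dest: Ck_on_continuous)
  have "Ck_on k (ball 0 \<delta>) (dpart i (rint I m h))" for i
    by (rule Ck_on_cong[OF open_ball rint_dpart(2)[OF 1, symmetric] Suc.IH])
       (use Suc.prems in \<open>auto simp: Ck_on_Suc\<close>)
  then show ?case
    using rint_dpart(1)[OF 1] by (simp add: Ck_on_Suc differentiable_on_eq_differentiable_at)
qed

lemma C0_conv_rint:
  assumes "C0_conv (ball 0 \<delta>) F"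
  shows "C0_conv (ball 0 \<delta>) (\<lambda>n. rint I m (F n))"
proof -
  let ?S = "ball 0 \<delta> :: (real^4) set"
  have c: "continuous_on ?S (F n)" for n using assms by (simp add: C0_conv_def)
  obtain B where B: "\<And>n x. x \<in> ?S \<Longrightarrow> norm (F n x) \<le> B" using assms C0_conv_def by meson
  have "norm (rint I m (F n) x) \<le> B" if "x \<in> ?S" for n x
    using that by (intro norm_rint_le[OF c that] B) auto
  moreover have "uniformly_Cauchy_on ?S (\<lambda>n. rint I m (F n))"
  proof (rule uniformly_Cauchy_onI)
    fix e :: real assume "e > 0"
    then have "e / 2 > 0" by simp
    moreover have "uniformly_Cauchy_on ?S F"
      using assms by (simp add: C0_conv_def uniformly_convergent_eq_Cauchy)
    ultimately obtain M where M: "\<And>x k n. x \<in> ?S \<Longrightarrow> k \<ge> M \<Longrightarrow> n \<ge> M \<Longrightarrow> dist (F k x) (F n x) < e / 2"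
      unfolding uniformly_Cauchy_on_def by meson
    have "dist (rint I m (F k) x) (rint I m (F n) x) < e"
      if "x \<in> ?S" "k \<ge> M" "n \<ge> M" for x k n
    proof -
      have "norm (rint I m (\<lambda>y. F k y - F n y) x) \<le> e / 2"
      proof (rule norm_rint_le[OF _ that(1)])
        show "continuous_on ?S (\<lambda>y. F k y - F n y)" by (intro continuous_intros c)
        fix y :: "real^4" assume "norm y \<le> norm x"
        then have "y \<in> ?S" using that by auto
        then show "norm (F k y - F n y) \<le> e / 2"
          using M[of y k n] that by (simp add: dist_norm)
      qed
      then show ?thesis using \<open>e > 0\<close> by (simp add: dist_norm rint_diff[OF c c that(1)])
    qed
    then show "\<exists>M. \<forall>x\<in>?S. \<forall>k\<ge>M. \<forall>n\<ge>M. dist (rint I m (F k) x) (rint I m (F n) x) < e" by blast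
  qed
  ultimately show ?thesis
    unfolding C0_conv_def uniformly_convergent_eq_Cauchy using continuous_on_rint[OF c] by blast
qed

lemma Ck_conv_rint:
  "Ck_conv k (ball 0 \<delta>) F \<Longrightarrow> Ck_conv k (ball 0 \<delta>) (\<lambda>n. rint I m (F n))"
proof (induction k arbitrary: F m)
  case 0
  then show ?case by (simp add: C0_conv_rint)
next
  case (Suc k)
  have 1: "Ck_on (Suc 0) (ball 0 \<delta>) (F n)" for n
    using Ck_conv_imp_Ck_on[OF Suc.prems, of n] by (auto simp: Ck_on_Suc dest: Ck_on_continuous)
  have "Ck_conv k (ball 0 \<delta>) (\<lambda>n. dpart i (rint I m (F n)))" for i
    by (rule Ck_conv_cong[OF open_ball rint_dpart(2)[OF 1, symmetric] Suc.IH])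
       (use Suc.prems in auto)
  then show ?case
    using rint_dpart(1)[OF 1] C0_conv_rint[OF Ck_conv_C0[OF Suc.prems]]
    by (simp add: differentiable_on_eq_differentiable_at)
qed

lemma Ck_on_rop:
  assumes "\<And>j. j \<in> I \<Longrightarrow> Ck_on k (ball 0 \<delta>) (h j)"
  shows "Ck_on k (ball 0 \<delta>) (rop I m h)"
  unfolding rop_def[abs_def] using assms
  by (intro Ck_on_sum Ck_on_scaleR Ck_on_rint open_ball Ck_on_linear[OF bounded_linear_vec_nth])

lemma Ck_conv_rop:
  assumes "\<And>j. j \<in> I \<Longrightarrow> Ck_conv k (ball 0 \<delta>) (h j)"
  shows "Ck_conv k (ball 0 \<delta>) (\<lambda>n. rop I m (\<lambda>j. h j n))"
  unfolding rop_def[abs_def] using assms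
  by (intro Ck_conv_sum Ck_conv_bilinear[OF bounded_bilinear_scaleR] Ck_conv_rint open_ball
      Ck_conv_linear[OF bounded_linear_vec_nth bounded_ball])

lemma rop_cong:
  assumes "\<And>j y. j \<in> I \<Longrightarrow> y \<in> ball 0 \<delta> \<Longrightarrow> h j y = h' j y" "x \<in> ball 0 \<delta>"
  shows "rop I m h x = rop I m h' x"
  unfolding rop_def using rint_cong[OF assms(1) assms(2)] by (intro sum.cong) auto

lemma rop_add:
  assumes "\<And>j. j \<in> I \<Longrightarrow> continuous_on (ball 0 \<delta>) (h j)"
    "\<And>j. j \<in> I \<Longrightarrow> continuous_on (ball 0 \<delta>) (h' j)" "x \<in> ball 0 \<delta>"
  shows "rop I m (\<lambda>j y. h j y + h' j y) x = rop I m h x + rop I m h' x"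
  unfolding rop_def sum.distrib[symmetric] scaleR_add_right[symmetric]
  using rint_add[OF assms] by (intro sum.cong) auto

lemma rop_diff:
  assumes "\<And>j. j \<in> I \<Longrightarrow> continuous_on (ball 0 \<delta>) (h j)"
    "\<And>j. j \<in> I \<Longrightarrow> continuous_on (ball 0 \<delta>) (h' j)" "x \<in> ball 0 \<delta>"
  shows "rop I m (\<lambda>j y. h j y - h' j y) x = rop I m h x - rop I m h' x"
  unfolding rop_def sum_subtractf[symmetric] scaleR_diff_right[symmetric]
  using rint_diff[OF assms] by (intro sum.cong) auto

lemma norm_rop_le:
  assumes "\<And>j. j \<in> I \<Longrightarrow> continuous_on (ball 0 \<delta>) (h j)" "x \<in> ball 0 \<delta>"
    and "\<And>j y. j \<in> I \<Longrightarrow> norm y \<le> norm x \<Longrightarrow> norm (h j y) \<le> B" "B \<ge> 0"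
  shows "norm (rop I m h x) \<le> real (card I) * \<delta> * B"
proof -
  have "norm ((x $ j) *\<^sub>R rint I m (h j) x) \<le> \<delta> * B" if "j \<in> I" for j
  proof -
    have "\<bar>x $ j\<bar> \<le> \<delta>" using component_le_norm_cart[of x j] assms(2) by simp
    then show ?thesis
      using norm_rint_le[OF assms(1)[OF that] assms(2) assms(3)[OF that]] assms(4)
      by (auto intro!: mult_mono)
  qed
  then have "norm (rop I m h x) \<le> (\<Sum>j\<in>I. \<delta> * B)"
    unfolding rop_def by (intro order_trans[OF norm_sum] sum_mono)
  then show ?thesis by (simp add: mult.assoc)
qed

text \<open>Product rule: for i in I the coefficient x_i contributes a term in which h is not
  differentiated.\<close>

lemma rop_dpart:
  assumes "\<And>j. j \<in> I \<Longrightarrow> Ck_on (Suc 0) (ball 0 \<delta>) (h j)" "x \<in> ball 0 \<delta>"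
  shows "rop I m h differentiable at x"
    and "dpart i (rop I m h) x = (if i \<in> I then rint I m (h i) x else 0)
      + rop I (if i \<in> I then Suc m else m) (\<lambda>j. dpart i (h j)) x"
proof -
  let ?D = "\<lambda>v. \<Sum>j\<in>I. (x $ j) *\<^sub>R (\<Sum>i\<in>UNIV. (v $ i) *\<^sub>R dpart i (rint I m (h j)) x)
      + (v $ j) *\<^sub>R rint I m (h j) x"
  have D: "(rop I m h has_derivative ?D) (at x)"
    unfolding rop_def[abs_def] using rint_dpart(1)[OF assms(1) assms(2)]
    by (intro has_derivative_sum has_derivative_scaleR has_derivative_dpart
        bounded_linear_imp_has_derivative bounded_linear_vec_nth) auto
  then show "rop I m h differentiable at x" by (auto simp: differentiable_def)
  have "axis i 1 $ j *\<^sub>R rint I m (h j) x = (if j = i then rint I m (h i) x else 0)" for j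
    by (auto simp: axis_def)
  then have "(\<Sum>j\<in>I. axis i 1 $ j *\<^sub>R rint I m (h j) x) = (if i \<in> I then rint I m (h i) x else 0)"
    by (simp add: sum.delta)
  then have "dpart i (rop I m h) x = (\<Sum>j\<in>I. (x $ j) *\<^sub>R dpart i (rint I m (h j)) x)
      + (if i \<in> I then rint I m (h i) x else 0)"
    unfolding dpart_eqI[OF D] sum_axis_scaleR sum.distrib by simp
  also have "(\<Sum>j\<in>I. (x $ j) *\<^sub>R dpart i (rint I m (h j)) x)
      = rop I (if i \<in> I then Suc m else m) (\<lambda>j. dpart i (h j)) x"
    unfolding rop_def using rint_dpart(2)[OF assms(1) assms(2)] by (intro sum.cong) auto
  finally show "dpart i (rop I m h) x = (if i \<in> I then rint I m (h i) x else 0)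
      + rop I (if i \<in> I then Suc m else m) (\<lambda>j. dpart i (h j)) x" by simp
qed

section \<open>Limits and contraction estimates\<close>

text \<open>Uniform convergence of the derivatives on a convex set allows limit and differentiation
  to be interchanged; the induction then passes to the sequences of partial derivatives.\<close>

lemma Ck_conv_limit:
  fixes F :: "nat \<Rightarrow> real^4 \<Rightarrow> 'b::banach"
  assumes "open S" "convex S" "Ck_conv k S F" "\<And>x. x \<in> S \<Longrightarrow> (\<lambda>n. F n x) \<longlonglongrightarrow> f x"
  shows "Ck_on k S f"
  using assms(3,4)
proof (induction k arbitrary: F f)
  case 0
  then obtain l where l: "uniform_limit S F l sequentially"
    by (auto simp: C0_conv_def uniformly_convergent_on_def)
  have "continuous_on S l"
    using 0 by (intro uniform_limit_theorem[OF _ l]) (auto simp: C0_conv_def)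
  moreover have "l x = f x" if "x \<in> S" for x
    using LIMSEQ_unique[OF tendsto_uniform_limitI[OF l that] 0(2)[OF that]] .
  ultimately show ?case using continuous_on_cong[of S S l f] by simp
next
  case (Suc k)
  have "\<exists>g. uniform_limit S (\<lambda>n. dpart i (F n)) g sequentially" for i
    using Suc.prems(1) Ck_conv_C0[of k S "\<lambda>n. dpart i (F n)"]
    by (auto simp: C0_conv_def uniformly_convergent_on_def)
  then obtain g where g: "\<And>i. uniform_limit S (\<lambda>n. dpart i (F n)) (g i) sequentially" by metis
  have Ckg: "Ck_on k S (g i)" for i
    using Suc.prems(1) by (intro Suc.IH[OF _ tendsto_uniform_limitI[OF g]]) auto
  let ?G = "\<lambda>x v. \<Sum>i\<in>UNIV. ((v::real^4) $ i) *\<^sub>R g i x"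
  have d: "F n differentiable at x" if "x \<in> S" for n x
    using Suc.prems that assms(1) by (auto simp: differentiable_on_eq_differentiable_at)
  have D: "(f has_derivative ?G x) (at x)" if x: "x \<in> S" for x
  proof -
    have "\<exists>g. \<forall>x\<in>S. (\<lambda>n. F n x) \<longlonglongrightarrow> g x \<and> (g has_derivative ?G x) (at x within S)"
    proof (rule has_derivative_sequence[where f = F and g' = ?G and ?x0.0 = x and l = "f x"])
      show "(F n has_derivative (\<lambda>v. \<Sum>i\<in>UNIV. (v $ i) *\<^sub>R dpart i (F n) x)) (at x within S)"
        if "x \<in> S" for n x
        using has_derivative_dpart[OF d[OF that]] by (rule has_derivative_at_withinI)
      show "convex S" "x \<in> S" "(\<lambda>n. F n x) \<longlonglongrightarrow> f x" using assms(2) x Suc.prems(2) by auto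
      fix e :: real assume "e > 0"
      \<comment> \<open>One quarter of e for each of the four partial derivatives.\<close>
      then have "e / 4 > 0" by simp
      then have "\<forall>\<^sub>F n in sequentially. \<forall>x\<in>S. dist (dpart i (F n) x) (g i x) < e / 4" for i
        by (rule uniform_limitD[OF g])
      then have "\<forall>\<^sub>F n in sequentially. \<forall>i\<in>UNIV. \<forall>x\<in>S. dist (dpart i (F n) x) (g i x) < e / 4"
        by (rule eventually_ball_finite[OF finite ballI])
      then show "\<forall>\<^sub>F n in sequentially. \<forall>x\<in>S. \<forall>v.
          norm ((\<Sum>i\<in>UNIV. (v $ i) *\<^sub>R dpart i (F n) x) - ?G x v) \<le> e * norm v"
      proof eventually_elim
        case (elim n)
        show ?case
        proof (intro ballI allI)
          fix x v assume "x \<in> S"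
          have "norm ((v $ i) *\<^sub>R (dpart i (F n) x - g i x)) \<le> norm v * (e / 4)" for i
            unfolding norm_scaleR using elim[rule_format, of i x] \<open>x \<in> S\<close>
            by (intro mult_mono) (auto simp: dist_norm component_le_norm_cart)
          then have "norm (\<Sum>i\<in>UNIV. (v $ i) *\<^sub>R (dpart i (F n) x - g i x))
              \<le> (\<Sum>i\<in>(UNIV::4 set). norm v * (e / 4))"
            by (intro order_trans[OF norm_sum] sum_mono)
          then show "norm ((\<Sum>i\<in>UNIV. (v $ i) *\<^sub>R dpart i (F n) x) - ?G x v) \<le> e * norm v"
            by (simp add: scaleR_diff_right sum_subtractf mult.commute)
        qed
      qed
    qed
    then obtain g' where g': "\<And>x. x \<in> S \<Longrightarrow> (\<lambda>n. F n x) \<longlonglongrightarrow> g' x"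
      "\<And>x. x \<in> S \<Longrightarrow> (g' has_derivative ?G x) (at x within S)" by blast
    have "g' y = f y" if "y \<in> S" for y
      using LIMSEQ_unique[OF g'(1)[OF that] Suc.prems(2)[OF that]] .
    then show ?thesis
      using g'(2)[OF x] has_derivative_cong_open[OF assms(1) x, of g' f]
      by (simp add: at_within_open[OF x assms(1)])
  qed
  have "dpart i f x = g i x" if "x \<in> S" for i x
    unfolding dpart_eqI[OF D[OF that]] sum_axis_scaleR ..
  then have "Ck_on k S (dpart i f)" for i
    using Ck_on_cong[OF assms(1) _ Ckg[of i], of "dpart i f"] by simp
  moreover have "f differentiable_on S"
    using D by (auto simp: differentiable_on_eq_differentiable_at[OF assms(1)] differentiable_def)
  ultimately show ?case by (simp add: Ck_on_Suc)
qed

text \<open>The map applied at step n may itself depend on n, so distances are halved only up to an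
  error that vanishes as the indices grow. Starting from the trivial distance 2 C, sufficiently many
  halvings still make the distance small.\<close>

lemma uniformly_Cauchy_on_perturbed_contraction:
  fixes V :: "nat \<Rightarrow> 'a \<Rightarrow> 'b::real_normed_vector"
  assumes bound: "\<And>n x. x \<in> S \<Longrightarrow> norm (V n x) \<le> C"
    and step: "\<And>e. e > 0 \<Longrightarrow> \<exists>N. \<forall>k\<ge>N. \<forall>n\<ge>N. \<forall>d. (\<forall>x\<in>S. dist (V k x) (V n x) \<le> d) \<longrightarrow>
      (\<forall>x\<in>S. dist (V (Suc k) x) (V (Suc n) x) \<le> e + d / 2)"
  shows "uniformly_Cauchy_on S V"
proof (rule uniformly_Cauchy_onI)
  fix e :: real assume e: "e > 0"
  then have "e / 8 > 0" by simp
  from step[OF this] obtain N where N':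
    "\<forall>k\<ge>N. \<forall>n\<ge>N. \<forall>d. (\<forall>x\<in>S. dist (V k x) (V n x) \<le> d) \<longrightarrow>
      (\<forall>x\<in>S. dist (V (Suc k) x) (V (Suc n) x) \<le> e / 8 + d / 2)" by auto
  have N: "\<And>k n d x. N \<le> k \<Longrightarrow> N \<le> n \<Longrightarrow> (\<forall>x\<in>S. dist (V k x) (V n x) \<le> d) \<Longrightarrow>
      x \<in> S \<Longrightarrow> dist (V (Suc k) x) (V (Suc n) x) \<le> e / 8 + d / 2"
    by (rule N'[rule_format]) auto
  \<comment> \<open>e / 4 is the fixed point of the map sending d to e / 8 + d / 2, so the
    accumulated errors never exceed it.\<close>
  have iter: "dist (V k x) (V n x) \<le> e / 4 + 2 * C * (1/2)^p"
    if "N + p \<le> k" "N + p \<le> n" "x \<in> S" for k n p x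
    using that
  proof (induction p arbitrary: k n x)
    case 0
    have "dist (V k x) (V n x) \<le> norm (V k x) + norm (V n x)" by (simp add: dist_norm norm_triangle_ineq4)
    then show ?case using bound[OF 0(3), of k] bound[OF 0(3), of n] e by simp
  next
    case (Suc p)
    obtain k' where k': "k = Suc k'" using Suc.prems by (cases k) auto
    obtain n' where n': "n = Suc n'" using Suc.prems by (cases n) auto
    have "dist (V (Suc k') x) (V (Suc n') x) \<le> e / 8 + (e / 4 + 2 * C * (1/2)^p) / 2"
      using Suc k' n' by (intro N) auto
    then show ?case by (simp add: k' n' field_simps)
  qed
  have "\<exists>p. C * (1/2)^p < e / 8"
  proof -
    have "(\<lambda>p. C * (1/2)^p) \<longlonglongrightarrow> C * 0"
      by (intro tendsto_mult tendsto_const LIMSEQ_realpow_zero) auto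
    then have "\<forall>\<^sub>F p in sequentially. C * (1/2)^p < e / 8"
      using e by (intro order_tendstoD(2)) auto
    then show ?thesis by (auto simp: eventually_sequentially)
  qed
  then obtain p where "C * (1/2)^p < e / 8" ..
  then have "dist (V k x) (V n x) < e" if "N + p \<le> k" "N + p \<le> n" "x \<in> S" for k n x
    using iter[OF that] e by simp
  then show "\<exists>M. \<forall>x\<in>S. \<forall>k\<ge>M. \<forall>n\<ge>M. dist (V k x) (V n x) < e" by blast
qed

lemma continuous_on_combination:
  fixes V :: "real^4 \<Rightarrow> real^4" and N :: "4 \<Rightarrow> real^4 \<Rightarrow> 'b::real_normed_vector"
  assumes "continuous_on S V" "\<And>l. continuous_on S (N l)"
  shows "continuous_on S (\<lambda>y. \<Sum>l\<in>UNIV. (V y $ l) *\<^sub>R N l y)"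
  using assms by (intro continuous_intros) auto

text \<open>Coefficients and inhomogeneity vary with n but converge, which makes the iteration a
  perturbed contraction; its factor 1/2 is the assumption \<open>small\<close>.\<close>

lemma C0_conv_linear_iteration:
  fixes V :: "nat \<Rightarrow> real^4 \<Rightarrow> real^4"
  assumes b: "C0_conv (ball 0 \<delta>) b"
    and N: "\<And>j l. j \<in> I \<Longrightarrow> C0_conv (ball 0 \<delta>) (N j l)"
    and V0: "\<And>x. x \<in> ball 0 \<delta> \<Longrightarrow> norm (V 0 x) \<le> B0"
    and Vc: "\<And>n. continuous_on (ball 0 \<delta>) (V n)"
    and rec: "\<And>n x. x \<in> ball 0 \<delta> \<Longrightarrow>
      V (Suc n) x = b n x + rop I m (\<lambda>j y. \<Sum>l\<in>UNIV. (V n y $ l) *\<^sub>R N j l n y) x"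
    and L: "\<And>n j y v. j \<in> I \<Longrightarrow> y \<in> ball 0 \<delta> \<Longrightarrow>
      norm (\<Sum>l\<in>UNIV. (v $ l) *\<^sub>R N j l n y) \<le> L * norm (v::real^4)"
    and small: "real (card I) * \<delta> * L \<le> 1 / 2" and pos: "\<delta> > 0" "L \<ge> 0"
  shows "C0_conv (ball 0 \<delta>) V"
proof -
  let ?S = "ball 0 \<delta> :: (real^4) set"
  have Nc: "continuous_on ?S (N j l n)" if "j \<in> I" for j l n using N[OF that] by (simp add: C0_conv_def)
  obtain Bb where Bb: "\<And>n x. x \<in> ?S \<Longrightarrow> norm (b n x) \<le> Bb" using b C0_conv_def by meson
  \<comment> \<open>Chosen so that the recursion preserves it: \<open>Bb\<close> is at most C / 2,
    and the integral term contributes at most C / 2.\<close>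
  define C where "C = max B0 (2 * Bb)"
  have "0 \<le> norm (b 0 0)" by simp
  also have "\<dots> \<le> Bb" using Bb pos(1) by auto
  finally have C: "C \<ge> 0" "B0 \<le> C" "Bb \<le> C / 2" by (auto simp: C_def)
  have half: "real (card I) * \<delta> * (L * d) \<le> d / 2" if "d \<ge> 0" for d
    using mult_right_mono[OF small that] by (simp add: mult.assoc)
  have bound: "norm (V n x) \<le> C" if "x \<in> ?S" for n x
    using that
  proof (induction n arbitrary: x)
    case 0
    then show ?case using V0[OF 0] C by simp
  next
    case (Suc n)
    have "norm (rop I m (\<lambda>j y. \<Sum>l\<in>UNIV. (V n y $ l) *\<^sub>R N j l n y) x) \<le> real (card I) * \<delta> * (L * C)"
    proof (rule norm_rop_le[OF _ Suc.prems])
      show "continuous_on ?S (\<lambda>y. \<Sum>l\<in>UNIV. (V n y $ l) *\<^sub>R N j l n y)" if "j \<in> I" for j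
        by (intro continuous_on_combination Vc Nc that)
      fix j and y :: "real^4" assume "j \<in> I" "norm y \<le> norm x"
      then have y: "y \<in> ?S" using Suc.prems by auto
      show "norm (\<Sum>l\<in>UNIV. (V n y $ l) *\<^sub>R N j l n y) \<le> L * C"
        using L[OF \<open>j \<in> I\<close> y, of "V n y" n] mult_left_mono[OF Suc.IH[OF y] pos(2)] by linarith
    qed (use C pos in auto)
    then have "norm (V (Suc n) x) \<le> Bb + real (card I) * \<delta> * (L * C)"
      unfolding rec[OF Suc.prems] by (intro norm_triangle_mono Bb Suc.prems)
    then show ?case using half[OF C(1)] C by linarith
  qed
  have "uniformly_Cauchy_on ?S V"
  proof (rule uniformly_Cauchy_on_perturbed_contraction[OF bound])
    fix e :: real assume e: "e > 0"
    \<comment> \<open>K exceeds the factor with which a coefficient error enters, the 4 counting the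
      summands. An error of e / (2 K) then costs at most e / 2; the added 1 keeps K
      positive.\<close>
    define K where "K = real (card I) * \<delta> * (4 * C) + 1"
    have K: "K > 0" using C pos by (auto simp: K_def intro!: add_nonneg_pos mult_nonneg_nonneg)
    obtain M1 where M1: "\<And>x k n. x \<in> ?S \<Longrightarrow> k \<ge> M1 \<Longrightarrow> n \<ge> M1 \<Longrightarrow> dist (b k x) (b n x) < e / 2"
      using b e unfolding C0_conv_def uniformly_convergent_eq_Cauchy uniformly_Cauchy_on_def
      by (meson half_gt_zero)
    have "\<exists>M. \<forall>x\<in>?S. \<forall>k\<ge>M. \<forall>n\<ge>M. dist (N j l k x) (N j l n x) < e / (2 * K)" if "j \<in> I" for j l
      using N[OF that, of l] e K
      unfolding C0_conv_def uniformly_convergent_eq_Cauchy uniformly_Cauchy_on_def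
      by (meson divide_pos_pos mult_pos_pos zero_less_numeral)
    then obtain M2 where M2: "\<And>j l x k n. j \<in> I \<Longrightarrow> x \<in> ?S \<Longrightarrow> k \<ge> M2 j l \<Longrightarrow> n \<ge> M2 j l \<Longrightarrow>
        dist (N j l k x) (N j l n x) < e / (2 * K)" by metis
    define M where "M = Max (insert M1 (range (\<lambda>(j, l). M2 j l)))"
    have "M2 j l \<in> range (\<lambda>(j, l). M2 j l)" for j l by (rule range_eqI[of _ _ "(j, l)"]) simp
    then have M: "M1 \<le> M" "M2 j l \<le> M" for j l unfolding M_def by (intro Max_ge; simp)+
    have "dist (V (Suc k) x) (V (Suc n) x) \<le> e + d / 2"
      if kn: "k \<ge> M" "n \<ge> M" and d: "\<forall>x\<in>?S. dist (V k x) (V n x) \<le> d" and x: "x \<in> ?S" for k n d x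
    proof -
      let ?T = "\<lambda>k j y. \<Sum>l\<in>UNIV. (V k y $ l) *\<^sub>R N j l k y"
      have Tc: "continuous_on ?S (?T k j)" if "j \<in> I" for k j
        by (intro continuous_on_combination Vc Nc that)
      have d0: "d \<ge> 0" using d x by (meson order_trans zero_le_dist)
      have "norm (rop I m (\<lambda>j y. ?T k j y - ?T n j y) x)
          \<le> real (card I) * \<delta> * (L * d + 4 * C * (e / (2 * K)))"
      proof (rule norm_rop_le[OF _ x])
        show "continuous_on ?S (\<lambda>y. ?T k j y - ?T n j y)" if "j \<in> I" for j
          by (intro continuous_on_diff Tc that)
        show "0 \<le> L * d + 4 * C * (e / (2 * K))" using pos C d0 e K by simp
        fix j and y :: "real^4" assume j: "j \<in> I" and "norm y \<le> norm x"
        then have y: "y \<in> ?S" using x by auto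
        \<comment> \<open>The change of V meets the coefficients of step k and is contracted; the
          change of the coefficients meets V, which is bounded by C.\<close>
        have eq: "?T k j y - ?T n j y = (\<Sum>l\<in>UNIV. ((V k y - V n y) $ l) *\<^sub>R N j l k y)
            + (\<Sum>l\<in>UNIV. (V n y $ l) *\<^sub>R (N j l k y - N j l n y))"
          by (simp add: scaleR_diff_left scaleR_diff_right sum_subtractf)
        have "norm ((V n y $ l) *\<^sub>R (N j l k y - N j l n y)) \<le> C * (e / (2 * K))" for l
        proof -
          have "norm (N j l k y - N j l n y) \<le> e / (2 * K)"
            using M2[OF j y, of l k n] kn M(2)[of j l] by (simp add: dist_norm)
          then show ?thesis
            unfolding norm_scaleR real_norm_def
            by (intro mult_mono order_trans[OF component_le_norm_cart bound[OF y]] C) auto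
        qed
        then have "norm (\<Sum>l\<in>UNIV. (V n y $ l) *\<^sub>R (N j l k y - N j l n y))
            \<le> (\<Sum>l\<in>(UNIV::4 set). C * (e / (2 * K)))"
          by (intro order_trans[OF norm_sum] sum_mono)
        then have "norm (\<Sum>l\<in>UNIV. (V n y $ l) *\<^sub>R (N j l k y - N j l n y)) \<le> 4 * C * (e / (2 * K))"
          by simp
        moreover have "norm (\<Sum>l\<in>UNIV. ((V k y - V n y) $ l) *\<^sub>R N j l k y) \<le> L * d"
          using L[OF j y, of "V k y - V n y" k] mult_left_mono[OF d[rule_format, OF y] pos(2)]
          by (simp add: dist_norm)
        ultimately show "norm (?T k j y - ?T n j y) \<le> L * d + 4 * C * (e / (2 * K))"
          unfolding eq by (intro norm_triangle_mono)
      qed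
      moreover have "real (card I) * \<delta> * (L * d + 4 * C * (e / (2 * K))) \<le> d / 2 + e / 2"
      proof -
        have "real (card I) * \<delta> * (4 * C * (e / (2 * K))) = (K - 1) / K * (e / 2)"
          by (simp add: K_def)
        also have "\<dots> \<le> 1 * (e / 2)" using K e by (intro mult_right_mono) auto
        finally show ?thesis using half[OF d0] by (simp add: distrib_left)
      qed
      moreover have "norm (b k x - b n x) \<le> e / 2"
        using M1[OF x, of k n] kn M(1) by (simp add: dist_norm)
      moreover have "V (Suc k) x - V (Suc n) x
          = (b k x - b n x) + rop I m (\<lambda>j y. ?T k j y - ?T n j y) x"
        using rop_diff[of I \<delta> "?T k" "?T n" x m] Tc x by (simp add: rec[OF x])
      ultimately show ?thesis
        using norm_triangle_ineq[of "b k x - b n x" "rop I m (\<lambda>j y. ?T k j y - ?T n j y) x"]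
        by (simp add: dist_norm)
    qed
    then show "\<exists>M. \<forall>k\<ge>M. \<forall>n\<ge>M. \<forall>d. (\<forall>x\<in>?S. dist (V k x) (V n x) \<le> d) \<longrightarrow>
        (\<forall>x\<in>?S. dist (V (Suc k) x) (V (Suc n) x) \<le> e + d / 2)" by blast
  qed
  then show ?thesis
    using Vc bound unfolding C0_conv_def uniformly_convergent_eq_Cauchy by blast
qed

section \<open>Flow of commuting vector fields\<close>

lemma dpart_add:
  assumes "F differentiable at x" "H differentiable at x"
  shows "dpart i (\<lambda>x. F x + H x) x = dpart i F x + dpart i H x"
  using dpart_eqI[OF has_derivative_add[OF has_derivative_dpart[OF assms(1)]
      has_derivative_dpart[OF assms(2)]], of i] by simp

lemma dpart_combination:
  fixes V :: "real^4 \<Rightarrow> real^4" and N :: "4 \<Rightarrow> real^4 \<Rightarrow> 'b::real_normed_vector"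
  assumes "V differentiable at x" "\<And>l. N l differentiable at x"
  shows "dpart i (\<lambda>y. \<Sum>l\<in>UNIV. (V y $ l) *\<^sub>R N l y) x
    = (\<Sum>l\<in>UNIV. (dpart i V x $ l) *\<^sub>R N l x) + (\<Sum>l\<in>UNIV. (V x $ l) *\<^sub>R dpart i (N l) x)"
proof -
  have "((\<lambda>y. \<Sum>l\<in>UNIV. (V y $ l) *\<^sub>R N l y) has_derivative
      (\<lambda>v. \<Sum>l\<in>UNIV. (V x $ l) *\<^sub>R (\<Sum>i\<in>UNIV. (v $ i) *\<^sub>R dpart i (N l) x)
        + ((\<Sum>i\<in>UNIV. (v $ i) *\<^sub>R dpart i V x) $ l) *\<^sub>R N l x)) (at x)"
    by (intro has_derivative_sum has_derivative_scaleR has_derivative_dpart assms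
        bounded_linear.has_derivative[OF bounded_linear_vec_nth])
  from dpart_eqI[OF this, of i] show ?thesis
    unfolding sum_axis_scaleR sum.distrib by simp
qed

text \<open>A partial derivative of V satisfies an iteration with the same coefficients N, in whose
  inhomogeneity V occurs undifferentiated. Hence N, L and the ball stay fixed in the induction over
  k, while b, V and the exponent m vary.\<close>

lemma Ck_conv_linear_iteration:
  fixes V :: "nat \<Rightarrow> real^4 \<Rightarrow> real^4"
  assumes "Ck_conv k (ball 0 \<delta>) b"
    and N: "\<And>j l. j \<in> I \<Longrightarrow> Ck_conv k (ball 0 \<delta>) (N j l)"
    and "Ck_conv k (ball 0 \<delta>) (\<lambda>_. V 0)"
    and "\<And>n x. x \<in> ball 0 \<delta> \<Longrightarrow>
      V (Suc n) x = b n x + rop I m (\<lambda>j y. \<Sum>l\<in>UNIV. (V n y $ l) *\<^sub>R N j l n y) x"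
    and L: "\<And>n j y v. j \<in> I \<Longrightarrow> y \<in> ball 0 \<delta> \<Longrightarrow>
      norm (\<Sum>l\<in>UNIV. (v $ l) *\<^sub>R N j l n y) \<le> L * norm (v::real^4)"
    and small: "real (card I) * \<delta> * L \<le> 1 / 2" and pos: "\<delta> > 0" "L \<ge> 0"
  shows "Ck_conv k (ball 0 \<delta>) V"
  using assms(1-4)
proof (induction k arbitrary: b V m)
  let ?S = "ball 0 \<delta> :: (real^4) set"
  \<comment> \<open>Each single iterate must be known to be C^k before the recursion can be
    differentiated.\<close>
  have on: "Ck_on k ?S (V n)"
    if b: "Ck_conv k ?S b" and N: "\<And>j l. j \<in> I \<Longrightarrow> Ck_conv k ?S (N j l)"
      and V0: "Ck_conv k ?S (\<lambda>_. V 0)"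
      and rec: "\<And>n x. x \<in> ?S \<Longrightarrow>
      V (Suc n) x = b n x + rop I m (\<lambda>j y. \<Sum>l\<in>UNIV. (V n y $ l) *\<^sub>R N j l n y) x"
    for k b m n and V :: "nat \<Rightarrow> real^4 \<Rightarrow> real^4"
  proof (induction n)
    case 0
    show ?case by (rule Ck_conv_imp_Ck_on[OF V0])
  next
    case (Suc n)
    have "Ck_on k ?S (\<lambda>x. b n x + rop I m (\<lambda>j y. \<Sum>l\<in>UNIV. (V n y $ l) *\<^sub>R N j l n y) x)"
      by (intro Ck_on_add open_ball Ck_conv_imp_Ck_on[OF b] Ck_on_rop Ck_on_sum Ck_on_scaleR
          Ck_on_nth[OF open_ball Suc] Ck_conv_imp_Ck_on[OF N])
    then show ?case by (rule Ck_on_cong[OF open_ball, rotated]) (simp add: rec)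
  qed
  { case 0
    then have "C0_conv ?S (\<lambda>_. V 0)" by simp
    then obtain B0 where B0: "\<And>x. x \<in> ?S \<Longrightarrow> norm (V 0 x) \<le> B0" unfolding C0_conv_def by blast
    have "C0_conv ?S V"
    proof (rule C0_conv_linear_iteration[of \<delta> b I N V B0 m L])
      show "continuous_on ?S (V n)" for n using on[OF 0, of n] by simp
    qed (use 0 B0 L small pos in simp_all)
    then show ?case by simp }
  { case (Suc k)
    let ?T = "\<lambda>n j y. \<Sum>l\<in>UNIV. (V n y $ l) *\<^sub>R N j l n y"
    note N1 = Ck_conv_SucD[OF Suc.prems(2)]
    have V: "Ck_conv k ?S V"
      by (rule Suc.IH[OF Ck_conv_SucD[OF Suc.prems(1)] N1 Ck_conv_SucD[OF Suc.prems(3)] Suc.prems(4)])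
    have V1: "Ck_on (Suc k) ?S (V n)" for n by (rule on[OF Suc.prems])
    have N2: "Ck_on (Suc k) ?S (N j l n)" if "j \<in> I" for j l n
      by (rule Ck_conv_imp_Ck_on[OF Suc.prems(2)[OF that]])
    have T1: "Ck_on (Suc k) ?S (?T n j)" if "j \<in> I" for n j
      by (intro Ck_on_sum Ck_on_scaleR Ck_on_nth[OF open_ball V1] N2 that open_ball)
    have Suc0: "Ck_on (Suc 0) ?S F" if "Ck_on (Suc k) ?S F" for F :: "real^4 \<Rightarrow> real^4"
      using that by (auto simp: Ck_on_Suc dest: Ck_on_continuous)
    have diff: "F differentiable at x" if "Ck_on (Suc k) ?S F" "x \<in> ?S" for F :: "real^4 \<Rightarrow> real^4" and x
      using that by (auto simp: Ck_on_Suc differentiable_on_eq_differentiable_at)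
    have "Ck_conv k ?S (\<lambda>n. dpart i (V n))" for i
    proof -
      define m' where "m' = (if i \<in> I then Suc m else m)"
      \<comment> \<open>Collects what is free of derivatives of V in the differentiated recursion;
        its convergence in C^k follows from that of V.\<close>
      define b' where "b' n x = dpart i (b n) x + (if i \<in> I then rint I m (?T n i) x else 0)
        + rop I m' (\<lambda>j y. \<Sum>l\<in>UNIV. (V n y $ l) *\<^sub>R dpart i (N j l n) y) x" for n x
      have "Ck_conv k ?S (\<lambda>n x. if i \<in> I then rint I m (?T n i) x else 0)"
      proof (cases "i \<in> I")
        case True
        then have "Ck_conv k ?S (\<lambda>n. rint I m (?T n i))"
          by (intro Ck_conv_rint Ck_conv_sum Ck_conv_bilinear[OF bounded_bilinear_scaleR]
              Ck_conv_linear_comp[OF bounded_linear_vec_nth] V N1 open_ball)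
        with True show ?thesis by simp
      qed simp
      moreover have "Ck_conv k ?S (\<lambda>n. rop I m' (\<lambda>j y. \<Sum>l\<in>UNIV. (V n y $ l) *\<^sub>R dpart i (N j l n) y))"
        using Suc.prems(2)
        by (intro Ck_conv_rop Ck_conv_sum Ck_conv_bilinear[OF bounded_bilinear_scaleR]
            Ck_conv_linear_comp[OF bounded_linear_vec_nth] V open_ball) auto
      moreover have "Ck_conv k ?S (\<lambda>n. dpart i (b n))" using Suc.prems(1) by simp
      ultimately have b': "Ck_conv k ?S b'" unfolding b'_def[abs_def] by (intro Ck_conv_add open_ball)
      have rec': "dpart i (V (Suc n)) x
          = b' n x + rop I m' (\<lambda>j y. \<Sum>l\<in>UNIV. (dpart i (V n) y $ l) *\<^sub>R N j l n y) x"
        if x: "x \<in> ?S" for n x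
      proof -
        have "dpart i (V (Suc n)) x = dpart i (\<lambda>x. b n x + rop I m (?T n) x) x"
          by (rule dpart_cong_open[OF open_ball x Suc.prems(4)])
        also have "\<dots> = dpart i (b n) x + dpart i (rop I m (?T n)) x"
          by (intro dpart_add diff[OF Ck_conv_imp_Ck_on[OF Suc.prems(1)] x] rop_dpart(1)[OF Suc0[OF T1] x])
        also have "dpart i (rop I m (?T n)) x
            = (if i \<in> I then rint I m (?T n i) x else 0) + rop I m' (\<lambda>j. dpart i (?T n j)) x"
          unfolding m'_def by (rule rop_dpart(2)[OF Suc0[OF T1] x])
        also have "rop I m' (\<lambda>j. dpart i (?T n j)) x
            = rop I m' (\<lambda>j y. (\<Sum>l\<in>UNIV. (dpart i (V n) y $ l) *\<^sub>R N j l n y)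
                + (\<Sum>l\<in>UNIV. (V n y $ l) *\<^sub>R dpart i (N j l n) y)) x"
          by (rule rop_cong[OF dpart_combination x]) (auto intro: diff V1 N2)
        also have "\<dots> = rop I m' (\<lambda>j y. \<Sum>l\<in>UNIV. (dpart i (V n) y $ l) *\<^sub>R N j l n y) x
            + rop I m' (\<lambda>j y. \<Sum>l\<in>UNIV. (V n y $ l) *\<^sub>R dpart i (N j l n) y) x"
          by (intro rop_add[where \<delta> = \<delta>] continuous_on_combination x Ck_on_continuous[OF V1] Ck_on_continuous[OF N2]
              Ck_on_continuous[OF V1[unfolded Ck_on_Suc, THEN conjunct2, rule_format]]
              Ck_on_continuous[OF N2[unfolded Ck_on_Suc, THEN conjunct2, rule_format]])
        finally show ?thesis by (simp add: b'_def)
      qed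
      show ?thesis
        by (rule Suc.IH[OF b' N1 _ rec']) (use Suc.prems(3) in auto)
    qed
    moreover have "C0_conv ?S V" by (rule Ck_conv_C0[OF V])
    ultimately show ?case using V1 by (simp add: Ck_on_Suc) }
qed

lemma norm_combination_le:
  fixes v :: "real^4"
  assumes "\<And>l. norm (w l) \<le> B"
  shows "norm (\<Sum>l\<in>UNIV. (v $ l) *\<^sub>R w l) \<le> 4 * B * norm v"
proof -
  have "B \<ge> 0" using assms[of 0] norm_ge_zero order_trans by blast
  then have "norm ((v $ l) *\<^sub>R w l) \<le> norm v * B" for l
    unfolding norm_scaleR real_norm_def
    by (intro mult_mono assms component_le_norm_cart) auto
  then have "norm (\<Sum>l\<in>UNIV. (v $ l) *\<^sub>R w l) \<le> (\<Sum>l\<in>(UNIV::4 set). norm v * B)"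
    by (intro order_trans[OF norm_sum] sum_mono)
  then show ?thesis by (simp add: mult_ac)
qed

lemma finite_family_bounded:
  fixes F :: "'j \<Rightarrow> 'a::topological_space \<Rightarrow> 'b::real_normed_vector"
  assumes "finite J" "compact K" "\<And>j. j \<in> J \<Longrightarrow> continuous_on K (F j)"
  shows "\<exists>B\<ge>0. \<forall>j\<in>J. \<forall>y\<in>K. norm (F j y) \<le> B"
proof -
  have "bounded (\<Union>j\<in>J. F j ` K)"
    using assms compact_imp_bounded compact_continuous_image by blast
  then obtain B where "\<forall>z\<in>(\<Union>j\<in>J. F j ` K). norm z \<le> B" unfolding bounded_iff by blast
  then show ?thesis by (intro exI[of _ "max B 0"]) (auto simp: le_max_iff_disj)
qed

text \<open>Picard iteration. The bound L for the derivatives of the fields along the flow, and its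
  smallness, are passed on because the commutation argument runs a second contraction on the same
  ball.\<close>

lemma flow_exists:
  fixes e :: "4 \<Rightarrow> real^4 \<Rightarrow> real^4"
  assumes "open O'" "y0 \<in> O'" and sm: "\<And>j. j \<in> I \<Longrightarrow> smooth_on O' (e j)"
  obtains \<delta> \<psi> L where "\<delta> > 0" "smooth_on (ball 0 \<delta>) \<psi>" "\<And>x. x \<in> ball 0 \<delta> \<Longrightarrow> \<psi> x \<in> O'"
    "\<And>x. x \<in> ball 0 \<delta> \<Longrightarrow> \<psi> x = y0 + rad I 0 x + rop I 0 (\<lambda>j y. e j (\<psi> y)) x"
    "\<And>j y v. j \<in> I \<Longrightarrow> y \<in> ball 0 \<delta> \<Longrightarrow>
      norm (\<Sum>l\<in>UNIV. (v $ l) *\<^sub>R dpart l (e j) (\<psi> y)) \<le> L * norm v"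
    "L \<ge> 0" "real (card I) * \<delta> * L \<le> 1 / 2"
proof -
  obtain \<rho> where \<rho>: "\<rho> > 0" "cball y0 \<rho> \<subseteq> O'" using assms(1,2) open_contains_cball by blast
  define K where "K = cball y0 \<rho>"
  have K: "compact K" "K \<subseteq> O'" "convex K" using \<rho> by (auto simp: K_def)
  have eC: "Ck_on k O' (e j)" if "j \<in> I" for j k using sm[OF that] by (simp add: smooth_on_def)
  have eD: "Ck_on k O' (dpart l (e j))" if "j \<in> I" for j k l
    using eC[OF that, of "Suc k"] by (simp add: Ck_on_Suc)
  have ediff: "e j differentiable at y" if "j \<in> I" "y \<in> O'" for j y
    using eC[OF that(1), of "Suc 0"] that(2) assms(1) by (auto simp: Ck_on_Suc differentiable_on_eq_differentiable_at)
  have eK: "continuous_on K (e j)" "continuous_on K (dpart l (e j))" if "j \<in> I" for j l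
    using eC[OF that, of 0] eD[OF that, of 0 l] K(2) by (auto intro: continuous_on_subset)
  have "\<exists>C\<ge>0. \<forall>j\<in>I. \<forall>y\<in>K. norm (e j y) \<le> C"
    using eK(1) K(1) by (intro finite_family_bounded) auto
  then obtain C where C: "C \<ge> 0" "\<And>j y. j \<in> I \<Longrightarrow> y \<in> K \<Longrightarrow> norm (e j y) \<le> C" by blast
  have "continuous_on K (dpart (snd q) (e (fst q)))" if "q \<in> I \<times> UNIV" for q
    using eK(2) that by auto
  then have "\<exists>B\<ge>0. \<forall>q\<in>I \<times> UNIV. \<forall>y\<in>K. norm (dpart (snd q) (e (fst q)) y) \<le> B"
    using K(1) by (intro finite_family_bounded) auto
  then obtain B where B: "B \<ge> 0" "\<And>j l y. j \<in> I \<Longrightarrow> y \<in> K \<Longrightarrow> norm (dpart l (e j) y) \<le> B"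
    by fastforce
  define L where "L = 4 * B"
  have L0: "L \<ge> 0" using B(1) by (simp add: L_def)
  have L: "norm (\<Sum>l\<in>UNIV. (v $ l) *\<^sub>R dpart l (e j) y) \<le> L * norm v" if "j \<in> I" "y \<in> K" for j y v
    unfolding L_def by (intro norm_combination_le B that)
  have lip: "norm (e j y - e j z) \<le> L * norm (y - z)" if j: "j \<in> I" and "y \<in> K" "z \<in> K" for j y z
  proof (rule differentiable_bound[OF K(3) _ _ that(2,3)])
    fix y assume y: "y \<in> K"
    show "(e j has_derivative (\<lambda>v. \<Sum>l\<in>UNIV. (v $ l) *\<^sub>R dpart l (e j) y)) (at y within K)"
      by (rule has_derivative_at_withinI[OF has_derivative_dpart[OF ediff[OF j subsetD[OF K(2) y]]]])
    show "onorm (\<lambda>v. \<Sum>l\<in>UNIV. (v $ l) *\<^sub>R dpart l (e j) y) \<le> L"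
      by (rule onorm_bound[OF L0 L[OF j y]])
  qed
  \<comment> \<open>The first bound keeps the iterates in K, since they stay within \<delta> + card
    I * \<delta> * C of y0; its summand 1 accounts for the leading \<delta>. The second bound gives
    the factor 1/2, and its summand 1 avoids division by 0.\<close>
  define \<delta> where "\<delta> = min (\<rho> / (1 + real (card I) * C)) (1 / (2 * (1 + real (card I) * L)))"
  have p1: "1 + real (card I) * C > 0" "1 + real (card I) * L > 0" using C(1) L0 by (auto intro: add_pos_nonneg)
  have \<delta>: "\<delta> > 0" using p1 \<rho>(1) by (simp add: \<delta>_def)
  have "\<delta> \<le> \<rho> / (1 + real (card I) * C)" by (simp add: \<delta>_def)
  then have \<delta>\<rho>: "\<delta> + real (card I) * \<delta> * C \<le> \<rho>" using p1 by (simp add: pos_le_divide_eq algebra_simps)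
  have "\<delta> \<le> 1 / (2 * (1 + real (card I) * L))" by (simp add: \<delta>_def)
  then have "2 * (\<delta> + real (card I) * \<delta> * L) \<le> 1" using p1 by (simp add: pos_le_divide_eq algebra_simps)
  then have small: "real (card I) * \<delta> * L \<le> 1 / 2" using \<delta> by simp
  let ?S = "ball 0 \<delta> :: (real^4) set"
  have half: "real (card I) * \<delta> * (L * d) \<le> d / 2" if "d \<ge> 0" for d
    using mult_right_mono[OF small that] by (simp add: mult.assoc)
  define P where "P = rec_nat (\<lambda>x. y0 + rad I 0 x) (\<lambda>_ f x. y0 + rad I 0 x + rop I 0 (\<lambda>j y. e j (f y)) x)"
  have P0: "P 0 = (\<lambda>x. y0 + rad I 0 x)"
    and PS: "P (Suc n) = (\<lambda>x. y0 + rad I 0 x + rop I 0 (\<lambda>j y. e j (P n y)) x)" for n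
    by (simp_all add: P_def)
  have radC: "Ck_on k ?S (\<lambda>x. y0 + rad I 0 x)" for k
    by (intro Ck_on_add Ck_on_const Ck_on_linear bounded_linear_rad open_ball)
  have P: "(\<forall>k. Ck_on k ?S (P n)) \<and> (\<forall>x\<in>?S. P n x \<in> K)" for n
  proof (induction n)
    case 0
    have "norm (rad I 0 x) \<le> \<rho>" if "x \<in> ?S" for x
    proof -
      have "real (card I) * \<delta> * C \<ge> 0" using C(1) \<delta> by simp
      then show ?thesis using norm_rad_le[of 0 I x] that \<delta>\<rho> by simp
    qed
    then show ?case unfolding P0 using radC by (simp add: K_def dist_norm)
  next
    case (Suc n)
    have ePC: "Ck_on k ?S (\<lambda>y. e j (P n y))" if "j \<in> I" for k j
      using Suc K(2) by (intro Ck_on_compose[OF open_ball assms(1) eC[OF that]]) auto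
    have "P (Suc n) x \<in> K" if x: "x \<in> ?S" for x
    proof -
      have "norm (rop I 0 (\<lambda>j y. e j (P n y)) x) \<le> real (card I) * \<delta> * C"
        using ePC[of _ 0] Suc x by (intro norm_rop_le[OF _ x] C) auto
      then have "norm (rad I 0 x + rop I 0 (\<lambda>j y. e j (P n y)) x) \<le> \<delta> + real (card I) * \<delta> * C"
        using norm_rad_le[of 0 I x] x by (intro norm_triangle_mono) auto
      moreover have "P (Suc n) x - y0 = rad I 0 x + rop I 0 (\<lambda>j y. e j (P n y)) x" by (simp add: PS)
      ultimately have "dist (P (Suc n) x) y0 \<le> \<rho>" using \<delta>\<rho> by (simp only: dist_norm)
      then show ?thesis by (simp add: K_def dist_commute)
    qed
    moreover have "Ck_on k ?S (P (Suc n))" for k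
      unfolding PS by (intro Ck_on_add[OF open_ball radC] Ck_on_rop ePC)
    ultimately show ?case by blast
  qed
  have PC: "Ck_on k ?S (P n)" and PK: "x \<in> ?S \<Longrightarrow> P n x \<in> K" for k n x using P by auto
  have ePC: "Ck_on k ?S (\<lambda>y. e j (P n y))" if "j \<in> I" for k j n
    using PK K(2) by (intro Ck_on_compose[OF open_ball assms(1) eC[OF that] PC]) auto
  have ePc: "continuous_on ?S (\<lambda>y. e j (P n y))" if "j \<in> I" for j n using ePC[OF that, of 0] by simp
  have PB: "norm (P n x) \<le> norm y0 + \<rho>" if "x \<in> ?S" for n x
    using PK[OF that, of n] norm_triangle_ineq2[of "P n x" y0] by (simp add: K_def dist_norm norm_minus_commute)
  have step: "norm (rop I 0 (\<lambda>j y. e j (f y)) x - rop I 0 (\<lambda>j y. e j (h y)) x) \<le> d / 2"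
    if "\<And>j. j \<in> I \<Longrightarrow> continuous_on ?S (\<lambda>y. e j (f y))" "\<And>j. j \<in> I \<Longrightarrow> continuous_on ?S (\<lambda>y. e j (h y))"
      "\<And>y. y \<in> ?S \<Longrightarrow> f y \<in> K" "\<And>y. y \<in> ?S \<Longrightarrow> h y \<in> K" "\<And>y. y \<in> ?S \<Longrightarrow> dist (f y) (h y) \<le> d"
      and x: "x \<in> ?S" for f h d x
  proof -
    have d: "d \<ge> 0" using that(5)[OF x] zero_le_dist order_trans by blast
    have "norm (rop I 0 (\<lambda>j y. e j (f y) - e j (h y)) x) \<le> real (card I) * \<delta> * (L * d)"
    proof (rule norm_rop_le[OF _ x])
      fix j and y :: "real^4" assume j: "j \<in> I" and "norm y \<le> norm x"
      then have y: "y \<in> ?S" using x by auto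
      show "norm (e j (f y) - e j (h y)) \<le> L * d"
        using lip[OF j that(3)[OF y] that(4)[OF y]] mult_left_mono[OF that(5)[OF y] L0]
        by (simp add: dist_norm)
    qed (use that d L0 in \<open>auto intro: continuous_on_diff\<close>)
    then show ?thesis using half[OF d] by (simp add: rop_diff[OF that(1,2) x])
  qed
  have "uniformly_Cauchy_on ?S P"
  proof (rule uniformly_Cauchy_on_perturbed_contraction[OF PB])
    fix \<epsilon> :: real assume "\<epsilon> > 0"
    have "dist (P (Suc k) x) (P (Suc n) x) \<le> \<epsilon> + d / 2"
      if "\<forall>x\<in>?S. dist (P k x) (P n x) \<le> d" "x \<in> ?S" for k n d x
      using step[of "P k" "P n" d x, OF ePc ePc PK PK _ that(2)] that(1) \<open>\<epsilon> > 0\<close>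
      by (simp add: PS dist_norm)
    then show "\<exists>N. \<forall>k\<ge>N. \<forall>n\<ge>N. \<forall>d. (\<forall>x\<in>?S. dist (P k x) (P n x) \<le> d) \<longrightarrow>
        (\<forall>x\<in>?S. dist (P (Suc k) x) (P (Suc n) x) \<le> \<epsilon> + d / 2)" by blast
  qed
  then have P_C0: "C0_conv ?S P"
    using PC[of 0, unfolded Ck_on.simps] PB
    unfolding C0_conv_def uniformly_convergent_eq_Cauchy by blast
  \<comment> \<open>Once the iterates converge in C^k, so do the derivatives of the fields along
    them. With these as coefficients, the derivatives of the iterates solve a linear iteration and
    converge in C^k too, which raises the order by one on the same ball.\<close>
  have P_Ck: "Ck_conv k ?S P" for k
  proof (induction k)
    case 0
    show ?case using P_C0 by simp
  next
    case (Suc k)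
    have N: "Ck_conv k ?S (\<lambda>n y. dpart l (e j) (P n y))" if "j \<in> I" for j l
      by (rule Ck_conv_compose[OF open_ball assms(1) K(1,2) eD[OF that] Suc PK])
    have "Ck_conv k ?S (\<lambda>n. dpart i (P n))" for i
    proof -
      have R: "dpart i (\<lambda>x. y0 + rad I 0 x) x = rad I 0 (axis i 1)" for x
        using dpart_eqI[OF has_derivative_add[OF has_derivative_const
              bounded_linear_imp_has_derivative[OF bounded_linear_rad]], of i y0 I 0 x] by simp
      define b where "b n x = rad I 0 (axis i 1) + (if i \<in> I then rint I 0 (\<lambda>y. e i (P n y)) x else 0)" for n x
      have "Ck_conv k ?S (\<lambda>n x. if i \<in> I then rint I 0 (\<lambda>y. e i (P n y)) x else 0)"
      proof (cases "i \<in> I")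
        case True
        then show ?thesis
          using Ck_conv_rint[OF Ck_conv_compose[OF open_ball assms(1) K(1,2) eC[OF True] Suc PK]] by simp
      qed simp
      then have b: "Ck_conv k ?S b" unfolding b_def[abs_def] by (intro Ck_conv_add Ck_conv_const open_ball)
      have rec: "dpart i (P (Suc n)) x = b n x + rop I (if i \<in> I then Suc 0 else 0)
          (\<lambda>j y. \<Sum>l\<in>UNIV. (dpart i (P n) y $ l) *\<^sub>R dpart l (e j) (P n y)) x" if x: "x \<in> ?S" for n x
      proof -
        have "dpart i (P (Suc n)) x = dpart i (\<lambda>x. y0 + rad I 0 x) x + dpart i (rop I 0 (\<lambda>j y. e j (P n y))) x"
          unfolding PS using radC[of "Suc 0"] x
          by (intro dpart_add rop_dpart(1)[OF ePC x]) (auto simp: Ck_on_Suc differentiable_on_eq_differentiable_at)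
        also have "dpart i (rop I 0 (\<lambda>j y. e j (P n y))) x
            = (if i \<in> I then rint I 0 (\<lambda>y. e i (P n y)) x else 0)
              + rop I (if i \<in> I then Suc 0 else 0) (\<lambda>j. dpart i (\<lambda>y. e j (P n y))) x"
          by (rule rop_dpart(2)[OF ePC x])
        also have "rop I (if i \<in> I then Suc 0 else 0) (\<lambda>j. dpart i (\<lambda>y. e j (P n y))) x
            = rop I (if i \<in> I then Suc 0 else 0)
              (\<lambda>j y. \<Sum>l\<in>UNIV. (dpart i (P n) y $ l) *\<^sub>R dpart l (e j) (P n y)) x"
        proof (rule rop_cong[OF dpart_compose(2) x])
          fix y assume "y \<in> ?S"
          then show "P n differentiable at y"
            using PC[of "Suc 0" n] by (auto simp: Ck_on_Suc differentiable_on_eq_differentiable_at)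
        qed (intro ediff subsetD[OF K(2) PK])
        finally show ?thesis by (simp add: R b_def add.assoc)
      qed
      have "dpart i (P 0) = (\<lambda>x. rad I 0 (axis i 1))" using R by (auto simp: P0)
      then show ?thesis
        by (intro Ck_conv_linear_iteration[OF b N _ rec L small \<delta> L0]) (auto simp: PK)
    qed
    then show ?case using P_C0 PC[of "Suc 0"] by (simp add: Ck_on_Suc)
  qed
  obtain \<psi> where \<psi>: "uniform_limit ?S P \<psi> sequentially"
    using P_C0 by (auto simp: C0_conv_def uniformly_convergent_on_def)
  note lim = tendsto_uniform_limitI[OF \<psi>]
  have \<psi>C: "Ck_on k ?S \<psi>" for k
    by (rule Ck_conv_limit[OF open_ball convex_ball P_Ck lim])
  have \<psi>K: "\<psi> x \<in> K" if "x \<in> ?S" for x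
    using PK[OF that] K(1) by (intro closed_sequentially[OF compact_imp_closed _ lim[OF that]]) auto
  have e\<psi>c: "continuous_on ?S (\<lambda>y. e j (\<psi> y))" if "j \<in> I" for j
    using \<psi>C[of 0] \<psi>K by (intro continuous_on_compose2[OF eK(1)[OF that]]) auto
  have fix_eq: "\<psi> x = y0 + rad I 0 x + rop I 0 (\<lambda>j y. e j (\<psi> y)) x" if x: "x \<in> ?S" for x
  proof -
    have "(\<lambda>n. rop I 0 (\<lambda>j y. e j (P n y)) x) \<longlonglongrightarrow> rop I 0 (\<lambda>j y. e j (\<psi> y)) x"
    proof (rule tendstoI)
      fix \<epsilon> :: real assume \<epsilon>: "\<epsilon> > 0"
      from uniform_limitD[OF \<psi> \<epsilon>]
      show "\<forall>\<^sub>F n in sequentially. dist (rop I 0 (\<lambda>j y. e j (P n y)) x) (rop I 0 (\<lambda>j y. e j (\<psi> y)) x) < \<epsilon>"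
      proof eventually_elim
        case (elim n)
        then show ?case
          using step[of "P n" \<psi> \<epsilon> x, OF ePc e\<psi>c PK \<psi>K _ x] \<epsilon> by (force simp: dist_norm)
      qed
    qed
    then have "(\<lambda>n. P (Suc n) x) \<longlonglongrightarrow> y0 + rad I 0 x + rop I 0 (\<lambda>j y. e j (\<psi> y)) x"
      unfolding PS by (intro tendsto_add tendsto_const)
    then show ?thesis using LIMSEQ_unique[OF LIMSEQ_Suc[OF lim[OF x]]] by blast
  qed
  show thesis
    by (rule that[of \<delta> \<psi> L]) (use \<delta> \<psi>C \<psi>K K(2) fix_eq L L0 small in \<open>auto simp: smooth_on_def\<close>)
qed

section \<open>Derivatives of the radial flow\<close>

text \<open>Integrate the derivative of t h(\<open>rad I t x\<close>) over [0, 1]; the factor t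
  removes the boundary term at 0.\<close>

lemma radial_identity:
  fixes h :: "real^4 \<Rightarrow> 'b::banach"
  assumes "Ck_on (Suc 0) (ball 0 \<delta>) h" "x \<in> ball 0 \<delta>"
  shows "h x = rint I 0 h x + rop I (Suc 0) (\<lambda>j. dpart j h) x"
proof -
  have hc: "continuous_on (ball 0 \<delta>) h" by (rule Ck_on_continuous[OF assms(1)])
  have dc: "continuous_on (ball 0 \<delta>) (dpart j h)" for j using assms(1) by (simp add: Ck_on_Suc)
  define w where "w = (\<chi> i. if i \<in> I then x $ i else 0)"
  have rad_eq: "rad I t x = rad I 0 x + t *\<^sub>R w" for t
    by (simp add: rad_def w_def vec_eq_iff)
  let ?D = "\<lambda>t. \<Sum>j\<in>I. (x $ j) *\<^sub>R dpart j h (rad I t x)"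
  have "((\<lambda>t. t *\<^sub>R h (rad I t x)) has_vector_derivative (t *\<^sub>R ?D t + h (rad I t x))) (at t within {0..1})"
    if t: "t \<in> {0..1}" for t
  proof -
    have "h differentiable at (rad I t x)"
      using rad_in_ball[OF t assms(2), of I] assms(1)
      by (auto simp: Ck_on_Suc differentiable_on_eq_differentiable_at)
    from has_derivative_dpart[OF this]
    have 1: "(h has_derivative (\<lambda>v. \<Sum>i\<in>UNIV. (v $ i) *\<^sub>R dpart i h (rad I t x))) (at (rad I t x))" .
    have 2: "((\<lambda>t. rad I t x) has_derivative (\<lambda>s. s *\<^sub>R w)) (at t within {0..1})"
      by (subst rad_eq) (rule has_derivative_eq_rhs[OF has_derivative_add[OF has_derivative_const
              has_derivative_scaleR_left[OF has_derivative_ident]]], simp)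
    have 3: "(\<Sum>i\<in>UNIV. ((s *\<^sub>R w) $ i) *\<^sub>R dpart i h (rad I t x)) = s *\<^sub>R ?D t" for s
    proof -
      have "(\<Sum>i\<in>UNIV. ((s *\<^sub>R w) $ i) *\<^sub>R dpart i h (rad I t x))
          = (\<Sum>i\<in>UNIV. if i \<in> I then s *\<^sub>R (x $ i) *\<^sub>R dpart i h (rad I t x) else 0)"
        by (intro sum.cong) (auto simp: w_def)
      then show ?thesis by (simp add: sum.If_cases scaleR_sum_right)
    qed
    have "((\<lambda>t. h (rad I t x)) has_vector_derivative ?D t) (at t within {0..1})"
      using has_derivative_compose[OF 2 1] unfolding has_vector_derivative_def 3 .
    from has_vector_derivative_scaleR[OF DERIV_ident this] show ?thesis by simp
  qed
  from fundamental_theorem_of_calculus[OF _ this]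
  have "((\<lambda>t. t *\<^sub>R ?D t + h (rad I t x)) has_integral (h x)) {0..1}" by simp
  then have "h x = integral {0..1} (\<lambda>t. t *\<^sub>R ?D t + h (rad I t x))" by (simp add: integral_unique)
  also have "\<dots> = integral {0..1} (\<lambda>t. (\<Sum>j\<in>I. (x $ j) *\<^sub>R t ^ Suc 0 *\<^sub>R dpart j h (rad I t x)) + t ^ 0 *\<^sub>R h (rad I t x))"
    by (simp add: scaleR_sum_right mult.commute)
  also have "\<dots> = (\<Sum>j\<in>I. (x $ j) *\<^sub>R rint I (Suc 0) (dpart j h) x) + rint I 0 h x"
  proof -
    have i: "(\<lambda>t. (x $ j) *\<^sub>R t ^ Suc 0 *\<^sub>R dpart j h (rad I t x)) integrable_on {0..1}" for j
      by (rule integrable_cmul[OF rint_integrable[OF dc assms(2)]])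
    show ?thesis
      unfolding rint_def integral_add[OF integrable_sum[OF finite i] rint_integrable[OF hc assms(2)]]
        integral_sum[OF finite i] integral_cmul ..
  qed
  finally show ?thesis by (simp add: rop_def)
qed

text \<open>For j in I, one factor t turns x_j into the j-th coordinate of \<open>rad I t x\<close>.
  An operator of positive exponent therefore sees its arguments only through their contraction with
  the position vector.\<close>

lemma rop_Suc_cong:
  fixes h h' :: "4 \<Rightarrow> real^4 \<Rightarrow> 'b::banach"
  assumes "\<And>j. j \<in> I \<Longrightarrow> continuous_on (ball 0 \<delta>) (h j)"
    and "\<And>j. j \<in> I \<Longrightarrow> continuous_on (ball 0 \<delta>) (h' j)"
    and eq: "\<And>y. y \<in> ball 0 \<delta> \<Longrightarrow> (\<Sum>j\<in>I. (y $ j) *\<^sub>R h j y) = (\<Sum>j\<in>I. (y $ j) *\<^sub>R h' j y)"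
    and x: "x \<in> ball 0 \<delta>"
  shows "rop I (Suc m) h x = rop I (Suc m) h' x"
proof -
  have *: "rop I (Suc m) h x = integral {0..1} (\<lambda>t. t ^ m *\<^sub>R (\<Sum>j\<in>I. (rad I t x $ j) *\<^sub>R h j (rad I t x)))"
    if "\<And>j. j \<in> I \<Longrightarrow> continuous_on (ball 0 \<delta>) (h j)" for h :: "4 \<Rightarrow> real^4 \<Rightarrow> 'b"
  proof -
    have "rop I (Suc m) h x = (\<Sum>j\<in>I. integral {0..1} (\<lambda>t. (x $ j) *\<^sub>R t ^ Suc m *\<^sub>R h j (rad I t x)))"
      unfolding rop_def rint_def integral_cmul ..
    also have "\<dots> = integral {0..1} (\<lambda>t. \<Sum>j\<in>I. (x $ j) *\<^sub>R t ^ Suc m *\<^sub>R h j (rad I t x))"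
      by (rule integral_sum[OF finite integrable_cmul[OF rint_integrable[OF that x]], symmetric])
    also have "\<dots> = integral {0..1} (\<lambda>t. t ^ m *\<^sub>R (\<Sum>j\<in>I. (rad I t x $ j) *\<^sub>R h j (rad I t x)))"
      unfolding scaleR_sum_right
      by (intro Henstock_Kurzweil_Integration.integral_cong sum.cong) (auto simp: rad_def mult_ac)
    finally show ?thesis .
  qed
  show ?thesis
    by (simp only: *[of h, OF assms(1)] *[of h', OF assms(2)])
       (rule Henstock_Kurzweil_Integration.integral_cong, simp add: eq[OF rad_in_ball[OF _ x]])
qed

text \<open>At a point z where the norm of r is maximal on the closed ball through x, the equation
  bounds that norm by half of itself. This works because the operator at z only looks at points of
  norm at most that of z.\<close>

lemma linear_fixed_point_zero:
  fixes r :: "real^4 \<Rightarrow> real^4"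
  assumes rc: "continuous_on (ball 0 \<delta>) r"
    and N: "\<And>j l. j \<in> I \<Longrightarrow> continuous_on (ball 0 \<delta>) (N j l)"
    and L: "\<And>j y v. j \<in> I \<Longrightarrow> y \<in> ball 0 \<delta> \<Longrightarrow>
      norm (\<Sum>l\<in>UNIV. (v $ l) *\<^sub>R N j l y) \<le> L * norm (v::real^4)"
    and small: "real (card I) * \<delta> * L \<le> 1 / 2" "L \<ge> 0"
    and eq: "\<And>x. x \<in> ball 0 \<delta> \<Longrightarrow> r x = rop I m (\<lambda>j y. \<Sum>l\<in>UNIV. (r y $ l) *\<^sub>R N j l y) x"
    and x: "x \<in> ball 0 \<delta>"
  shows "r x = 0"
proof -
  have sub: "cball 0 (norm x) \<subseteq> ball 0 \<delta>" using x by auto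
  have "continuous_on (cball 0 (norm x)) (\<lambda>y. norm (r y))"
    using continuous_on_subset[OF rc sub] by (rule continuous_on_norm)
  from continuous_attains_sup[OF compact_cball _ this]
  obtain z where z: "norm z \<le> norm x" "\<And>y. norm y \<le> norm x \<Longrightarrow> norm (r y) \<le> norm (r z)" by auto
  have zb: "z \<in> ball 0 \<delta>" using z(1) x by auto
  have "norm (rop I m (\<lambda>j y. \<Sum>l\<in>UNIV. (r y $ l) *\<^sub>R N j l y) z) \<le> real (card I) * \<delta> * (L * norm (r z))"
  proof (rule norm_rop_le[OF _ zb])
    show "continuous_on (ball 0 \<delta>) (\<lambda>y. \<Sum>l\<in>UNIV. (r y $ l) *\<^sub>R N j l y)" if "j \<in> I" for j
      by (intro continuous_on_combination rc N that)
    fix j and y :: "real^4" assume j: "j \<in> I" and y: "norm y \<le> norm z"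
    have "y \<in> ball 0 \<delta>" using y zb by auto
    with L[OF j, of y "r y"] mult_left_mono[OF z(2)[OF order_trans[OF y z(1)]] small(2)]
    show "norm (\<Sum>l\<in>UNIV. (r y $ l) *\<^sub>R N j l y) \<le> L * norm (r z)" by linarith
  qed (use small(2) in auto)
  also have "\<dots> \<le> 1 / 2 * norm (r z)"
    using mult_right_mono[OF small(1) norm_ge_zero[of "r z"]] by (simp add: mult.assoc)
  finally have "norm (r z) \<le> 1 / 2 * norm (r z)" using eq[OF zb] by simp
  then show ?thesis using z(2)[of x] by simp
qed

text \<open>Let h_j be e_j along the flow. Differentiating the fixed point equation and subtracting
  the radial identity for h_i expresses r = d_i \<psi> - h_i as the operator of exponent 1 applied
  to d_i h_j - d_j h_i. Commutativity turns the second term into the first with h_i in place of d_i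
  \<psi>, so r solves a homogeneous linear equation and vanishes.\<close>

lemma commuting_frame_flow:
  fixes e :: "4 \<Rightarrow> real^4 \<Rightarrow> real^4"
  assumes "open O'" "y0 \<in> O'" and sm: "\<And>j. j \<in> I \<Longrightarrow> smooth_on O' (e j)"
    and comm: "\<And>i j y. i \<in> I \<Longrightarrow> j \<in> I \<Longrightarrow> y \<in> O' \<Longrightarrow>
      (\<Sum>l\<in>UNIV. (e i y $ l) *\<^sub>R dpart l (e j) y) = (\<Sum>l\<in>UNIV. (e j y $ l) *\<^sub>R dpart l (e i) y)"
  obtains \<delta> \<psi> where "\<delta> > 0" "smooth_on (ball 0 \<delta>) \<psi>" "\<And>x. x \<in> ball 0 \<delta> \<Longrightarrow> \<psi> x \<in> O'"
    "\<And>x. x \<in> ball 0 \<delta> \<Longrightarrow> \<psi> x = y0 + rad I 0 x + rop I 0 (\<lambda>j y. e j (\<psi> y)) x"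
    "\<And>i x. i \<in> I \<Longrightarrow> x \<in> ball 0 \<delta> \<Longrightarrow> dpart i \<psi> x = e i (\<psi> x)"
proof (rule flow_exists[OF assms(1-3)])
  fix \<delta> L :: real and \<psi> :: "real^4 \<Rightarrow> real^4"
  assume \<delta>: "\<delta> > 0"
    and \<psi>: "smooth_on (ball 0 \<delta>) \<psi>" "\<And>x. x \<in> ball 0 \<delta> \<Longrightarrow> \<psi> x \<in> O'"
    and fp: "\<And>x. x \<in> ball 0 \<delta> \<Longrightarrow> \<psi> x = y0 + rad I 0 x + rop I 0 (\<lambda>j y. e j (\<psi> y)) x"
    and L: "\<And>j y v. j \<in> I \<Longrightarrow> y \<in> ball 0 \<delta> \<Longrightarrow>
      norm (\<Sum>l\<in>UNIV. (v $ l) *\<^sub>R dpart l (e j) (\<psi> y)) \<le> L * norm v"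
    and small: "L \<ge> 0" "real (card I) * \<delta> * L \<le> 1 / 2"
  let ?S = "ball 0 \<delta> :: (real^4) set"
  have \<psi>C: "Ck_on k ?S \<psi>" for k using \<psi>(1) by (simp add: smooth_on_def)
  have \<psi>d: "\<psi> differentiable at x" if "x \<in> ?S" for x
    using \<psi>C[of "Suc 0"] that by (auto simp: Ck_on_Suc differentiable_on_eq_differentiable_at)
  have eC: "Ck_on k O' (e j)" if "j \<in> I" for j k using sm[OF that] by (simp add: smooth_on_def)
  have eD: "Ck_on k O' (dpart l (e j))" if "j \<in> I" for j k l
    using eC[OF that, of "Suc k"] by (simp add: Ck_on_Suc)
  have ed: "e j differentiable at (\<psi> x)" if "j \<in> I" "x \<in> ?S" for j x
    using eC[OF that(1), of "Suc 0"] \<psi>(2)[OF that(2)] assms(1)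
    by (auto simp: Ck_on_Suc differentiable_on_eq_differentiable_at)
  define h where "h j y = e j (\<psi> y)" for j y
  define N where "N j l y = dpart l (e j) (\<psi> y)" for j l y
  have hC: "Ck_on k ?S (h j)" if "j \<in> I" for k j
    unfolding h_def[abs_def] by (rule Ck_on_compose[OF open_ball assms(1) eC[OF that] \<psi>C \<psi>(2)])
  have dhC: "Ck_on k ?S (dpart i (h j))" if "j \<in> I" for k i j
    using hC[OF that, of "Suc k"] by (simp add: Ck_on_Suc)
  have NC: "Ck_on k ?S (N j l)" if "j \<in> I" for k j l
    unfolding N_def[abs_def] by (rule Ck_on_compose[OF open_ball assms(1) eD[OF that] \<psi>C \<psi>(2)])
  have dh: "dpart i (h j) y = (\<Sum>l\<in>UNIV. (dpart i \<psi> y $ l) *\<^sub>R N j l y)" if "j \<in> I" "y \<in> ?S" for i j y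
    unfolding h_def[abs_def] N_def by (rule dpart_compose(2)[OF \<psi>d[OF that(2)] ed[OF that]])
  have d\<psi>: "dpart i \<psi> x = rint I 0 (h i) x + rop I (Suc 0) (\<lambda>j. dpart i (h j)) x"
    if i: "i \<in> I" and x: "x \<in> ?S" for i x
  proof -
    have A: "((\<lambda>x. y0 + rad I 0 x) has_derivative rad I 0) (at x)"
      by (rule has_derivative_eq_rhs[OF has_derivative_add[OF has_derivative_const
              bounded_linear_imp_has_derivative[OF bounded_linear_rad]]]) simp
    have "dpart i \<psi> x = dpart i (\<lambda>x. (y0 + rad I 0 x) + rop I 0 h x) x"
      using fp by (intro dpart_cong_open[OF open_ball x]) (simp add: h_def[abs_def])
    also have "\<dots> = dpart i (\<lambda>x. y0 + rad I 0 x) x + dpart i (rop I 0 h) x"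
      using A by (intro dpart_add rop_dpart(1)[OF hC x]) (auto simp: differentiable_def)
    also have "dpart i (\<lambda>x. y0 + rad I 0 x) x = 0" using dpart_eqI[OF A] i by (simp add: rad_axis)
    finally show ?thesis using rop_dpart(2)[where I = I and m = 0 and i = i and h = h, OF hC x] i by simp
  qed
  \<comment> \<open>Euler's identity for the flow: along rays, \<open>\<psi>\<close> is an integral curve of \<open>\<Sum>x\<^sub>j e\<^sub>j\<close>.\<close>
  have radial: "(\<Sum>i\<in>I. (x $ i) *\<^sub>R dpart i \<psi> x) = (\<Sum>j\<in>I. (x $ j) *\<^sub>R h j x)" if x: "x \<in> ?S" for x
  proof -
    have "(\<Sum>i\<in>I. (x $ i) *\<^sub>R dpart i \<psi> x) = (\<Sum>i\<in>I. (x $ i) *\<^sub>R rint I 0 (h i) x)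
        + (\<Sum>i\<in>I. \<Sum>j\<in>I. (x $ i) *\<^sub>R (x $ j) *\<^sub>R rint I (Suc 0) (dpart i (h j)) x)"
      using d\<psi>[OF _ x] by (simp add: rop_def scaleR_add_right scaleR_sum_right sum.distrib)
    also have "(\<Sum>i\<in>I. \<Sum>j\<in>I. (x $ i) *\<^sub>R (x $ j) *\<^sub>R rint I (Suc 0) (dpart i (h j)) x)
        = (\<Sum>j\<in>I. \<Sum>i\<in>I. (x $ j) *\<^sub>R (x $ i) *\<^sub>R rint I (Suc 0) (dpart i (h j)) x)"
      by (subst sum.swap) (simp add: mult.commute)
    also have "(\<Sum>i\<in>I. (x $ i) *\<^sub>R rint I 0 (h i) x)
        + (\<Sum>j\<in>I. \<Sum>i\<in>I. (x $ j) *\<^sub>R (x $ i) *\<^sub>R rint I (Suc 0) (dpart i (h j)) x)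
        = (\<Sum>j\<in>I. (x $ j) *\<^sub>R (rint I 0 (h j) x + rop I (Suc 0) (\<lambda>i. dpart i (h j)) x))"
      by (simp add: rop_def scaleR_add_right scaleR_sum_right sum.distrib)
    also have "\<dots> = (\<Sum>j\<in>I. (x $ j) *\<^sub>R h j x)"
      using radial_identity[OF hC x] by (intro sum.cong) auto
    finally show ?thesis .
  qed
  have "dpart i \<psi> x = h i x" if i: "i \<in> I" and x: "x \<in> ?S" for i x
  proof -
    define r :: "real^4 \<Rightarrow> real^4" where "r y = dpart i \<psi> y - h i y" for y
    have d\<psi>c: "continuous_on ?S (dpart i \<psi>)" for i using \<psi>C[of "Suc 0"] by (simp add: Ck_on_Suc)
    note hc = Ck_on_continuous[OF hC]
    note dhc = Ck_on_continuous[OF dhC]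
    note Nc = Ck_on_continuous[OF NC]
    \<comment> \<open>The integrands agree only after contraction with y_j: Euler's identity
      replaces d_j \<psi> by h_j, and commutativity then exchanges i and j.\<close>
    have swap: "rop I (Suc 0) (\<lambda>j. dpart j (h i)) x = rop I (Suc 0) (\<lambda>j y. \<Sum>l\<in>UNIV. (h i y $ l) *\<^sub>R N j l y) x"
      if x: "x \<in> ?S" for x
    proof (rule rop_Suc_cong[OF dhc[OF i] _ _ x])
      show "continuous_on ?S (\<lambda>y. \<Sum>l\<in>UNIV. (h i y $ l) *\<^sub>R N j l y)" if "j \<in> I" for j
        by (intro continuous_on_combination hc[OF i] Nc[OF that])
      fix y assume y: "y \<in> ?S"
      have "(\<Sum>j\<in>I. (y $ j) *\<^sub>R dpart j (h i) y)
          = (\<Sum>l\<in>UNIV. ((\<Sum>j\<in>I. (y $ j) *\<^sub>R dpart j \<psi> y) $ l) *\<^sub>R N i l y)"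
        unfolding dh[OF i y] by (simp add: scaleR_sum_right scaleR_sum_left) (subst sum.swap, simp)
      also have "\<dots> = (\<Sum>j\<in>I. (y $ j) *\<^sub>R (\<Sum>l\<in>UNIV. (h j y $ l) *\<^sub>R N i l y))"
        unfolding radial[OF y] by (simp add: scaleR_sum_right scaleR_sum_left) (subst sum.swap, simp)
      also have "\<dots> = (\<Sum>j\<in>I. (y $ j) *\<^sub>R (\<Sum>l\<in>UNIV. (h i y $ l) *\<^sub>R N j l y))"
        unfolding h_def N_def using comm[OF _ i \<psi>(2)[OF y]] by (intro sum.cong) auto
      finally show "(\<Sum>j\<in>I. (y $ j) *\<^sub>R dpart j (h i) y)
          = (\<Sum>j\<in>I. (y $ j) *\<^sub>R (\<Sum>l\<in>UNIV. (h i y $ l) *\<^sub>R N j l y))" .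
    qed
    have "r x = 0"
    proof (rule linear_fixed_point_zero[where r = r and N = N and L = L and I = I and m = "Suc 0", OF _ Nc _ small(2,1) _ x])
      show "continuous_on ?S r" unfolding r_def[abs_def] by (intro continuous_on_diff d\<psi>c hc[OF i])
      show "norm (\<Sum>l\<in>UNIV. (v $ l) *\<^sub>R N j l y) \<le> L * norm v" if "j \<in> I" "y \<in> ?S" for j y v
        using L[OF that, of v] by (simp add: N_def)
      fix x :: "real^4" assume x: "x \<in> ?S"
      have "r x = rop I (Suc 0) (\<lambda>j. dpart i (h j)) x - rop I (Suc 0) (\<lambda>j. dpart j (h i)) x"
        unfolding r_def d\<psi>[OF i x] using radial_identity[OF hC[OF i] x, of I] by simp
      also have "rop I (Suc 0) (\<lambda>j. dpart i (h j)) x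
          = rop I (Suc 0) (\<lambda>j y. \<Sum>l\<in>UNIV. (dpart i \<psi> y $ l) *\<^sub>R N j l y) x"
        by (rule rop_cong[OF dh x])
      also have "\<dots> - rop I (Suc 0) (\<lambda>j. dpart j (h i)) x
          = rop I (Suc 0) (\<lambda>j y. (\<Sum>l\<in>UNIV. (dpart i \<psi> y $ l) *\<^sub>R N j l y)
              - (\<Sum>l\<in>UNIV. (h i y $ l) *\<^sub>R N j l y)) x"
        unfolding swap[OF x]
        by (rule rop_diff[symmetric, where \<delta> = \<delta>])
           (intro continuous_on_combination d\<psi>c hc[OF i] Nc x; assumption)+
      finally show "r x = rop I (Suc 0) (\<lambda>j y. \<Sum>l\<in>UNIV. (r y $ l) *\<^sub>R N j l y) x"
        by (simp add: r_def scaleR_diff_left sum_subtractf)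
    qed
    then show ?thesis by (simp add: r_def)
  qed
  then show thesis using that[OF \<delta> \<psi> fp] by (simp add: h_def)
qed

section \<open>Charts\<close>

lemma smooth_on_differentiable:
  "smooth_on S F \<Longrightarrow> open S \<Longrightarrow> x \<in> S \<Longrightarrow> F differentiable at x"
  unfolding smooth_on_def by (metis Ck_on_Suc differentiable_on_eq_differentiable_at)

lemma smooth_on_dpart: "smooth_on S F \<Longrightarrow> smooth_on S (dpart i F)"
  unfolding smooth_on_def by (metis Ck_on_Suc)

lemma smooth_on_continuous: "smooth_on S F \<Longrightarrow> continuous_on S F"
  unfolding smooth_on_def using Ck_on.simps(1) by blast

lemma smooth_on_cong:
  "open S \<Longrightarrow> (\<And>y. y \<in> S \<Longrightarrow> F y = H y) \<Longrightarrow> smooth_on S F \<Longrightarrow> smooth_on S H"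
  unfolding smooth_on_def using Ck_on_cong by metis

lemma smooth_on_subset: "smooth_on S F \<Longrightarrow> T \<subseteq> S \<Longrightarrow> smooth_on T F"
  unfolding smooth_on_def using Ck_on_subset by metis

lemma smooth_on_compose:
  "open S \<Longrightarrow> open T \<Longrightarrow> smooth_on T F \<Longrightarrow> smooth_on S H \<Longrightarrow> (\<And>x. x \<in> S \<Longrightarrow> H x \<in> T) \<Longrightarrow>
    smooth_on S (\<lambda>x. F (H x))"
  unfolding smooth_on_def using Ck_on_compose[of S T] by metis

lemma smooth_on_nth: "open S \<Longrightarrow> smooth_on S F \<Longrightarrow> smooth_on S (\<lambda>x. F x $ i)"
  unfolding smooth_on_def using Ck_on_nth by metis

lemma smooth_on_vecI:
  fixes F :: "real^4 \<Rightarrow> 'b::euclidean_space^'n"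
  shows "open S \<Longrightarrow> (\<And>i. smooth_on S (\<lambda>x. F x $ i)) \<Longrightarrow> smooth_on S F"
  unfolding smooth_on_def using Ck_on_vecI[of S] by metis

lemma smooth_on_mult:
  fixes F H :: "real^4 \<Rightarrow> real"
  shows "open S \<Longrightarrow> smooth_on S F \<Longrightarrow> smooth_on S H \<Longrightarrow> smooth_on S (\<lambda>x. F x * H x)"
  unfolding smooth_on_def using Ck_on_mult[of S] by metis

lemma smooth_on_diff:
  "open S \<Longrightarrow> smooth_on S F \<Longrightarrow> smooth_on S H \<Longrightarrow> smooth_on S (\<lambda>x. F x - H x)"
  unfolding smooth_on_def using Ck_on_diff[of S] by metis

lemma smooth_on_divide:
  fixes F H :: "real^4 \<Rightarrow> real"
  assumes "open S" "smooth_on S F" "smooth_on S H" "\<And>x. x \<in> S \<Longrightarrow> H x \<noteq> 0"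
  shows "smooth_on S (\<lambda>x. F x / H x)"
proof -
  have "smooth_on S (\<lambda>x. F x * inverse (H x))"
    using assms Ck_on_inverse[of S _ H] by (intro smooth_on_mult) (auto simp: smooth_on_def)
  then show ?thesis by (simp add: divide_inverse)
qed

lemma smooth_on_const: "smooth_on S (\<lambda>x. c)"
  by (simp add: smooth_on_def)

lemma smooth_on_linear: "bounded_linear L \<Longrightarrow> smooth_on S L"
  by (simp add: smooth_on_def Ck_on_linear)

lemma dpart_linear_comp:
  assumes "bounded_linear L" "F differentiable at x"
  shows "dpart i (\<lambda>x. L (F x)) x = L (dpart i F x)"
  using dpart_eqI[OF bounded_linear.has_derivative[OF assms(1) has_derivative_dpart[OF assms(2)]], of i]
  by simp

lemmas dpart_nth = dpart_linear_comp[OF bounded_linear_vec_nth]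

text \<open>The derivative of g is the inverse of the Jacobian matrix of F, evaluated at g. If g is
  C^k, so are the entries of this matrix, and g is C^(k+1).\<close>

lemma smooth_inverse_function:
  fixes F :: "real^4 \<Rightarrow> real^4"
  assumes "open S" "smooth_on S F" "x0 \<in> S"
    and inj: "\<And>v::real^4. (\<Sum>i\<in>UNIV. (v $ i) *\<^sub>R dpart i F x0) = 0 \<Longrightarrow> v = 0"
  obtains U V g where "open U" "U \<subseteq> S" "x0 \<in> U" "open V" "homeomorphism U V F g" "smooth_on V g"
proof -
  let ?D = "\<lambda>x v::real^4. \<Sum>i\<in>UNIV. (v $ i) *\<^sub>R dpart i F x"
  have bl: "bounded_linear (?D x)" for x
    by (intro bounded_linear_sum bounded_linear_compose[OF bounded_linear_scaleR_left bounded_linear_vec_nth])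
  define f' where "f' x = Blinfun (?D x)" for x
  have f': "blinfun_apply (f' x) = ?D x" for x
    unfolding f'_def by (rule bounded_linear_Blinfun_apply[OF bl])
  have der: "(F has_derivative blinfun_apply (f' x)) (at x)" if "x \<in> S" for x
    unfolding f' by (rule has_derivative_dpart[OF smooth_on_differentiable[OF assms(2,1) that]])
  have cont: "continuous_on S f'"
  proof (rule continuous_on_blinfun_componentwise)
    show "continuous_on S (\<lambda>x. blinfun_apply (f' x) v)" for v
      unfolding f' using smooth_on_continuous[OF smooth_on_dpart[OF assms(2)]]
      by (intro continuous_intros)
  qed
  have "linear (?D x0)" using bl by (rule bounded_linear.linear)
  moreover have "inj (?D x0)"
    using inj by (subst linear_injective_0[OF \<open>linear (?D x0)\<close>]) blast
  ultimately obtain h where h: "linear h" "h \<circ> ?D x0 = id"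
    using linear_injective_left_inverse by blast
  have "Blinfun h o\<^sub>L f' x0 = id_blinfun"
    using h by (intro blinfun_eqI)
      (simp add: bounded_linear_Blinfun_apply linear_linear f' fun_eq_iff)
  from inverse_function_theorem[OF assms(1) der cont assms(3) this]
  obtain U V g g' where U: "open U" "U \<subseteq> S" "x0 \<in> U" and V: "open V" and hom: "homeomorphism U V F g"
    and g: "\<And>y. y \<in> V \<Longrightarrow> (g has_derivative (g' y)) (at y)"
      "\<And>y. y \<in> V \<Longrightarrow> g' y = inv (blinfun_apply (f' (g y)))"
      "\<And>y. y \<in> V \<Longrightarrow> bij (blinfun_apply (f' (g y)))" by metis
  have gU: "g y \<in> U" if "y \<in> V" for y using hom that by (auto simp: homeomorphism_def)
  define M where "M x = (\<chi> a i. dpart i F x $ a)" for x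
  have M: "?D x = (*v) (M x)" for x
    by (auto simp: fun_eq_iff vec_eq_iff matrix_vector_mult_def M_def mult.commute)
  have dg: "dpart i g y $ a = matrix_inv (M (g y)) $ a $ i" and inv: "invertible (M (g y))"
    if y: "y \<in> V" for i a y
  proof -
    have b: "bij ((*v) (M (g y)))" using g(3)[OF y] unfolding f' M .
    then have "inj ((*v) (M (g y)))" by (rule bij_is_inj)
    then show inv: "invertible (M (g y))" by (metis invertible_left_inverse matrix_left_invertible_injective)
    have "M (g y) *v (matrix_inv (M (g y)) *v axis i 1) = axis i 1"
      using matrix_inv_inverse(1)[OF inv] by (simp add: matrix_vector_mul_assoc)
    then have "matrix_inv (M (g y)) *v axis i 1 = dpart i g y"
      unfolding dpart_eqI[OF g(1)[OF y]] g(2)[OF y] f' M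
      using b by (metis bij_inv_eq_iff)
    then show "dpart i g y $ a = matrix_inv (M (g y)) $ a $ i"
      by (metis (no_types, lifting) matrix_vector_mult_basis column_def vec_lambda_beta)
  qed
  have "Ck_on k V g" for k
  proof (induction k)
    case 0
    show ?case using hom by (simp add: homeomorphism_def)
  next
    case (Suc k)
    have "Ck_on k S (\<lambda>x. M x $ a $ b)" for a b
      using smooth_on_nth[OF assms(1) smooth_on_dpart[OF assms(2)]] by (simp add: smooth_on_def M_def)
    then have "Ck_on k V (\<lambda>y. M (g y) $ a $ b)" for a b
      using Ck_on_compose[OF V assms(1) _ Suc, of "\<lambda>x. M x $ a $ b"] gU U(2) by auto
    then have "Ck_on k V (\<lambda>y. matrix_inv (M (g y)) $ a $ i)" for a i
      by (rule Ck_on_matrix_inv[OF V _ inv])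
    then have "Ck_on k V (\<lambda>y. dpart i g y $ a)" for a i
      by (rule Ck_on_cong[OF V, rotated]) (simp add: dg)
    then have "Ck_on k V (dpart i g)" for i by (rule Ck_on_vecI[OF V])
    moreover have "g differentiable_on V"
      using g(1) by (auto simp: differentiable_on_eq_differentiable_at[OF V] differentiable_def)
    ultimately show ?case by (simp add: Ck_on_Suc)
  qed
  then show thesis using that[OF U V hom] by (simp add: smooth_on_def)
qed

section \<open>Charts and coordinate changes\<close>

lemma chart_inv [simp]: "is_chart c \<Longrightarrow> p \<in> fst c \<Longrightarrow> inv_into (fst c) (snd c) (snd c p) = p"
  by (simp add: is_chart_def homeomorphism_def)

lemma in_chart_snd [simp]: "is_chart c \<Longrightarrow> p \<in> fst c \<Longrightarrow> in_chart c F (snd c p) = F p"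
  by (simp add: in_chart_def)

lemma open_chart_image:
  assumes "is_chart c" "open W"
  shows "open (snd c ` (fst c \<inter> W))"
proof -
  let ?S = "snd c ` fst c" and ?i = "inv_into (fst c) (snd c)"
  have "snd c ` (fst c \<inter> W) = ?S \<inter> ?i -` W" using assms(1) by force
  moreover have "continuous_on ?S ?i" "open ?S" using assms(1) unfolding is_chart_def homeomorphism_def by blast+
  ultimately show ?thesis using assms(2) by (simp add: continuous_open_preimage)
qed

lemma pd_eq_dpart: "pd c i F p = dpart i (in_chart c F) (snd c p)"
  by (simp add: pd_def dpart_def)

lemma in_chart_pd:
  "is_chart c \<Longrightarrow> y \<in> snd c ` fst c \<Longrightarrow> in_chart c (pd c i F) y = dpart i (in_chart c F) y"
  by (auto simp: pd_eq_dpart)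

lemma pd_pd:
  assumes "is_chart c" "p \<in> fst c"
  shows "pd c k (pd c i F) p = dpart k (dpart i (in_chart c F)) (snd c p)"
proof -
  have S: "open (snd c ` fst c)" using open_chart_image[OF assms(1) open_UNIV] by simp
  show ?thesis
    unfolding pd_eq_dpart[of c k]
    by (rule dpart_cong_open[OF S imageI[OF assms(2)] in_chart_pd[OF assms(1)]])
qed

locale smooth_mfd =
  fixes \<A> :: "'a::{t2_space, second_countable_topology} chart set"
  assumes smooth_structure: "smooth_structure \<A>"
begin

lemma is_chart: "c \<in> \<A> \<Longrightarrow> is_chart c"
  using smooth_structure by (simp add: smooth_structure_def)

lemma open_chart: "c \<in> \<A> \<Longrightarrow> open (fst c)"
  using is_chart is_chart_def by blast

lemma chart_at: obtains c where "c \<in> \<A>" "p \<in> fst c"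
proof -
  have "p \<in> (\<Union>c\<in>\<A>. fst c)" using smooth_structure unfolding smooth_structure_def by simp
  then show thesis using that by blast
qed

lemma transition_smooth:
  "c \<in> \<A> \<Longrightarrow> d \<in> \<A> \<Longrightarrow> smooth_on (snd c ` (fst c \<inter> fst d)) (in_chart c (snd d))"
  using smooth_structure by (simp add: smooth_structure_def compatible_def)

lemma in_chart_transition:
  assumes "c \<in> \<A>" "d \<in> \<A>" "y \<in> snd c ` (fst c \<inter> fst d)"
  shows "in_chart c F y = in_chart d F (in_chart c (snd d) y)"
proof -
  obtain q where q: "y = snd c q" "q \<in> fst c" "q \<in> fst d" using assms(3) by blast
  show ?thesis
    unfolding q(1) using q(2,3) is_chart[OF assms(1)] is_chart[OF assms(2)] by simp
qed

lemma pd_chain: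
  assumes c: "c \<in> \<A>" "d \<in> \<A>" "p \<in> fst c \<inter> fst d" and F: "in_chart d F differentiable at (snd d p)"
  shows "in_chart c F differentiable at (snd c p)"
    and "pd c i F p = (\<Sum>a\<in>UNIV. pd c i (\<lambda>q. snd d q $ a) p *\<^sub>R pd d a F p)"
proof -
  let ?S = "snd c ` (fst c \<inter> fst d)" and ?T = "in_chart c (snd d)"
  have S: "open ?S" "snd c p \<in> ?S" using open_chart_image[OF is_chart open_chart] c by auto
  have T: "?T differentiable at (snd c p)"
    by (rule smooth_on_differentiable[OF transition_smooth[OF c(1,2)] S])
  have Tp: "?T (snd c p) = snd d p" using c is_chart by auto
  note eq = in_chart_transition[OF c(1,2), of _ F]
  have "(\<lambda>y. in_chart d F (?T y)) differentiable at (snd c p)"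
    using dpart_compose(1)[OF T] F Tp by simp
  then show "in_chart c F differentiable at (snd c p)"
    unfolding differentiable_def using has_derivative_cong_open[OF S eq] by simp
  have "pd c i F p = dpart i (\<lambda>y. in_chart d F (?T y)) (snd c p)"
    unfolding pd_eq_dpart by (rule dpart_cong_open[OF S eq])
  also have "\<dots> = (\<Sum>a\<in>UNIV. (dpart i ?T (snd c p) $ a) *\<^sub>R dpart a (in_chart d F) (snd d p))"
    using dpart_compose(2)[OF T] F Tp by simp
  also have "\<dots> = (\<Sum>a\<in>UNIV. pd c i (\<lambda>q. snd d q $ a) p *\<^sub>R pd d a F p)"
    using dpart_nth[OF T] by (simp add: pd_eq_dpart in_chart_def)
  finally show "pd c i F p = (\<Sum>a\<in>UNIV. pd c i (\<lambda>q. snd d q $ a) p *\<^sub>R pd d a F p)" .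
qed

lemma coordinate_smooth: "d \<in> \<A> \<Longrightarrow> smooth_fun_on \<A> (fst d) (\<lambda>p. snd d p $ a)"
  unfolding smooth_fun_on_def
proof
  fix c assume "d \<in> \<A>" "c \<in> \<A>"
  then show "smooth_on (snd c ` (fst c \<inter> fst d)) (in_chart c (\<lambda>p. snd d p $ a))"
    using smooth_on_nth[OF open_chart_image[OF is_chart open_chart] transition_smooth, of c d a]
    by (simp add: in_chart_def)
qed

text \<open>By maximality of the atlas, compatibility with every member suffices, and the new
  transition maps are old ones composed with \<Phi> or \<Psi>.\<close>

lemma chart_compose:
  assumes c: "c \<in> \<A>" and O: "open O'" "O' \<subseteq> snd c ` fst c" and O'': "open O''"
    and hom: "homeomorphism O' O'' \<Phi> \<Psi>" and sm: "smooth_on O' \<Phi>" "smooth_on O'' \<Psi>"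
  shows "({p \<in> fst c. snd c p \<in> O'}, \<lambda>p. \<Phi> (snd c p)) \<in> \<A>" (is "?d \<in> \<A>")
proof -
  let ?D = "{p \<in> fst c. snd c p \<in> O'}" and ?i = "inv_into (fst c) (snd c)"
  let ?x = "\<lambda>p. \<Phi> (snd c p)"
  have ic: "is_chart c" by (rule is_chart[OF c])
  have hc: "homeomorphism (fst c) (snd c ` fst c) (snd c) ?i" using ic by (simp add: is_chart_def)
  have im: "snd c ` ?D = O'" using O(2) by auto
  have 1: "homeomorphism ?D O' (snd c) ?i"
    by (rule homeomorphism_of_subsets[OF hc]) (use im O(2) in auto)
  have 2: "homeomorphism ?D O'' (\<Phi> \<circ> snd c) (?i \<circ> \<Psi>)"
    by (rule homeomorphism_compose[OF 1 hom])
  have x: "?i (\<Psi> (?x p)) = p" if "p \<in> ?D" for p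
    using 2 that unfolding homeomorphism_def o_def by blast
  have im2: "?x ` ?D = O''" using 2 unfolding homeomorphism_def o_def by blast
  have z: "?i (\<Psi> z) \<in> ?D" "?x (?i (\<Psi> z)) = z" if "z \<in> O''" for z
    using 2 that unfolding homeomorphism_def o_def by blast+
  have inj: "inj_on ?x ?D" by (rule inj_on_inverseI[of ?D "\<lambda>z. ?i (\<Psi> z)"]) (rule x)
  have inv: "inv_into ?D ?x z = ?i (\<Psi> z)" if "z \<in> O''" for z
    by (rule inv_into_f_eq[OF inj z[OF that]])
  have oD: "open ?D"
  proof -
    have "?D = fst c \<inter> snd c -` O'" by auto
    then show ?thesis
      using continuous_open_preimage[of "fst c" "snd c" O'] hc O(1) open_chart[OF c]
      by (simp add: homeomorphism_def)
  qed
  have id: "is_chart ?d"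
    unfolding is_chart_def fst_conv snd_conv im2
    using oD O'' homeomorphism_cong[OF 2, of ?D O'' ?x "inv_into ?D ?x"] inv by simp
  have "compatible ?d e" if e: "e \<in> \<A>" for e
    unfolding compatible_def fst_conv snd_conv
  proof
    let ?S = "?x ` (?D \<inter> fst e)" and ?T = "snd c ` (fst c \<inter> fst e)"
    have S: "open ?S" using open_chart_image[OF id open_chart[OF e]] by simp
    have T: "open ?T" by (rule open_chart_image[OF ic open_chart[OF e]])
    have SO: "?S \<subseteq> O''" using im2 by auto
    have \<Psi>x: "\<Psi> (\<Phi> y) = y" if "y \<in> O'" for y using hom that by (simp add: homeomorphism_def)
    have "smooth_on ?S (\<lambda>z. in_chart c (snd e) (\<Psi> z))"
      by (rule smooth_on_compose[OF S T transition_smooth[OF c e] smooth_on_subset[OF sm(2) SO]])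
         (auto simp: \<Psi>x)
    moreover have "in_chart c (snd e) (\<Psi> z) = in_chart ?d (snd e) z" if "z \<in> ?S" for z
      using inv[of z] that SO by (simp add: in_chart_def subset_iff)
    ultimately show "smooth_on ?S (in_chart ?d (snd e))"
      using smooth_on_cong[OF S, of "\<lambda>z. in_chart c (snd e) (\<Psi> z)" "in_chart ?d (snd e)"] by blast
    let ?R = "snd e ` (?D \<inter> fst e)"
    have R: "open ?R" using open_chart_image[OF is_chart[OF e] oD] by (simp add: Int_commute)
    have "smooth_on ?R (\<lambda>w. \<Phi> (in_chart e (snd c) w))"
      by (rule smooth_on_compose[OF R O(1) sm(1) smooth_on_subset[OF transition_smooth[OF e c]]])
         (use is_chart[OF e] in auto)
    then show "smooth_on ?R (in_chart e ?x)" by (simp add: in_chart_def)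
  qed
  moreover have "\<forall>c. is_chart c \<and> (\<forall>d\<in>\<A>. compatible c d) \<longrightarrow> c \<in> \<A>"
    using smooth_structure unfolding smooth_structure_def by blast
  ultimately show ?thesis using id by blast
qed

end

section \<open>Charts adapted to a pair of functions\<close>

lemma independent_pair_extend:
  fixes r1 r2 :: "real^4"
  assumes "\<And>a b. a *\<^sub>R r1 + b *\<^sub>R r2 = 0 \<Longrightarrow> a = 0 \<and> b = 0"
  obtains r3 r4 where "span {r1, r2, r3, r4} = UNIV"
proof -
  have ne: "r1 \<noteq> r2" using assms[of 1 "-1"] by auto
  have r2: "r2 \<noteq> 0" using assms[of 0 1] by auto
  have "r1 \<notin> span {r2}"
  proof
    assume "r1 \<in> span {r2}"
    then obtain k where "r1 = k *\<^sub>R r2" by (auto simp: span_singleton)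
    then show False using assms[of 1 "-k"] by simp
  qed
  then have "independent {r1, r2}" using ne r2 by (simp add: independent_insert)
  then obtain B where B: "{r1, r2} \<subseteq> B" "independent B" "span B = UNIV"
    by (metis maximal_independent_subset_extend subset_UNIV top.extremum_uniqueI)
  have "card B = 4" using basis_card_eq_dim[of B UNIV] B by simp
  then have "finite B" using card_ge_0_finite[of B] by simp
  then have "card (B - {r1, r2}) = 2" using \<open>card B = 4\<close> B(1) ne by (simp add: card_Diff_subset)
  then obtain r3 r4 where "B - {r1, r2} = {r3, r4}" by (auto simp: card_2_iff)
  then have "B = {r1, r2, r3, r4}" using B(1) by auto
  then show thesis using that B(3) by simp
qed

context smooth_mfd
begin

text \<open>Two constant covectors complete df and dg at p to a basis. The functions f, g and the
  two linear functions belonging to these covectors then have an invertible Jacobian at p.\<close>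

lemma adapted_chart:
  assumes "open W" "conormal_pair \<A> W f g" "p \<in> W"
  obtains d where "d \<in> \<A>" "p \<in> fst d" "fst d \<subseteq> W"
    "\<And>q. q \<in> fst d \<Longrightarrow> snd d q $ 1 = f q" "\<And>q. q \<in> fst d \<Longrightarrow> snd d q $ 2 = g q"
proof -
  obtain c where c: "c \<in> \<A>" "p \<in> fst c" by (rule chart_at)
  let ?S = "snd c ` (fst c \<inter> W)"
  have S: "open ?S" "snd c p \<in> ?S" using open_chart_image[OF is_chart[OF c(1)] assms(1)] c(2) assms(3) by auto
  have fg: "smooth_on ?S (in_chart c f)" "smooth_on ?S (in_chart c g)"
    using assms(2) c(1) by (auto simp: conormal_pair_def smooth_fun_on_def)
  define r1 where "r1 = (\<chi> i. pd c i f p)"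
  define r2 where "r2 = (\<chi> i. pd c i g p)"
  have "a = 0 \<and> b = 0" if "a *\<^sub>R r1 + b *\<^sub>R r2 = 0" for a b
  proof -
    have "\<forall>i. a * pd c i f p + b * pd c i g p = 0"
      using that by (simp add: r1_def r2_def vec_eq_iff)
    then show ?thesis using assms(2,3) c unfolding conormal_pair_def by blast
  qed
  then obtain r3 r4 where r: "span {r1, r2, r3, r4} = UNIV" by (rule independent_pair_extend)
  define \<Phi> :: "real^4 \<Rightarrow> real^4" where "\<Phi> y = (\<chi> a. if a = 1 then in_chart c f y else
    if a = 2 then in_chart c g y else if a = 3 then r3 \<bullet> y else r4 \<bullet> y)" for y
  have \<Phi>: "(\<lambda>y. \<Phi> y $ 1) = in_chart c f" "(\<lambda>y. \<Phi> y $ 2) = in_chart c g"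
      "(\<lambda>y. \<Phi> y $ 3) = (\<lambda>y. r3 \<bullet> y)" "(\<lambda>y. \<Phi> y $ 4) = (\<lambda>y. r4 \<bullet> y)"
    by (simp_all add: \<Phi>_def)
  have sm: "smooth_on ?S \<Phi>"
  proof (rule smooth_on_vecI[OF S(1)])
    fix a :: 4
    show "smooth_on ?S (\<lambda>y. \<Phi> y $ a)"
      using exhaust_4[of a] \<Phi> fg smooth_on_linear[OF bounded_linear_inner_right] by metis
  qed
  have d: "\<Phi> differentiable at (snd c p)" by (rule smooth_on_differentiable[OF sm S])
  have lin: "dpart i (\<lambda>y. r \<bullet> y) x = r $ i" for r x :: "real^4" and i
    using dpart_eqI[OF bounded_linear_imp_has_derivative[OF bounded_linear_inner_right[of r]], of i x]
    by (simp add: inner_axis)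
  have D: "dpart i \<Phi> (snd c p) $ 1 = r1 $ i" "dpart i \<Phi> (snd c p) $ 2 = r2 $ i"
     "dpart i \<Phi> (snd c p) $ 3 = r3 $ i" "dpart i \<Phi> (snd c p) $ 4 = r4 $ i" for i
    unfolding dpart_nth[OF d, symmetric] \<Phi> by (simp_all add: r1_def r2_def pd_eq_dpart lin)
  have "v = 0" if v: "(\<Sum>i\<in>UNIV. (v $ i) *\<^sub>R dpart i \<Phi> (snd c p)) = 0" for v :: "real^4"
  proof -
    have "(\<Sum>i\<in>UNIV. v $ i * dpart i \<Phi> (snd c p) $ a) = 0" for a
      using arg_cong[OF v, of "\<lambda>w. w $ a"] by simp
    from this[of 1] this[of 2] this[of 3] this[of 4]
    have "r1 \<bullet> v = 0" "r2 \<bullet> v = 0" "r3 \<bullet> v = 0" "r4 \<bullet> v = 0"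
      by (simp_all add: D inner_vec_def mult.commute)
    then have "orthogonal v y" if "y \<in> span {r1, r2, r3, r4}" for y
      by (intro orthogonal_to_span[OF that]) (auto simp: orthogonal_def inner_commute)
    then show ?thesis using r orthogonal_self by blast
  qed
  from smooth_inverse_function[OF S(1) sm S(2) this]
  obtain U V g' where U: "open U" "U \<subseteq> ?S" "snd c p \<in> U" "open V" "homeomorphism U V \<Phi> g'" "smooth_on V g'"
    by metis
  let ?d = "({q \<in> fst c. snd c q \<in> U}, \<lambda>q. \<Phi> (snd c q))"
  have "?d \<in> \<A>"
    using U by (intro chart_compose[OF c(1) U(1) _ U(4,5) smooth_on_subset[OF sm U(2)] U(6)]) auto
  \<comment> \<open>Coordinates are injective on the chart domain, so a point of it whose
    coordinates lie in the image of W lies in W.\<close>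
  moreover have "q \<in> W" if "q \<in> fst c" "snd c q \<in> U" for q
  proof -
    obtain q' where "q' \<in> fst c" "q' \<in> W" "snd c q = snd c q'"
      using subsetD[OF U(2) \<open>snd c q \<in> U\<close>] by blast
    then show ?thesis using chart_inv[OF is_chart[OF c(1)]] that(1) by metis
  qed
  ultimately show thesis
    using U(3) c(2) is_chart[OF c(1)] by (intro that[of ?d]) (auto simp: \<Phi>_def)
qed

end

section \<open>The equation as a covector\<close>

text \<open>Moves the point under consideration to 0, the centre of the balls on which the radial
  operators act.\<close>

lemma Ck_on_translate:
  assumes "open S" "Ck_on k S F" "ball x \<delta> \<subseteq> S"
  shows "Ck_on k (ball 0 \<delta>) (\<lambda>z. F (x + z))"
proof (rule Ck_on_compose[OF open_ball assms(1,2)])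
  show "Ck_on k (ball 0 \<delta>) (\<lambda>z. x + z)"
    by (intro Ck_on_add open_ball Ck_on_const Ck_on_linear bounded_linear_ident)
qed (use assms(3) in \<open>auto simp: subset_iff dist_norm\<close>)

lemma dpart_translate:
  assumes "F differentiable at (x + z)"
  shows "dpart i (\<lambda>z. F (x + z)) z = dpart i F (x + z)"
proof -
  have D: "((\<lambda>z. x + z) has_derivative (\<lambda>v. v)) (at z)" by (auto intro!: derivative_eq_intros)
  from dpart_compose(2)[of "\<lambda>z. x + z" z F i] assms D show ?thesis
    by (auto simp: differentiable_def dpart_eqI[OF D])
qed

text \<open>Both mixed derivatives arise from the radial identity with \<open>I = {i}\<close>: differentiate it along
  \<open>j\<close>, and compare with the identity for the \<open>j\<close>-th derivative.\<close>

lemma dpart_commute: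
  fixes F :: "real^4 \<Rightarrow> 'b::banach"
  assumes "open S" "smooth_on S F" "x \<in> S"
  shows "dpart i (dpart j F) x = dpart j (dpart i F) x"
proof (cases "i = j")
  case False
  obtain \<delta> where \<delta>: "\<delta> > 0" "ball x \<delta> \<subseteq> S" using assms(1,3) open_contains_ball by blast
  let ?S = "ball 0 \<delta> :: (real^4) set" and ?I = "{i}"
  define h where "h z = F (x + z)" for z
  have xz: "x + z \<in> S" if "z \<in> ?S" for z using that \<delta>(2) by (auto simp: subset_iff dist_norm)
  have hC: "Ck_on k ?S h" for k
    unfolding h_def[abs_def] using assms(1,2) \<delta>(2) by (intro Ck_on_translate) (auto simp: smooth_on_def)
  have dhC: "Ck_on k ?S (dpart a h)" for k a using hC[of "Suc k"] by (simp add: Ck_on_Suc)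
  have ddhC: "Ck_on k ?S (dpart b (dpart a h))" for k a b using dhC[of "Suc k"] by (simp add: Ck_on_Suc)
  define w where "w y = dpart j (dpart i h) y - dpart i (dpart j h) y" for y
  have wc: "continuous_on ?S w"
    unfolding w_def[abs_def] by (intro continuous_on_diff Ck_on_continuous[OF ddhC])
  \<comment> \<open>For I = {i} the operator is y_i times one integral, and y_i has to be cancelled;
    the point 0 itself is reached by continuity below.\<close>
  have 0: "rint ?I (Suc 0) w y = 0" if y: "y \<in> ?S" "y $ i \<noteq> 0" for y
  proof -
    have "dpart j h y = dpart j (\<lambda>y. rint ?I 0 h y + rop ?I (Suc 0) (\<lambda>j. dpart j h) y) y"
      by (rule dpart_cong_open[OF open_ball y(1)]) (rule radial_identity[OF hC])
    also have "\<dots> = dpart j (rint ?I 0 h) y + dpart j (rop ?I (Suc 0) (\<lambda>j. dpart j h)) y"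
      by (intro dpart_add rint_dpart(1)[OF hC y(1)] rop_dpart(1)[OF dhC y(1)])
    also have "\<dots> = rint ?I 0 (dpart j h) y + rop ?I (Suc 0) (\<lambda>k. dpart j (dpart k h)) y"
      using False by (simp add: rint_dpart(2)[OF hC y(1)] rop_dpart(2)[OF dhC y(1)])
    finally have "rop ?I (Suc 0) (\<lambda>k. dpart j (dpart k h)) y = rop ?I (Suc 0) (\<lambda>k. dpart k (dpart j h)) y"
      using radial_identity[OF dhC[of "Suc 0" j] y(1), of ?I] by simp
    then have "rint ?I (Suc 0) (dpart j (dpart i h)) y = rint ?I (Suc 0) (dpart i (dpart j h)) y"
      using y(2) by (simp add: rop_def)
    then show ?thesis
      unfolding w_def[abs_def]
      using rint_diff[OF Ck_on_continuous[OF ddhC] Ck_on_continuous[OF ddhC] y(1)] by simp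
  qed
  have z0: "0 \<in> ?S" using \<delta> by simp
  have rc: "continuous_on ?S (rint ?I (Suc 0) w)" by (rule continuous_on_rint[OF wc])
  have "rint ?I (Suc 0) w 0 = 0"
  proof -
    \<comment> \<open>Points of the i-th axis that tend to 0 and have nonzero i-th
      coordinate.\<close>
    define u where "u n = (\<delta> / 2 * inverse (real (Suc n))) *\<^sub>R axis i (1::real)" for n
    have "(\<lambda>n. \<delta> / 2 * inverse (real (Suc n))) \<longlonglongrightarrow> \<delta> / 2 * 0"
      by (intro tendsto_mult tendsto_const LIMSEQ_inverse_real_of_nat)
    from tendsto_scaleR[OF this tendsto_const[of "axis i (1::real)"]]
    have "u \<longlonglongrightarrow> 0" unfolding u_def[abs_def] by simp
    moreover have nu: "norm (u n) < \<delta>" for n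
    proof -
      have "\<delta> / 2 * inverse (real (Suc n)) \<le> \<delta> / 2 * 1"
        using \<delta>(1) by (intro mult_left_mono) (auto simp: field_simps)
      then show ?thesis using \<delta>(1) by (simp add: u_def abs_mult)
    qed
    ultimately have "(\<lambda>n. rint ?I (Suc 0) w (u n)) \<longlonglongrightarrow> rint ?I (Suc 0) w 0"
      by (intro continuous_on_tendsto_compose[OF rc _ z0]) auto
    moreover have "rint ?I (Suc 0) w (u n) = 0" for n
      using nu[of n] \<delta>(1) by (intro 0) (auto simp: u_def)
    ultimately show ?thesis by (simp add: LIMSEQ_const_iff)
  qed
  \<comment> \<open>At the centre the ray is constant, and the weight t integrates to 1/2.\<close>
  moreover have "rint ?I (Suc 0) w 0 = (1 / 2) *\<^sub>R w 0"
  proof -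
    have "rad ?I t 0 = 0" for t by (simp add: rad_def vec_eq_iff)
    moreover have "((\<lambda>t::real. t *\<^sub>R w 0) has_integral (1 ^ 2 / 2 - 0 ^ 2 / 2) *\<^sub>R w 0) {0..1}"
      using ident_has_integral[of 0 "1::real"] by (intro has_integral_scaleR_left) simp
    ultimately show ?thesis by (simp add: rint_def integral_unique)
  qed
  ultimately have "w 0 = 0" by simp
  moreover have "dpart a (dpart b h) 0 = dpart a (dpart b F) x" for a b
  proof -
    have Fd: "F differentiable at (x + z)" "dpart b F differentiable at (x + z)" if "z \<in> ?S" for z
      using xz[OF that] assms smooth_on_differentiable smooth_on_dpart by metis+
    have "dpart a (dpart b h) 0 = dpart a (\<lambda>z. dpart b F (x + z)) 0"
      unfolding h_def[abs_def] by (intro dpart_cong_open[OF open_ball z0] dpart_translate Fd)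
    then show ?thesis using dpart_translate[OF Fd(2)[OF z0], of a] by simp
  qed
  ultimately show ?thesis by (simp add: w_def)
qed simp

section \<open>Level sets and derivatives in a chart\<close>

text \<open>The bridge from coincidence of surfaces, a statement about point sets, to vanishing
  partial derivatives.\<close>

lemma dpart_eq_0_of_line_constant:
  fixes F :: "real^4 \<Rightarrow> 'b::real_normed_vector"
  assumes "open S" "y \<in> S" "F differentiable at y"
    and const: "\<And>z. z \<in> S \<Longrightarrow> (\<And>k. k \<noteq> i \<Longrightarrow> z $ k = y $ k) \<Longrightarrow> F z = F y"
  shows "dpart i F y = 0"
proof -
  have "((\<lambda>t. y + t *\<^sub>R axis i 1) has_derivative (\<lambda>t. t *\<^sub>R axis i 1)) (at 0)"
    by (rule has_derivative_eq_rhs[OF has_derivative_add[OF has_derivative_const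
            has_derivative_scaleR_left[OF has_derivative_ident]]]) simp
  moreover have "(F has_derivative (\<lambda>v. \<Sum>k\<in>UNIV. (v $ k) *\<^sub>R dpart k F y)) (at (y + 0 *\<^sub>R axis i 1))"
    using has_derivative_dpart[OF assms(3)] by simp
  ultimately have "((\<lambda>t. F (y + t *\<^sub>R axis i 1)) has_derivative
      (\<lambda>t. \<Sum>k\<in>UNIV. ((t *\<^sub>R axis i 1) $ k) *\<^sub>R dpart k F y)) (at 0)"
    by (rule has_derivative_compose)
  moreover have "(\<Sum>k\<in>UNIV. ((t *\<^sub>R axis i 1) $ k) *\<^sub>R dpart k F y) = t *\<^sub>R dpart i F y" for t
    using sum_axis_scaleR[of i "\<lambda>k. t *\<^sub>R dpart k F y"] by (simp add: mult.commute)
  ultimately have 1: "((\<lambda>t. F (y + t *\<^sub>R axis i 1)) has_derivative (\<lambda>t. t *\<^sub>R dpart i F y)) (at 0)" by simp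
  let ?T = "(\<lambda>t. y + t *\<^sub>R axis i 1) -` S"
  have "open ?T" using assms(1) by (intro open_vimage continuous_intros)
  moreover have "0 \<in> ?T" using assms(2) by simp
  moreover have "F y = F (y + t *\<^sub>R axis i 1)" if "t \<in> ?T" for t
    using that by (intro const[symmetric]) (auto simp: axis_def)
  ultimately have "((\<lambda>t. F (y + t *\<^sub>R axis i 1)) has_derivative (\<lambda>t. 0)) (at 0)"
    by (intro has_derivative_transform_within_open[OF has_derivative_const]) auto
  from has_derivative_unique[OF 1 this] show ?thesis by (metis scaleR_one)
qed

lemma det2_nonzero:
  fixes p q r s :: real
  assumes "\<And>a b. a * p + b * r = 0 \<Longrightarrow> a * q + b * s = 0 \<Longrightarrow> a = 0 \<and> b = 0"
  shows "p * s - q * r \<noteq> 0"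
proof
  assume 0: "p * s - q * r = 0"
  \<comment> \<open>A vanishing determinant makes (s, -q) and (r, -p) coefficient pairs of linear
    dependencies.\<close>
  then have "s = 0" "q = 0" using assms[of s "- q"] by (auto simp: algebra_simps)
  moreover have "r = 0" "p = 0" using assms[of r "- p"] 0 by (auto simp: algebra_simps)
  ultimately show False using assms[of 1 0] by simp
qed

text \<open>Each family is the partition of U into nonempty fibres, and partitions agree exactly
  when their equivalence relations do.\<close>

lemma surfaces_eq_iff:
  "surfaces U f g = surfaces U f' g' \<longleftrightarrow>
    (\<forall>q\<in>U. \<forall>r\<in>U. (f q = f r \<and> g q = g r) \<longleftrightarrow> (f' q = f' r \<and> g' q = g' r))"
proof -
  define L where "L f g q = {r \<in> U. f r = f q \<and> g r = g q}" for f g :: "'a \<Rightarrow> real" and q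
  have S: "surfaces U f g = L f g ` U" for f g :: "'a \<Rightarrow> real"
    unfolding surfaces_def L_def by auto
  have in_L: "q \<in> U \<Longrightarrow> q \<in> L f g q" for f g q by (simp add: L_def)
  show ?thesis
  proof
    assume "surfaces U f g = surfaces U f' g'"
    then have "L f g q \<in> L f' g' ` U" if "q \<in> U" for q using that S by blast
    moreover have "L f' g' q' = L f' g' q" if "q \<in> L f' g' q'" for q q' using that by (auto simp: L_def)
    ultimately have "L f g q = L f' g' q" if "q \<in> U" for q
      using that in_L[OF that, of f g] by (metis imageE)
    then have *: "r \<in> L f g q \<longleftrightarrow> r \<in> L f' g' q" if "q \<in> U" for q r using that by simp
    show "\<forall>q\<in>U. \<forall>r\<in>U. (f q = f r \<and> g q = g r) \<longleftrightarrow> (f' q = f' r \<and> g' q = g' r)"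
    proof (intro ballI)
      fix q r assume "q \<in> U" "r \<in> U"
      with *[of r q] show "(f q = f r \<and> g q = g r) \<longleftrightarrow> (f' q = f' r \<and> g' q = g' r)"
        by (simp add: L_def)
    qed
  next
    assume "\<forall>q\<in>U. \<forall>r\<in>U. (f q = f r \<and> g q = g r) \<longleftrightarrow> (f' q = f' r \<and> g' q = g' r)"
    then have "L f g q = L f' g' q" if "q \<in> U" for q using that unfolding L_def by blast
    then show "surfaces U f g = surfaces U f' g'" unfolding S by simp
  qed
qed

lemma restrict_family_surfaces:
  assumes "V \<subseteq> U"
  shows "restrict_family V (surfaces U f g) = surfaces V f g"
proof -
  have *: "{p \<in> U. f p = a \<and> g p = b} \<inter> V = {p \<in> V. f p = a \<and> g p = b}" for a b
    using assms by blast
  show ?thesis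
  proof (intro equalityI subsetI)
    fix T assume "T \<in> restrict_family V (surfaces U f g)"
    then obtain a b where "T = {p \<in> U. f p = a \<and> g p = b} \<inter> V" "T \<noteq> {}"
      unfolding restrict_family_def surfaces_def by blast
    then show "T \<in> surfaces V f g" unfolding * surfaces_def by blast
  next
    fix T assume "T \<in> surfaces V f g"
    then obtain a b where T: "T = {p \<in> V. f p = a \<and> g p = b}" "T \<noteq> {}" unfolding surfaces_def by blast
    then have "{p \<in> U. f p = a \<and> g p = b} \<in> surfaces U f g"
      using assms unfolding surfaces_def by blast
    with T show "T \<in> restrict_family V (surfaces U f g)"
      unfolding restrict_family_def using *[of a b] by blast
  qed
qed

lemma pd_cong_open:
  assumes "is_chart c" "open W" "p \<in> fst c \<inter> W" "\<And>q. q \<in> fst c \<inter> W \<Longrightarrow> F q = H q"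
  shows "pd c i F p = pd c i H p"
  unfolding pd_eq_dpart using assms(3,4) assms(1)
  by (intro dpart_cong_open[OF open_chart_image[OF assms(1,2)]]) auto

lemma pd_const [simp]: "pd c i (\<lambda>_. k) p = 0"
  unfolding pd_eq_dpart in_chart_def using dpart_eqI[OF has_derivative_const] by metis

lemma pd_sum:
  assumes "\<And>a. a \<in> A \<Longrightarrow> in_chart c (F a) differentiable at (snd c p)"
  shows "in_chart c (\<lambda>q. \<Sum>a\<in>A. F a q) differentiable at (snd c p)"
    and "pd c i (\<lambda>q. \<Sum>a\<in>A. F a q) p = (\<Sum>a\<in>A. pd c i (F a) p)"
proof -
  have D: "((\<lambda>y. \<Sum>a\<in>A. in_chart c (F a) y) has_derivative
      (\<lambda>v. \<Sum>a\<in>A. \<Sum>i\<in>UNIV. (v $ i) *\<^sub>R dpart i (in_chart c (F a)) (snd c p))) (at (snd c p))"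
    using assms by (intro has_derivative_sum has_derivative_dpart)
  then show "in_chart c (\<lambda>q. \<Sum>a\<in>A. F a q) differentiable at (snd c p)"
    by (auto simp: in_chart_def differentiable_def)
  show "pd c i (\<lambda>q. \<Sum>a\<in>A. F a q) p = (\<Sum>a\<in>A. pd c i (F a) p)"
    using dpart_eqI[OF D, of i] unfolding pd_eq_dpart sum_axis_scaleR by (simp add: in_chart_def)
qed

lemma pd_mult:
  fixes F H :: "'a::topological_space \<Rightarrow> real"
  assumes "in_chart c F differentiable at (snd c p)" "in_chart c H differentiable at (snd c p)"
    and p: "is_chart c" "p \<in> fst c"
  shows "in_chart c (\<lambda>q. F q * H q) differentiable at (snd c p)"
    and "pd c i (\<lambda>q. F q * H q) p = pd c i F p * H p + F p * pd c i H p"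
proof -
  have D: "((\<lambda>y. in_chart c F y * in_chart c H y) has_derivative
      (\<lambda>v. in_chart c F (snd c p) * (\<Sum>i\<in>UNIV. (v $ i) *\<^sub>R dpart i (in_chart c H) (snd c p))
        + (\<Sum>i\<in>UNIV. (v $ i) *\<^sub>R dpart i (in_chart c F) (snd c p)) * in_chart c H (snd c p))) (at (snd c p))"
    by (intro has_derivative_mult has_derivative_dpart assms)
  then show "in_chart c (\<lambda>q. F q * H q) differentiable at (snd c p)"
    by (auto simp: in_chart_def differentiable_def)
  show "pd c i (\<lambda>q. F q * H q) p = pd c i F p * H p + F p * pd c i H p"
    using dpart_eqI[OF D, of i] p unfolding pd_eq_dpart sum_axis_scaleR by (simp add: in_chart_def)
qed

section \<open>Gradients and the bracket covector\<close>

definition dirderiv :: "'a chart \<Rightarrow> real^4 \<Rightarrow> ('a \<Rightarrow> real) \<Rightarrow> 'a \<Rightarrow> real" where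
  "dirderiv c v F p = (\<Sum>k\<in>UNIV. v $ k * pd c k F p)"

definition grad :: "'a tensor2 \<Rightarrow> 'a chart \<Rightarrow> ('a \<Rightarrow> real) \<Rightarrow> 'a \<Rightarrow> real^4" where
  "grad G c f p = matrix_inv (G c p) *v (\<chi> j. pd c j f p)"

text \<open>In terms of \<open>X = grad f\<close> and \<open>Z = grad g\<close>, this is the covector dual to the Lie bracket
  \<open>[X, Z]\<close>.\<close>

definition bracket_form ::
    "'a tensor2 \<Rightarrow> 'a chart \<Rightarrow> ('a \<Rightarrow> real) \<Rightarrow> ('a \<Rightarrow> real) \<Rightarrow> 4 \<Rightarrow> 'a \<Rightarrow> real" where
  "bracket_form G c f g i p = (\<Sum>j\<in>UNIV. pd c j f p * nabla2_up G c j i g p) -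
    (\<Sum>j\<in>UNIV. pd c j g p * nabla2_up G c j i f p)"

locale riemannian_mfd = smooth_mfd \<A> for \<A> :: "'a::{t2_space, second_countable_topology} chart set" +
  fixes G :: "'a tensor2"
  assumes metric: "riemannian_metric \<A> G"
begin

lemma G_sym: "c \<in> \<A> \<Longrightarrow> p \<in> fst c \<Longrightarrow> G c p $ i $ j = G c p $ j $ i"
proof -
  assume "c \<in> \<A>" "p \<in> fst c"
  then have "transpose (G c p) = G c p" using metric unfolding riemannian_metric_def by blast
  then have "transpose (G c p) $ j $ i = G c p $ j $ i" by simp
  then show ?thesis by (simp add: transpose_def)
qed

lemma G_pos: "c \<in> \<A> \<Longrightarrow> p \<in> fst c \<Longrightarrow> v \<noteq> 0 \<Longrightarrow> v \<bullet> (G c p *v v) > 0"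
  using metric unfolding riemannian_metric_def by blast

lemma G_transform:
  "c \<in> \<A> \<Longrightarrow> d \<in> \<A> \<Longrightarrow> p \<in> fst c \<inter> fst d \<Longrightarrow> G c p $ i $ j = (\<Sum>a\<in>UNIV. \<Sum>b\<in>UNIV.
    pd c i (\<lambda>q. snd d q $ a) p * pd c j (\<lambda>q. snd d q $ b) p * G d p $ a $ b)"
  using metric unfolding riemannian_metric_def by blast

lemma G_smooth: "c \<in> \<A> \<Longrightarrow> smooth_on (snd c ` fst c) (\<lambda>y. in_chart c (\<lambda>q. G c q $ i $ j) y)"
proof -
  assume c: "c \<in> \<A>"
  then have "smooth_on (snd c ` fst c) (in_chart c (G c))"
    using metric unfolding riemannian_metric_def by blast
  moreover have "open (snd c ` fst c)" using open_chart_image[OF is_chart[OF c] open_UNIV] by simp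
  ultimately have "smooth_on (snd c ` fst c) (\<lambda>y. in_chart c (G c) y $ i $ j)"
    by (intro smooth_on_nth)
  then show ?thesis by (simp add: in_chart_def)
qed

lemma G_invertible:
  assumes "c \<in> \<A>" "p \<in> fst c"
  shows "invertible (G c p)"
proof -
  have "v = 0" if "G c p *v v = 0" for v using G_pos[OF assms, of v] that by (cases "v = 0") simp_all
  then show ?thesis
    using matrix_left_invertible_ker[of "G c p"] invertible_left_inverse[of "G c p"] by blast
qed

lemma G_inv_sym:
  assumes "c \<in> \<A>" "p \<in> fst c"
  shows "matrix_inv (G c p) $ i $ j = matrix_inv (G c p) $ j $ i"
proof -
  let ?G = "G c p" let ?P = "matrix_inv ?G"
  note inv = matrix_inv_inverse[OF G_invertible[OF assms]]
  have "transpose ?G = ?G" using G_sym[OF assms] by (simp add: transpose_def vec_eq_iff)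
  then have "transpose ?P ** ?G = mat 1" using arg_cong[OF inv(1), of transpose]
    by (simp add: matrix_transpose_mul transpose_mat)
  then have "transpose ?P = ?P"
    using arg_cong[OF inv(1), of "\<lambda>M. transpose ?P ** M"]
    by (simp add: matrix_mul_assoc)
  then have "transpose ?P $ j $ i = ?P $ j $ i" by simp
  then show ?thesis by (simp add: transpose_def)
qed

lemma lower_grad:
  assumes "c \<in> \<A>" "p \<in> fst c"
  shows "(\<Sum>k\<in>UNIV. G c p $ i $ k * grad G c f p $ k) = pd c i f p"
proof -
  have "G c p *v grad G c f p = (\<chi> j. pd c j f p)"
    unfolding grad_def using matrix_inv_inverse(1)[OF G_invertible[OF assms]]
    by (simp add: matrix_vector_mul_assoc)
  from arg_cong[OF this, of "\<lambda>w. w $ i"] show ?thesis by (simp add: matrix_vector_mult_def)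
qed

text \<open>Both occurrences of the inverse metric, in the raised index and in the Christoffel
  symbols, are absorbed into gradients.\<close>

lemma nabla_term:
  assumes c: "c \<in> \<A>" "p \<in> fst c"
  shows "(\<Sum>j\<in>UNIV. pd c j f p * nabla2_up G c j i g p)
    = dirderiv c (grad G c f p) (pd c i g) p
      - (1/2) * (\<Sum>k\<in>UNIV. \<Sum>l\<in>UNIV. grad G c f p $ k * grad G c g p $ l *
          (pd c k (\<lambda>q. G c q $ i $ l) p + pd c i (\<lambda>q. G c q $ k $ l) p - pd c l (\<lambda>q. G c q $ k $ i) p))"
proof -
  let ?X = "grad G c f p" and ?Z = "grad G c g p" and ?P = "matrix_inv (G c p)"
  let ?T = "\<lambda>k l. pd c k (\<lambda>q. G c q $ i $ l) p + pd c i (\<lambda>q. G c q $ k $ l) p - pd c l (\<lambda>q. G c q $ k $ i) p"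
  have raise: "(\<Sum>j\<in>UNIV. ?P $ j $ k * pd c j h p) = grad G c h p $ k" for h k
    unfolding grad_def matrix_vector_mult_def
    by (simp add: G_inv_sym[OF c, of _ k])
  have N: "nabla2 G c k i g p = pd c k (pd c i g) p - (1/2) * (\<Sum>l\<in>UNIV. ?Z $ l * ?T k l)" for k
  proof -
    have "(\<Sum>m\<in>UNIV. christoffel G c m k i p * pd c m g p)
        = (\<Sum>m\<in>UNIV. \<Sum>l\<in>UNIV. (1/2) * (?P $ m $ l * pd c m g p * ?T k l))"
      unfolding christoffel_def by (simp add: sum_distrib_left sum_distrib_right mult_ac)
    also have "\<dots> = (\<Sum>l\<in>UNIV. (1/2) * ((\<Sum>m\<in>UNIV. ?P $ m $ l * pd c m g p) * ?T k l))"
      by (subst sum.swap) (simp add: sum_distrib_left sum_distrib_right)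
    finally show ?thesis
      unfolding nabla2_def nabla_covector_def raise by (simp add: sum_distrib_left)
  qed
  have "(\<Sum>j\<in>UNIV. pd c j f p * nabla2_up G c j i g p)
      = (\<Sum>j\<in>UNIV. \<Sum>k\<in>UNIV. ?P $ j $ k * pd c j f p * nabla2 G c k i g p)"
    unfolding nabla2_up_def by (simp add: sum_distrib_left mult_ac)
  also have "\<dots> = (\<Sum>k\<in>UNIV. (\<Sum>j\<in>UNIV. ?P $ j $ k * pd c j f p) * nabla2 G c k i g p)"
    by (subst sum.swap) (simp add: sum_distrib_right)
  also have "\<dots> = (\<Sum>k\<in>UNIV. ?X $ k * pd c k (pd c i g) p)
      - (\<Sum>k\<in>UNIV. ?X $ k * ((1/2) * (\<Sum>l\<in>UNIV. ?Z $ l * ?T k l)))"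
    unfolding raise N by (simp only: right_diff_distrib sum_subtractf)
  finally show ?thesis
    unfolding dirderiv_def by (simp add: sum_distrib_left mult_ac)
qed

lemma pd_G_sym:
  assumes "c \<in> \<A>" "p \<in> fst c"
  shows "pd c k (\<lambda>q. G c q $ i $ j) p = pd c k (\<lambda>q. G c q $ j $ i) p"
  by (rule pd_cong_open[OF is_chart[OF assms(1)] open_UNIV]) (use assms G_sym in auto)

text \<open>In the difference of the two Christoffel sums the terms d_i G_kl cancel and the others
  double, which uses up the factor 1/2. What remains is the product rule for G_ik [X, Z]^k, written
  with the lowered fields df and dg.\<close>

lemma bracket_form_eq:
  assumes c: "c \<in> \<A>" "p \<in> fst c"
  shows "bracket_form G c f g i p
    = dirderiv c (grad G c f p) (pd c i g) p - dirderiv c (grad G c g p) (pd c i f) p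
      + (\<Sum>k\<in>UNIV. grad G c f p $ k * dirderiv c (grad G c g p) (\<lambda>q. G c q $ i $ k) p)
      - (\<Sum>k\<in>UNIV. grad G c g p $ k * dirderiv c (grad G c f p) (\<lambda>q. G c q $ i $ k) p)"
proof -
  let ?X = "\<lambda>k. grad G c f p $ k" and ?Z = "\<lambda>k. grad G c g p $ k"
  let ?d = "\<lambda>l i k. pd c l (\<lambda>q. G c q $ i $ k) p"
  have arith: "b = a' \<Longrightarrow> a' - a = 2 * (u - v) \<Longrightarrow> v = v' \<Longrightarrow> x = u \<Longrightarrow> z = v' \<Longrightarrow>
      (s - 1/2 * a) - (t - 1/2 * b) = s - t + x - z" for a a' b s t u v v' x z :: real
    by simp
  have "(\<Sum>k\<in>UNIV. \<Sum>l\<in>UNIV. ?Z k * ?X l * (?d k i l + ?d i k l - ?d l k i))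
      = (\<Sum>k\<in>UNIV. \<Sum>l\<in>UNIV. ?X k * ?Z l * (?d l i k + ?d i l k - ?d k l i))"
    by (subst sum.swap) (simp add: mult_ac)
  moreover have "(\<Sum>k\<in>UNIV. \<Sum>l\<in>UNIV. ?X k * ?Z l * (?d l i k + ?d i l k - ?d k l i))
      - (\<Sum>k\<in>UNIV. \<Sum>l\<in>UNIV. ?X k * ?Z l * (?d k i l + ?d i k l - ?d l k i))
      = 2 * ((\<Sum>k\<in>UNIV. \<Sum>l\<in>UNIV. ?X k * ?Z l * ?d l i k) - (\<Sum>k\<in>UNIV. \<Sum>l\<in>UNIV. ?X k * ?Z l * ?d k i l))"
    unfolding sum_subtractf[symmetric] sum_distrib_left
    using pd_G_sym[OF c] by (intro sum.cong refl) (simp add: algebra_simps)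
  moreover have "(\<Sum>k\<in>UNIV. \<Sum>l\<in>UNIV. ?X k * ?Z l * ?d k i l) = (\<Sum>k\<in>UNIV. \<Sum>l\<in>UNIV. ?Z k * ?X l * ?d l i k)"
    by (subst sum.swap) (simp add: mult_ac)
  moreover have "(\<Sum>k\<in>UNIV. ?X k * dirderiv c (grad G c g p) (\<lambda>q. G c q $ i $ k) p)
      = (\<Sum>k\<in>UNIV. \<Sum>l\<in>UNIV. ?X k * ?Z l * ?d l i k)"
    by (simp add: dirderiv_def sum_distrib_left mult.assoc)
  moreover have "(\<Sum>k\<in>UNIV. ?Z k * dirderiv c (grad G c f p) (\<lambda>q. G c q $ i $ k) p)
      = (\<Sum>k\<in>UNIV. \<Sum>l\<in>UNIV. ?Z k * ?X l * ?d l i k)"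
    by (simp add: dirderiv_def sum_distrib_left mult.assoc)
  ultimately show ?thesis
    unfolding bracket_form_def nabla_term[OF c] by (rule arith)
qed

text \<open>The transformation law reads M G' M^T = G with G invertible, so the Jacobian M has
  nonzero determinant.\<close>

lemma jacobian_kernel:
  assumes c: "c \<in> \<A>" and d: "d \<in> \<A>" and p: "p \<in> fst c \<inter> fst d"
    and w: "\<And>i. (\<Sum>a\<in>UNIV. pd c i (\<lambda>q. snd d q $ a) p * w $ a) = 0"
  shows "w = 0"
proof -
  define M where "M = (\<chi> i a. pd c i (\<lambda>q. snd d q $ a) p)"
  have "M ** (G d p ** transpose M) = G c p"
  proof -
    have "(M ** (G d p ** transpose M)) $ i $ j = G c p $ i $ j" for i j
      unfolding G_transform[OF c d p]
      by (simp add: M_def matrix_matrix_mult_def transpose_def sum_distrib_left mult_ac)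
    then show ?thesis by (simp add: vec_eq_iff)
  qed
  then have "det M * det (G d p ** transpose M) = det (G c p)" by (simp only: det_mul[symmetric])
  then have "det M \<noteq> 0"
    using G_invertible[OF c, of p] p unfolding invertible_det_nz by auto
  moreover have "M *v w = 0" using w by (simp add: vec_eq_iff matrix_vector_mult_def M_def)
  ultimately show ?thesis
    using matrix_left_invertible_ker[of M] invertible_left_inverse[of M] invertible_det_nz[of M] by blast
qed

lemma dirderiv_cong_open:
  assumes "is_chart c" "open W" "p \<in> fst c \<inter> W" "\<And>q. q \<in> fst c \<inter> W \<Longrightarrow> F q = H q"
  shows "dirderiv c v F p = dirderiv c v H p"
  unfolding dirderiv_def using pd_cong_open[OF assms] by simp

lemma dirderiv_sum:
  assumes "\<And>a. a \<in> A \<Longrightarrow> in_chart c (F a) differentiable at (snd c p)"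
  shows "dirderiv c v (\<lambda>q. \<Sum>a\<in>A. F a q) p = (\<Sum>a\<in>A. dirderiv c v (F a) p)"
  by (simp add: dirderiv_def pd_sum(2)[OF assms] sum_distrib_left) (rule sum.swap)

lemma dirderiv_mult:
  assumes "in_chart c F differentiable at (snd c p)" "in_chart c H differentiable at (snd c p)"
    and "is_chart c" "p \<in> fst c"
  shows "dirderiv c v (\<lambda>q. F q * H q) p = dirderiv c v F p * H p + F p * dirderiv c v H p"
  unfolding dirderiv_def pd_mult(2)[OF assms]
  by (simp add: algebra_simps sum.distrib sum_distrib_left)

lemma smooth_fun_differentiable:
  fixes F :: "'a \<Rightarrow> real"
  assumes "smooth_fun_on \<A> W F" "open W" "c \<in> \<A>" "p \<in> fst c \<inter> W"
  shows "in_chart c F differentiable at (snd c p)"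
    and "in_chart c (pd c i F) differentiable at (snd c p)"
proof -
  let ?S = "snd c ` (fst c \<inter> W)"
  have S: "open ?S" "snd c p \<in> ?S" using open_chart_image[OF is_chart[OF assms(3)] assms(2)] assms(4) by auto
  have sm: "smooth_on ?S (in_chart c F)" using assms(1,3) by (simp add: smooth_fun_on_def)
  show "in_chart c F differentiable at (snd c p)" by (rule smooth_on_differentiable[OF sm S])
  have "dpart i (in_chart c F) differentiable at (snd c p)"
    by (rule smooth_on_differentiable[OF smooth_on_dpart[OF sm] S])
  moreover have "in_chart c (pd c i F) y = dpart i (in_chart c F) y" if "y \<in> ?S" for y
    using that by (intro in_chart_pd[OF is_chart[OF assms(3)]]) auto
  ultimately show "in_chart c (pd c i F) differentiable at (snd c p)"
    unfolding differentiable_def using has_derivative_cong_open[OF S] by blast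
qed

lemma G_differentiable:
  assumes "c \<in> \<A>" "p \<in> fst c"
  shows "in_chart c (\<lambda>q. G c q $ i $ j) differentiable at (snd c p)"
  using open_chart_image[OF is_chart[OF assms(1)] open_UNIV] assms(2)
  by (intro smooth_on_differentiable[OF G_smooth[OF assms(1)]]) auto

lemma pd_pd_commute:
  fixes F :: "'a \<Rightarrow> real"
  assumes "smooth_fun_on \<A> W F" "open W" "c \<in> \<A>" "p \<in> fst c \<inter> W"
  shows "pd c i (pd c j F) p = pd c j (pd c i F) p"
  using assms open_chart_image[OF is_chart[OF assms(3)] assms(2)]
  by (simp add: pd_pd[OF is_chart] smooth_fun_on_def dpart_commute[of "snd c ` (fst c \<inter> W)"])

lemma sum_prod_swap3:
  fixes x :: "4 \<Rightarrow> real" and h :: "4 \<Rightarrow> 4 \<Rightarrow> 4 \<Rightarrow> real"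
  shows "(\<Sum>k\<in>UNIV. x k * (\<Sum>a\<in>UNIV. \<Sum>b\<in>UNIV. h k a b)) = (\<Sum>a\<in>UNIV. \<Sum>b\<in>UNIV. \<Sum>k\<in>UNIV. x k * h k a b)"
  unfolding sum_distrib_left
  by (subst sum.swap, rule sum.cong[OF refl], rule sum.swap)

text \<open>The Hessian terms involving second derivatives of the coordinate change cancel against the
  terms which they cause in the derivatives of the metric.\<close>

lemma bracket_form_transform:
  assumes c: "c \<in> \<A>" and d: "d \<in> \<A>" and W: "open W" and p: "p \<in> fst c \<inter> fst d" "p \<in> W"
    and f: "smooth_fun_on \<A> W f" and g: "smooth_fun_on \<A> W g"
  shows "bracket_form G c f g i p
    = (\<Sum>a\<in>UNIV. pd c i (\<lambda>q. snd d q $ a) p * bracket_form G d f g a p)"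
proof -
  have pc: "p \<in> fst c" and pd: "p \<in> fst d" using p by auto
  define J where "J k a q = pd c k (\<lambda>q. snd d q $ a) q" for k a q
  let ?N = "fst d \<inter> W"
  have N: "open ?N" "p \<in> fst c \<inter> ?N" using open_chart[OF d] W p by auto
  note ic = is_chart[OF c] note id = is_chart[OF d]
  have coord: "smooth_fun_on \<A> (fst d) (\<lambda>q. snd d q $ a)" for a by (rule coordinate_smooth[OF d])
  have dJ: "in_chart c (J k a) differentiable at (snd c p)" for k a
    unfolding J_def[abs_def] by (rule smooth_fun_differentiable(2)[OF coord open_chart[OF d] c p(1)])
  have Jsym: "pd c l (J k a) p = pd c k (J l a) p" for k l a
    unfolding J_def[abs_def] by (rule pd_pd_commute[OF coord open_chart[OF d] c p(1)])
  have chain: "pd c k F q = (\<Sum>a\<in>UNIV. J k a q * pd d a F q)"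
    if "in_chart d F differentiable at (snd d q)" "q \<in> fst c \<inter> fst d" for k F q
    using pd_chain(2)[OF c d that(2,1), of k] by (simp add: J_def)
  have pdF: "pd c k F q = (\<Sum>a\<in>UNIV. J k a q * pd d a F q)"
    if "smooth_fun_on \<A> W F" "q \<in> fst c \<inter> ?N" for k F q
    using that by (intro chain smooth_fun_differentiable(1)[OF that(1) W d]) auto
  let ?G = "\<lambda>a b q. G d q $ a $ b"
  define X where "X = grad G c f p"
  define Z where "Z = grad G c g p"
  define push where "push V = (\<chi> a. \<Sum>k\<in>UNIV. V $ k * J k a p)" for V :: "real^4"
  have push: "dirderiv c V F p = dirderiv d (push V) F p"
    if "in_chart d F differentiable at (snd d p)" for V F
  proof -
    have "dirderiv c V F p = (\<Sum>k\<in>UNIV. \<Sum>a\<in>UNIV. V $ k * (J k a p * pd d a F p))"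
      unfolding dirderiv_def chain[OF that p(1)] by (simp add: sum_distrib_left)
    also have "\<dots> = dirderiv d (push V) F p"
      unfolding dirderiv_def push_def by (subst sum.swap) (simp add: sum_distrib_right mult.assoc)
    finally show ?thesis .
  qed
  have Gt: "G c q $ i $ k = (\<Sum>a\<in>UNIV. \<Sum>b\<in>UNIV. J i a q * J k b q * ?G a b q)"
    if "q \<in> fst c \<inter> ?N" for i k q
    unfolding J_def using that by (intro G_transform[OF c d]) auto
  \<comment> \<open>The Jacobian annihilates the difference of the two sides. Consequently gradients
    push forward to gradients.\<close>
  have lowered: "(\<Sum>b\<in>UNIV. ?G a b p * push V $ b) = pd d a F p"
    if F: "smooth_fun_on \<A> W F" and V: "V = grad G c F p" for a V F
  proof -
    define w where "w = (\<chi> a. (\<Sum>b\<in>UNIV. ?G a b p * push V $ b) - pd d a F p)"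
    have Jw: "(\<Sum>a\<in>UNIV. J i a p * w $ a) = 0" for i
    proof -
      have "(\<Sum>a\<in>UNIV. J i a p * (\<Sum>b\<in>UNIV. ?G a b p * push V $ b))
          = (\<Sum>a\<in>UNIV. \<Sum>b\<in>UNIV. \<Sum>k\<in>UNIV. V $ k * (J i a p * J k b p * ?G a b p))"
        unfolding push_def by (simp add: sum_distrib_left mult_ac)
      also have "\<dots> = (\<Sum>k\<in>UNIV. V $ k * G c p $ i $ k)"
        unfolding Gt[OF N(2)] by (rule sum_prod_swap3[symmetric])
      also have "\<dots> = pd c i F p"
        using lower_grad[OF c pc, of i F] by (simp add: V mult.commute)
      also have "\<dots> = (\<Sum>a\<in>UNIV. J i a p * pd d a F p)" by (rule pdF[OF F N(2)])
      finally show ?thesis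
        by (simp add: w_def right_diff_distrib sum_subtractf)
    qed
    have "w = 0" by (rule jacobian_kernel[OF c d p(1) Jw[unfolded J_def]])
    then have "w $ a = 0" by simp
    then show ?thesis by (simp add: w_def)
  qed
  have pushX: "push V = grad G d F p" if F: "smooth_fun_on \<A> W F" and V: "V = grad G c F p" for V F
  proof -
    have "G d p *v push V = (\<chi> a. pd d a F p)"
      using lowered[OF that] by (simp add: matrix_vector_mult_def vec_eq_iff)
    then have "matrix_inv (G d p) *v (G d p *v push V) = grad G d F p" by (simp add: grad_def)
    then show ?thesis
      using matrix_inv_inverse(2)[OF G_invertible[OF d pd]] by (simp add: matrix_vector_mul_assoc)
  qed
  have hess: "dirderiv c V (pd c i F) p = (\<Sum>a\<in>UNIV. dirderiv c V (J i a) p * pd d a F p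
      + J i a p * dirderiv d (push V) (pd d a F) p)" if F: "smooth_fun_on \<A> W F" for V F
  proof -
    have dF: "in_chart c (pd d a F) differentiable at (snd c p)"
      "in_chart d (pd d a F) differentiable at (snd d p)" for a
      using pd_chain(1)[OF c d p(1)] smooth_fun_differentiable(2)[OF F W d] p by auto
    have "dirderiv c V (pd c i F) p = dirderiv c V (\<lambda>q. \<Sum>a\<in>UNIV. J i a q * pd d a F q) p"
      by (rule dirderiv_cong_open[OF ic N]) (rule pdF[OF F])
    also have "\<dots> = (\<Sum>a\<in>UNIV. dirderiv c V (\<lambda>q. J i a q * pd d a F q) p)"
      by (intro dirderiv_sum pd_mult(1)[OF dJ dF(1) ic pc])
    finally show ?thesis
      unfolding dirderiv_mult[OF dJ dF(1) ic pc] push[OF dF(2)] .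
  qed
  \<comment> \<open>The contribution of second derivatives of the coordinate change. As these
    commute, it is symmetric in X and Z and drops out of the difference.\<close>
  define S where "S b = (\<Sum>k\<in>UNIV. X $ k * dirderiv c Z (J k b) p)" for b
  have S': "S b = (\<Sum>k\<in>UNIV. Z $ k * dirderiv c X (J k b) p)" for b
    unfolding S_def dirderiv_def sum_distrib_left
    by (subst sum.swap) (simp add: Jsym mult.left_commute)
  \<comment> \<open>The product rule for J J G gives three groups: the first cancels the additional
    Hessian terms, the second contains the symmetric sum S, and the third is the term in the other
    chart.\<close>
  have metric_term: "(\<Sum>k\<in>UNIV. X' $ k * dirderiv c V (\<lambda>q. G c q $ i $ k) p)
      = (\<Sum>a\<in>UNIV. dirderiv c V (J i a) p * pd d a F p)
        + (\<Sum>a\<in>UNIV. \<Sum>b\<in>UNIV. J i a p * ?G a b p * (\<Sum>k\<in>UNIV. X' $ k * dirderiv c V (J k b) p))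
        + (\<Sum>a\<in>UNIV. J i a p * (\<Sum>b\<in>UNIV. push X' $ b * dirderiv d (push V) (?G a b) p))"
    if F: "smooth_fun_on \<A> W F" and X': "X' = grad G c F p" for X' V F
  proof -
    have dG: "in_chart c (?G a b) differentiable at (snd c p)"
      "in_chart d (?G a b) differentiable at (snd d p)" for a b
      using pd_chain(1)[OF c d p(1)] G_differentiable[OF d pd] by auto
    have dJJ: "in_chart c (\<lambda>q. J i a q * J k b q) differentiable at (snd c p)" for a k b
      by (rule pd_mult(1)[OF dJ dJ ic pc])
    have D: "dirderiv c V (\<lambda>q. G c q $ i $ k) p = (\<Sum>a\<in>UNIV. \<Sum>b\<in>UNIV.
        (dirderiv c V (J i a) p * J k b p + J i a p * dirderiv c V (J k b) p) * ?G a b p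
          + J i a p * J k b p * dirderiv d (push V) (?G a b) p)" for k
    proof -
      have "dirderiv c V (\<lambda>q. G c q $ i $ k) p
          = dirderiv c V (\<lambda>q. \<Sum>a\<in>UNIV. \<Sum>b\<in>UNIV. J i a q * J k b q * ?G a b q) p"
        by (rule dirderiv_cong_open[OF ic N]) (rule Gt)
      also have "\<dots> = (\<Sum>a\<in>UNIV. \<Sum>b\<in>UNIV. dirderiv c V (\<lambda>q. J i a q * J k b q * ?G a b q) p)"
        by (subst dirderiv_sum, rule pd_sum(1)[OF pd_mult(1)[OF dJJ dG(1) ic pc]])
           (subst dirderiv_sum, rule pd_mult(1)[OF dJJ dG(1) ic pc], rule refl)
      finally show ?thesis
        unfolding dirderiv_mult[OF dJJ dG(1) ic pc] dirderiv_mult[OF dJ dJ ic pc] push[OF dG(2)] .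
    qed
    have "(\<Sum>k\<in>UNIV. X' $ k * dirderiv c V (\<lambda>q. G c q $ i $ k) p)
        = (\<Sum>a\<in>UNIV. \<Sum>b\<in>UNIV. \<Sum>k\<in>UNIV. X' $ k *
          ((dirderiv c V (J i a) p * J k b p + J i a p * dirderiv c V (J k b) p) * ?G a b p
          + J i a p * J k b p * dirderiv d (push V) (?G a b) p))"
      unfolding D by (rule sum_prod_swap3)
    also have "\<dots> = (\<Sum>a\<in>UNIV. \<Sum>b\<in>UNIV. dirderiv c V (J i a) p * (?G a b p * push X' $ b)
          + J i a p * ?G a b p * (\<Sum>k\<in>UNIV. X' $ k * dirderiv c V (J k b) p)
          + J i a p * (push X' $ b * dirderiv d (push V) (?G a b) p))"
      unfolding push_def by (simp add: sum_distrib_left sum_distrib_right sum.distrib algebra_simps)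
    also have "\<dots> = (\<Sum>a\<in>UNIV. dirderiv c V (J i a) p * (\<Sum>b\<in>UNIV. ?G a b p * push X' $ b))
        + (\<Sum>a\<in>UNIV. \<Sum>b\<in>UNIV. J i a p * ?G a b p * (\<Sum>k\<in>UNIV. X' $ k * dirderiv c V (J k b) p))
        + (\<Sum>a\<in>UNIV. J i a p * (\<Sum>b\<in>UNIV. push X' $ b * dirderiv d (push V) (?G a b) p))"
      by (simp add: sum.distrib sum_distrib_left)
    finally show ?thesis unfolding lowered[OF that] .
  qed
  note mX = metric_term[OF f X_def, of Z, folded S_def]
  note mZ = metric_term[OF g Z_def, of X, folded S']
  have "bracket_form G c f g i p
      = (\<Sum>a\<in>UNIV. J i a p * dirderiv d (push X) (pd d a g) p)
        - (\<Sum>a\<in>UNIV. J i a p * dirderiv d (push Z) (pd d a f) p)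
        + (\<Sum>a\<in>UNIV. J i a p * (\<Sum>b\<in>UNIV. push X $ b * dirderiv d (push Z) (?G a b) p))
        - (\<Sum>a\<in>UNIV. J i a p * (\<Sum>b\<in>UNIV. push Z $ b * dirderiv d (push X) (?G a b) p))"
    unfolding bracket_form_eq[OF c pc] X_def[symmetric] Z_def[symmetric] hess[OF f] hess[OF g] mX mZ sum.distrib
    by simp
  also have "\<dots> = (\<Sum>a\<in>UNIV. J i a p * bracket_form G d f g a p)"
    unfolding bracket_form_eq[OF d pd] pushX[OF f X_def] pushX[OF g Z_def]
    by (simp add: algebra_simps sum.distrib sum_subtractf)
  finally show ?thesis by (simp add: J_def)
qed

end

section \<open>Doubly biorthogonal coordinates\<close>

text \<open>An alternating form on a plane is fixed by one value and scales with the determinant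
  under a change of basis. This moves the equation from the two gradients to the normalised
  frame.\<close>

lemma sum_antisym_form:
  fixes t :: "4 \<Rightarrow> 4 \<Rightarrow> real"
  assumes "\<And>k l. t k l = - t l k"
  shows "(\<Sum>k\<in>UNIV. \<Sum>l\<in>UNIV. (x1 * a k + x2 * b k) * (z1 * a l + z2 * b l) * t k l)
    = (x1 * z2 - x2 * z1) * (\<Sum>k\<in>UNIV. \<Sum>l\<in>UNIV. a k * b l * t k l)"
proof -
  define B where "B u v = (\<Sum>k\<in>UNIV. \<Sum>l\<in>UNIV. u k * v l * t k l)" for u v :: "4 \<Rightarrow> real"
  have anti: "B u v = - B v u" for u v
  proof -
    have "B u v = (\<Sum>l\<in>UNIV. \<Sum>k\<in>UNIV. u k * v l * t k l)" unfolding B_def by (rule sum.swap)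
    also have "\<dots> = (\<Sum>l\<in>UNIV. \<Sum>k\<in>UNIV. - (v l * u k * t l k))"
      by (intro sum.cong refl) (subst assms, simp)
    finally show ?thesis by (simp add: B_def sum_negf)
  qed
  have "(\<Sum>k\<in>UNIV. \<Sum>l\<in>UNIV. (x1 * a k + x2 * b k) * (z1 * a l + z2 * b l) * t k l)
      = x1 * z1 * B a a + x1 * z2 * B a b + x2 * z1 * B b a + x2 * z2 * B b b"
    unfolding B_def by (simp add: algebra_simps sum.distrib sum_distrib_left)
  also have "\<dots> = (x1 * z2 - x2 * z1) * B a b"
    using anti[of a a] anti[of b b] anti[of b a] by (simp add: algebra_simps)
  finally show ?thesis by (simp add: B_def)
qed

text \<open>For \<open>j \<in> {1, 2}\<close>, the vector \<open>\<partial>\<^sub>j\<close> corrected by a combination of \<open>\<partial>\<^sub>3\<close> and \<open>\<partial>\<^sub>4\<close> so that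
  it becomes orthogonal to both of them; the correction is Cramer's rule.\<close>

definition ortho_frame :: "(4 \<Rightarrow> 4 \<Rightarrow> real^4 \<Rightarrow> real) \<Rightarrow> 4 \<Rightarrow> real^4 \<Rightarrow> real^4" where
  "ortho_frame H j y = (\<chi> k.
     if k = 3 then (H 3 4 y * H 4 j y - H 4 4 y * H 3 j y) / (H 3 3 y * H 4 4 y - H 4 3 y * H 3 4 y)
     else if k = 4 then (H 4 3 y * H 3 j y - H 3 3 y * H 4 j y) / (H 3 3 y * H 4 4 y - H 4 3 y * H 3 4 y)
     else if k = j then 1 else 0)"

lemma ortho_frame_nth:
  "ortho_frame H 1 y $ 1 = 1" "ortho_frame H 1 y $ 2 = 0"
  "ortho_frame H 2 y $ 1 = 0" "ortho_frame H 2 y $ 2 = 1"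
  by (simp_all add: ortho_frame_def)

text \<open>Metric components in a chart, as functions on an open subset of real^4. The assumption
  \<open>block\<close> is nondegeneracy of the block with indices 3 and 4; in this form it directly
  shows that a given vector is 0.\<close>

locale block_metric =
  fixes S :: "(real^4) set" and H :: "4 \<Rightarrow> 4 \<Rightarrow> real^4 \<Rightarrow> real"
  assumes open_S: "open S" and smooth_H: "\<And>i j. smooth_on S (H i j)"
    and block: "\<And>y (v::real^4). y \<in> S \<Longrightarrow> v $ 1 = 0 \<Longrightarrow> v $ 2 = 0 \<Longrightarrow>
      (\<Sum>k\<in>UNIV. H 3 k y * v $ k) = 0 \<Longrightarrow> (\<Sum>k\<in>UNIV. H 4 k y * v $ k) = 0 \<Longrightarrow> v = 0"
begin

lemma block_det:
  assumes "y \<in> S"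
  shows "H 3 3 y * H 4 4 y - H 4 3 y * H 3 4 y \<noteq> 0"
proof (rule det2_nonzero)
  fix a b assume 0: "a * H 3 3 y + b * H 3 4 y = 0" "a * H 4 3 y + b * H 4 4 y = 0"
  define v :: "real^4" where "v = (\<chi> k. if k = 3 then a else if k = 4 then b else 0)"
  have "v = 0"
    by (rule block[OF assms]) (use 0 in \<open>simp_all add: v_def sum_4 mult.commute\<close>)
  then have "v $ 3 = 0" "v $ 4 = 0" by simp_all
  then show "a = 0 \<and> b = 0" by (simp add: v_def)
qed

lemma ortho_frame_smooth: "smooth_on S (ortho_frame H j)"
proof (rule smooth_on_vecI[OF open_S])
  fix k :: 4
  have "smooth_on S (\<lambda>y. (H 3 4 y * H 4 j y - H 4 4 y * H 3 j y) / (H 3 3 y * H 4 4 y - H 4 3 y * H 3 4 y))"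
    "smooth_on S (\<lambda>y. (H 4 3 y * H 3 j y - H 3 3 y * H 4 j y) / (H 3 3 y * H 4 4 y - H 4 3 y * H 3 4 y))"
    using block_det by (intro smooth_on_divide smooth_on_diff smooth_on_mult open_S smooth_H; simp)+
  then show "smooth_on S (\<lambda>y. ortho_frame H j y $ k)"
    by (cases "k = 3"; cases "k = 4"; cases "k = j") (simp_all add: ortho_frame_def smooth_on_const)
qed

lemma ortho_frame_ortho:
  assumes "y \<in> S" "j \<in> {1, 2}" "\<alpha> \<in> {3, 4}"
  shows "(\<Sum>k\<in>UNIV. H \<alpha> k y * ortho_frame H j y $ k) = 0"
proof -
  define D where "D = H 3 3 y * H 4 4 y - H 4 3 y * H 3 4 y"
  have D: "D \<noteq> 0" using block_det[OF assms(1)] by (simp add: D_def)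
  have "(\<Sum>k\<in>UNIV. H \<alpha> k y * ortho_frame H j y $ k) = H \<alpha> j y
      + H \<alpha> 3 y * ((H 3 4 y * H 4 j y - H 4 4 y * H 3 j y) / D)
      + H \<alpha> 4 y * ((H 4 3 y * H 3 j y - H 3 3 y * H 4 j y) / D)"
    using assms(2) by (auto simp: sum_4 ortho_frame_def D_def)
  also have "\<dots> = (H \<alpha> j y * D + H \<alpha> 3 y * (H 3 4 y * H 4 j y - H 4 4 y * H 3 j y)
      + H \<alpha> 4 y * (H 4 3 y * H 3 j y - H 3 3 y * H 4 j y)) / D"
    using D by (simp add: add_divide_distrib)
  also have "\<dots> = 0" using assms(3) by (auto simp: D_def algebra_simps)
  finally show ?thesis .
qed

text \<open>Let w be the bracket of the two fields. Its components 1 and 2 vanish because those of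
  the frame are constant. Differentiating the orthogonality relations turns its pairing with row
  \<alpha> of H into the sum in \<open>inv\<close>, which is up to sign the exterior derivative of
  that row, read as a one-form, on the frame. Nondegeneracy of the block gives w = 0.\<close>

lemma ortho_frame_commutes:
  assumes y: "y \<in> S" and inv: "\<And>\<alpha>. \<alpha> \<in> {3, 4} \<Longrightarrow>
    (\<Sum>k\<in>UNIV. \<Sum>l\<in>UNIV. ortho_frame H 1 y $ k * ortho_frame H 2 y $ l *
      (dpart l (H \<alpha> k) y - dpart k (H \<alpha> l) y)) = 0"
  shows "(\<Sum>l\<in>UNIV. (ortho_frame H 1 y $ l) *\<^sub>R dpart l (ortho_frame H 2) y)
    = (\<Sum>l\<in>UNIV. (ortho_frame H 2 y $ l) *\<^sub>R dpart l (ortho_frame H 1) y)"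
proof -
  let ?e = "ortho_frame H"
  define w where "w = (\<Sum>l\<in>UNIV. (?e 1 y $ l) *\<^sub>R dpart l (?e 2) y)
    - (\<Sum>l\<in>UNIV. (?e 2 y $ l) *\<^sub>R dpart l (?e 1) y)"
  have d: "?e j differentiable at y" for j
    by (rule smooth_on_differentiable[OF ortho_frame_smooth open_S y])
  have dH: "H i j differentiable at y" for i j
    by (rule smooth_on_differentiable[OF smooth_H open_S y])
  have const: "dpart l (\<lambda>y. c) y = 0" for c :: real and l
    using dpart_eqI[OF has_derivative_const] by metis
  have "dpart l (?e j) y $ 1 = 0" "dpart l (?e j) y $ 2 = 0" if "j \<in> {1, 2}" for l j
    unfolding dpart_nth[OF d, symmetric] using that by (auto simp: ortho_frame_nth const)
  then have w12: "w $ 1 = 0" "w $ 2 = 0" by (simp_all add: w_def)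
  have w34: "(\<Sum>k\<in>UNIV. H \<alpha> k y * w $ k) = 0" if \<alpha>: "\<alpha> \<in> {3, 4}" for \<alpha>
  proof -
    have D: "(\<Sum>k\<in>UNIV. H \<alpha> k y * dpart l (?e j) y $ k) = - (\<Sum>k\<in>UNIV. ?e j y $ k * dpart l (H \<alpha> k) y)"
      if j: "j \<in> {1, 2}" for l j
    proof -
      have "dpart l (\<lambda>y. \<Sum>k\<in>UNIV. (?e j y $ k) *\<^sub>R H \<alpha> k y) y = dpart l (\<lambda>y. 0) y"
        using ortho_frame_ortho[OF _ j \<alpha>] by (intro dpart_cong_open[OF open_S y]) (simp add: mult.commute)
      then have "(\<Sum>k\<in>UNIV. dpart l (?e j) y $ k * H \<alpha> k y) + (\<Sum>k\<in>UNIV. ?e j y $ k * dpart l (H \<alpha> k) y) = 0"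
        unfolding dpart_combination[OF d dH] const by simp
      then show ?thesis by (simp add: mult.commute)
    qed
    have E: "(\<Sum>k\<in>UNIV. H \<alpha> k y * (\<Sum>l\<in>UNIV. (?e i y $ l) *\<^sub>R dpart l (?e j) y) $ k)
        = - (\<Sum>l\<in>UNIV. \<Sum>k\<in>UNIV. ?e i y $ l * ?e j y $ k * dpart l (H \<alpha> k) y)"
      if "j \<in> {1, 2}" for i j
    proof -
      have "(\<Sum>k\<in>UNIV. H \<alpha> k y * (\<Sum>l\<in>UNIV. (?e i y $ l) *\<^sub>R dpart l (?e j) y) $ k)
          = (\<Sum>k\<in>UNIV. \<Sum>l\<in>UNIV. ?e i y $ l * (H \<alpha> k y * dpart l (?e j) y $ k))"
        by (simp add: sum_distrib_left mult.left_commute)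
      also have "\<dots> = (\<Sum>l\<in>UNIV. ?e i y $ l * (\<Sum>k\<in>UNIV. H \<alpha> k y * dpart l (?e j) y $ k))"
        by (subst sum.swap) (simp add: sum_distrib_left)
      finally show ?thesis unfolding D[OF that] by (simp add: sum_distrib_left sum_negf mult.assoc)
    qed
    have "(\<Sum>k\<in>UNIV. H \<alpha> k y * w $ k)
        = (\<Sum>k\<in>UNIV. H \<alpha> k y * (\<Sum>l\<in>UNIV. (?e 1 y $ l) *\<^sub>R dpart l (?e 2) y) $ k)
        - (\<Sum>k\<in>UNIV. H \<alpha> k y * (\<Sum>l\<in>UNIV. (?e 2 y $ l) *\<^sub>R dpart l (?e 1) y) $ k)"
      unfolding w_def vector_minus_component right_diff_distrib sum_subtractf ..
    also have "\<dots> = (\<Sum>l\<in>UNIV. \<Sum>k\<in>UNIV. ?e 2 y $ l * ?e 1 y $ k * dpart l (H \<alpha> k) y)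
        - (\<Sum>l\<in>UNIV. \<Sum>k\<in>UNIV. ?e 1 y $ l * ?e 2 y $ k * dpart l (H \<alpha> k) y)"
      unfolding E[OF insertI2[OF singletonI], of 1] E[OF insertI1, of 2] by simp
    also have "(\<Sum>l\<in>UNIV. \<Sum>k\<in>UNIV. ?e 2 y $ l * ?e 1 y $ k * dpart l (H \<alpha> k) y)
        = (\<Sum>k\<in>UNIV. \<Sum>l\<in>UNIV. ?e 1 y $ k * ?e 2 y $ l * dpart l (H \<alpha> k) y)"
      by (subst sum.swap) (simp add: mult.commute)
    also have "\<dots> - (\<Sum>l\<in>UNIV. \<Sum>k\<in>UNIV. ?e 1 y $ l * ?e 2 y $ k * dpart l (H \<alpha> k) y)
        = (\<Sum>k\<in>UNIV. \<Sum>l\<in>UNIV. ?e 1 y $ k * ?e 2 y $ l * (dpart l (H \<alpha> k) y - dpart k (H \<alpha> l) y))"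
      by (simp only: right_diff_distrib sum_subtractf)
    also have "\<dots> = 0" by (rule inv[OF \<alpha>])
    finally show ?thesis .
  qed
  have "w = 0" by (rule block[OF y w12]) (use w34 in auto)
  then show ?thesis by (simp add: w_def)
qed

end

lemma rint_nth:
  fixes h :: "real^4 \<Rightarrow> real^4"
  assumes "continuous_on (ball 0 \<delta>) h" "x \<in> ball 0 \<delta>"
  shows "rint I m h x $ a = rint I m (\<lambda>y. h y $ a) x"
  using integral_linear[OF rint_integrable[OF assms] bounded_linear_vec_nth[of a], of m I]
  by (simp add: rint_def o_def)

lemma conormal_pair_subset: "conormal_pair \<A> W f g \<Longrightarrow> U \<subseteq> W \<Longrightarrow> conormal_pair \<A> U f g"
proof -
  assume fg: "conormal_pair \<A> W f g" and U: "U \<subseteq> W"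
  have "smooth_fun_on \<A> U h" if "smooth_fun_on \<A> W h" for h :: "'a \<Rightarrow> real"
    unfolding smooth_fun_on_def
  proof
    fix c assume "c \<in> \<A>"
    then have "smooth_on (snd c ` (fst c \<inter> W)) (in_chart c h)" using that by (simp add: smooth_fun_on_def)
    then show "smooth_on (snd c ` (fst c \<inter> U)) (in_chart c h)"
      by (rule smooth_on_subset) (use U in blast)
  qed
  then show ?thesis using fg U unfolding conormal_pair_def by blast
qed

section \<open>From biorthogonal coordinates to the equation\<close>

context riemannian_mfd
begin

text \<open>The conditions make the quadratic form of the metric vanish at v, and the metric is
  positive definite.\<close>

lemma G_block:
  assumes "c \<in> \<A>" "p \<in> fst c" "v $ 1 = 0" "v $ 2 = 0"
    and "(\<Sum>k\<in>UNIV. G c p $ 3 $ k * v $ k) = 0" "(\<Sum>k\<in>UNIV. G c p $ 4 $ k * v $ k) = 0"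
  shows "v = 0"
proof -
  have "v \<bullet> (G c p *v v) = 0"
    using assms(3-6) by (simp add: inner_vec_def matrix_vector_mult_def sum_4[of "\<lambda>i. v $ i * _ i"])
  then show ?thesis using G_pos[OF assms(1,2), of v] by (cases "v = 0") simp_all
qed

lemma pd_eq_0_of_line_constant:
  fixes h :: "'a \<Rightarrow> real"
  assumes d: "d \<in> \<A>" and W: "open W" "smooth_fun_on \<A> W h" and q: "q \<in> fst d \<inter> W"
    and const: "\<And>r. r \<in> fst d \<inter> W \<Longrightarrow> (\<And>k. k \<noteq> i \<Longrightarrow> snd d r $ k = snd d q $ k) \<Longrightarrow> h r = h q"
  shows "pd d i h q = 0"
  unfolding pd_eq_dpart
proof (rule dpart_eq_0_of_line_constant[OF open_chart_image[OF is_chart[OF d] W(1)]])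
  show "snd d q \<in> snd d ` (fst d \<inter> W)" using q by blast
  show "in_chart d h differentiable at (snd d q)" by (rule smooth_fun_differentiable(1)[OF W(2,1) d q])
  fix z assume "z \<in> snd d ` (fst d \<inter> W)" and z: "\<And>k. k \<noteq> i \<Longrightarrow> z $ k = snd d q $ k"
  then obtain r where r: "r \<in> fst d \<inter> W" "z = snd d r" by blast
  then have "h r = h q" using z by (intro const) auto
  then show "in_chart d h z = in_chart d h (snd d q)" using r q is_chart[OF d] by simp
qed

lemma doubly_biorthogonal_zero:
  assumes "c \<in> \<A>" "doubly_biorthogonal G c" "q \<in> fst c" "a \<in> {1, 2}" "b \<in> {3, 4}"
  shows "G c q $ a $ b = 0" "G c q $ b $ a = 0"
proof -
  show "G c q $ a $ b = 0" using assms(2-5) by (auto simp: doubly_biorthogonal_def)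
  then show "G c q $ b $ a = 0" using G_sym[OF assms(1,3)] by simp
qed

text \<open>In the chart d the functions f and g have no derivatives along x^3, x^4, and the block
  form leaves their gradients without components 3 and 4. The covector then has vanishing components
  3 and 4, and the admissible test vectors have no others.\<close>

lemma biorthogonal_imp_pde:
  assumes d: "d \<in> \<A>" "doubly_biorthogonal G d" and fg: "conormal_pair \<A> (fst d) f g"
    and levels: "\<And>q r. q \<in> fst d \<Longrightarrow> r \<in> fst d \<Longrightarrow> snd d q $ 1 = snd d r $ 1 \<Longrightarrow>
      snd d q $ 2 = snd d r $ 2 \<Longrightarrow> f q = f r \<and> g q = g r"
  shows "biorthogonality_pde \<A> G (fst d) f g"
proof -
  have sm: "smooth_fun_on \<A> (fst d) f" "smooth_fun_on \<A> (fst d) g" using fg by (auto simp: conormal_pair_def)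
  have pd0: "pd d \<alpha> f q = 0" "pd d \<alpha> g q = 0" if \<alpha>: "\<alpha> \<in> {3, 4}" and q: "q \<in> fst d" for \<alpha> q
  proof -
    have "f r = f q \<and> g r = g q"
      if "r \<in> fst d \<inter> fst d" "\<And>k. k \<noteq> \<alpha> \<Longrightarrow> snd d r $ k = snd d q $ k" for r
    proof (rule levels[OF _ q])
      have "1 \<noteq> \<alpha>" "2 \<noteq> \<alpha>" using \<alpha> by auto
      then show "snd d r $ 1 = snd d q $ 1" "snd d r $ 2 = snd d q $ 2" by (auto intro: that(2))
    qed (use that(1) in simp)
    note const = this
    have q': "q \<in> fst d \<inter> fst d" using q by simp
    show "pd d \<alpha> f q = 0"
      by (rule pd_eq_0_of_line_constant[OF d(1) open_chart[OF d(1)] sm(1) q']) (use const in blast)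
    show "pd d \<alpha> g q = 0"
      by (rule pd_eq_0_of_line_constant[OF d(1) open_chart[OF d(1)] sm(2) q']) (use const in blast)
  qed
  have G0: "G d q $ \<alpha> $ k = 0" if "\<alpha> \<in> {3, 4}" "k \<in> {1, 2}" "q \<in> fst d" for \<alpha> k q
    by (rule doubly_biorthogonal_zero(2)[OF d that(3,2,1)])
  have X0: "grad G d F p $ 3 = 0" "grad G d F p $ 4 = 0"
    if F: "\<And>\<alpha>. \<alpha> \<in> {3, 4} \<Longrightarrow> pd d \<alpha> F p = 0" and p: "p \<in> fst d" for F p
  proof -
    define v :: "real^4" where "v = (\<chi> k. if k = 3 \<or> k = 4 then grad G d F p $ k else 0)"
    have "(\<Sum>k\<in>UNIV. G d p $ \<alpha> $ k * v $ k) = 0" if "\<alpha> \<in> {3, 4}" for \<alpha>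
      using lower_grad[OF d(1) p, of \<alpha> F] F[OF that] G0[OF that _ p] by (simp add: sum_4 v_def)
    then have "v = 0" by (intro G_block[OF d(1) p]) (auto simp: v_def)
    then have "v $ 3 = 0" "v $ 4 = 0" by simp_all
    then show "grad G d F p $ 3 = 0" "grad G d F p $ 4 = 0" by (simp_all add: v_def)
  qed
  note ic = is_chart[OF d(1)]
  have zero: "dirderiv d V F p = 0" if "\<And>q. q \<in> fst d \<Longrightarrow> F q = 0" "p \<in> fst d" for V F p
    using dirderiv_cong_open[OF ic open_UNIV, of p F "\<lambda>_. 0" V] that by (simp add: dirderiv_def)
  \<comment> \<open>In each term of \<open>bracket_form_eq\<close> either a function that is 0 on
    the whole chart is differentiated, or a gradient component 3 or 4 occurs as a factor.\<close>
  have E0: "bracket_form G d f g \<alpha> p = 0" if \<alpha>: "\<alpha> \<in> {3, 4}" and p: "p \<in> fst d" for \<alpha> p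
  proof -
    have "(\<Sum>k\<in>UNIV. grad G d F p $ k * dirderiv d V (\<lambda>q. G d q $ \<alpha> $ k) p) = 0"
      if "\<And>\<alpha>. \<alpha> \<in> {3, 4} \<Longrightarrow> pd d \<alpha> F p = 0" for F V
      using X0[OF that p] zero[of "\<lambda>q. G d q $ \<alpha> $ 1"] zero[of "\<lambda>q. G d q $ \<alpha> $ 2"] G0[OF \<alpha>] p
      by (simp add: sum_4)
    then show ?thesis
      unfolding bracket_form_eq[OF d(1) p] using zero pd0[OF \<alpha>] p pd0 by simp
  qed
  show ?thesis unfolding biorthogonality_pde_def
  proof (intro ballI allI impI)
    fix c p and Y :: "real^4"
    assume c: "c \<in> \<A>" and p: "p \<in> fst c \<inter> fst d"
      and Y: "(\<Sum>i\<in>UNIV. Y $ i * pd c i f p) = 0 \<and> (\<Sum>i\<in>UNIV. Y $ i * pd c i g p) = 0"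
    \<comment> \<open>The components of Y in the chart d.\<close>
    define Y' where "Y' a = (\<Sum>i\<in>UNIV. Y $ i * pd c i (\<lambda>q. snd d q $ a) p)" for a
    have pd: "p \<in> fst d" using p by simp
    have push: "(\<Sum>i\<in>UNIV. Y $ i * (\<Sum>a\<in>UNIV. pd c i (\<lambda>q. snd d q $ a) p * t a)) = (\<Sum>a\<in>UNIV. Y' a * t a)"
      for t :: "4 \<Rightarrow> real"
      unfolding Y'_def sum_distrib_left sum_distrib_right by (subst sum.swap) (simp add: mult.assoc)
    have "pd c i F p = (\<Sum>a\<in>UNIV. pd c i (\<lambda>q. snd d q $ a) p * pd d a F p)"
      if "smooth_fun_on \<A> (fst d) F" for i F
      using pd_chain(2)[OF c d(1) p smooth_fun_differentiable(1)[OF that open_chart[OF d(1)] d(1)], of i] pd by simp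
    then have "(\<Sum>a\<in>UNIV. Y' a * pd d a f p) = 0" "(\<Sum>a\<in>UNIV. Y' a * pd d a g p) = 0"
      using Y sm push by simp_all
    then have Y12: "Y' 1 * pd d 1 f p + Y' 2 * pd d 2 f p = 0" "Y' 1 * pd d 1 g p + Y' 2 * pd d 2 g p = 0"
      using pd0[OF _ pd] by (simp_all add: sum_4)
    \<comment> \<open>The Jacobian of (f, g) in (x^1, x^2) is invertible, which forces components 1
      and 2 of the test vector to vanish.\<close>
    have "pd d 1 f p * pd d 2 g p - pd d 2 f p * pd d 1 g p \<noteq> 0"
    proof (rule det2_nonzero)
      fix a b assume ab: "a * pd d 1 f p + b * pd d 1 g p = 0" "a * pd d 2 f p + b * pd d 2 g p = 0"
      have "a * pd d i f p + b * pd d i g p = 0" for i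
        using exhaust_4[of i] ab pd0[OF _ pd] by auto
      then show "a = 0 \<and> b = 0" using fg d(1) pd unfolding conormal_pair_def by blast
    qed
    moreover have "Y' 1 * (pd d 1 f p * pd d 2 g p - pd d 2 f p * pd d 1 g p) = 0"
    proof -
      have "Y' 1 * (pd d 1 f p * pd d 2 g p - pd d 2 f p * pd d 1 g p)
          = pd d 2 g p * (Y' 1 * pd d 1 f p + Y' 2 * pd d 2 f p) - pd d 2 f p * (Y' 1 * pd d 1 g p + Y' 2 * pd d 2 g p)"
        by (simp add: algebra_simps)
      then show ?thesis by (simp add: Y12)
    qed
    moreover have "Y' 2 * (pd d 1 f p * pd d 2 g p - pd d 2 f p * pd d 1 g p) = 0"
    proof -
      have "Y' 2 * (pd d 1 f p * pd d 2 g p - pd d 2 f p * pd d 1 g p)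
          = pd d 1 f p * (Y' 1 * pd d 1 g p + Y' 2 * pd d 2 g p) - pd d 1 g p * (Y' 1 * pd d 1 f p + Y' 2 * pd d 2 f p)"
        by (simp add: algebra_simps)
      then show ?thesis by (simp add: Y12)
    qed
    ultimately have "Y' 1 = 0" "Y' 2 = 0" by simp_all
    then have "(\<Sum>a\<in>UNIV. Y' a * bracket_form G d f g a p) = 0" using E0[OF _ pd] by (simp add: sum_4)
    then have "(\<Sum>i\<in>UNIV. Y $ i * bracket_form G c f g i p) = 0"
      unfolding bracket_form_transform[OF c d(1) open_chart[OF d(1)] p pd sm] push .
    then show "(\<Sum>i\<in>UNIV. Y $ i * ((\<Sum>j\<in>UNIV. pd c j f p * nabla2_up G c j i g p) -
        (\<Sum>j\<in>UNIV. pd c j g p * nabla2_up G c j i f p))) = 0"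
      by (simp add: bracket_form_def)
  qed
qed

section \<open>Uniqueness of the second family\<close>

text \<open>Since the first families agree, the coordinate fields 3 and 4 of both charts span the
  same plane. The i-th coordinate field of d is orthogonal to it, so its part along the fields 3 and
  4 of d' vanishes.\<close>

lemma cross_block_zero:
  assumes d: "d \<in> \<A>" "doubly_biorthogonal G d" and d': "d' \<in> \<A>" "doubly_biorthogonal G d'"
    and q: "q \<in> fst d \<inter> fst d'"
    and levels: "\<And>r. r \<in> fst d \<inter> fst d' \<Longrightarrow> snd d r $ 1 = snd d q $ 1 \<Longrightarrow> snd d r $ 2 = snd d q $ 2 \<Longrightarrow>
      snd d' r $ 1 = snd d' q $ 1 \<and> snd d' r $ 2 = snd d' q $ 2"
    and i: "i \<in> {1, 2}"
  shows "pd d i (\<lambda>q. snd d' q $ 3) q = 0 \<and> pd d i (\<lambda>q. snd d' q $ 4) q = 0"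
proof -
  define J where "J k a = pd d k (\<lambda>q. snd d' q $ a) q" for k a
  have qd: "q \<in> fst d" "q \<in> fst d'" using q by auto
  have J0: "J \<beta> 1 = 0" "J \<beta> 2 = 0" if \<beta>: "\<beta> \<in> {3, 4}" for \<beta>
  proof -
    have "snd d' r $ 1 = snd d' q $ 1 \<and> snd d' r $ 2 = snd d' q $ 2"
      if "r \<in> fst d \<inter> fst d'" "\<And>k. k \<noteq> \<beta> \<Longrightarrow> snd d r $ k = snd d q $ k" for r
    proof (rule levels[OF that(1)])
      have "1 \<noteq> \<beta>" "2 \<noteq> \<beta>" using \<beta> by auto
      then show "snd d r $ 1 = snd d q $ 1" "snd d r $ 2 = snd d q $ 2" by (auto intro: that(2))
    qed
    note const = this
    show "J \<beta> 1 = 0" "J \<beta> 2 = 0"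
      unfolding J_def
      by (rule pd_eq_0_of_line_constant[OF d(1) open_chart[OF d'(1)] coordinate_smooth[OF d'(1)] q],
          use const in blast)+
  qed
  have G': "G d' q $ a $ b = 0" if "a \<in> {1, 2} \<and> b \<in> {3, 4} \<or> a \<in> {3, 4} \<and> b \<in> {1, 2}" for a b
    using that doubly_biorthogonal_zero[OF d' qd(2)] by blast
  have Gt: "G d q $ k $ l = (\<Sum>a\<in>UNIV. \<Sum>b\<in>UNIV. J k a * J l b * G d' q $ a $ b)" for k l
    unfolding J_def by (rule G_transform[OF d(1) d'(1) q])
  have det: "J 3 3 * J 4 4 - J 3 4 * J 4 3 \<noteq> 0"
  proof (rule det2_nonzero)
    fix a b assume ab: "a * J 3 3 + b * J 4 3 = 0" "a * J 3 4 + b * J 4 4 = 0"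
    define v :: "real^4" where "v = (\<chi> k. if k = 3 then a else if k = 4 then b else 0)"
    have 0: "a * J 3 c + b * J 4 c = 0" for c using exhaust_4[of c] ab J0 by auto
    have "(\<Sum>k\<in>UNIV. G d q $ l $ k * v $ k) = 0" for l
    proof -
      have "(\<Sum>k\<in>UNIV. G d q $ l $ k * v $ k) = a * G d q $ l $ 3 + b * G d q $ l $ 4"
        by (simp add: sum_4 v_def)
      also have "\<dots> = (\<Sum>c\<in>UNIV. \<Sum>e\<in>UNIV. J l c * (a * J 3 e + b * J 4 e) * G d' q $ c $ e)"
        unfolding Gt sum_distrib_left sum.distrib[symmetric] by (simp add: algebra_simps)
      finally show ?thesis by (simp add: 0)
    qed
    then have "v = 0" by (intro G_block[OF d(1) qd(1)]) (auto simp: v_def)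
    then have "v $ 3 = 0" "v $ 4 = 0" by simp_all
    then show "a = 0 \<and> b = 0" by (simp add: v_def)
  qed
  \<comment> \<open>u is the part of the i-th coordinate field of d along the fields 3 and 4 of d',
    and s lists the inner products of u with the coordinate fields of d'.\<close>
  define u :: "real^4" where "u = (\<chi> k. if k = 3 \<or> k = 4 then J i k else 0)"
  define s where "s b = (\<Sum>k\<in>UNIV. G d' q $ b $ k * u $ k)" for b
  have s0: "J \<beta> 3 * s 3 + J \<beta> 4 * s 4 = 0" if "\<beta> \<in> {3, 4}" for \<beta>
  proof -
    have "G d q $ i $ \<beta> = 0" by (rule doubly_biorthogonal_zero(1)[OF d qd(1) i that])
    then show ?thesis
      unfolding Gt using J0[OF that] G' G_sym[OF d'(1) qd(2), of 3 4]
      by (simp add: sum_4 s_def u_def algebra_simps)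
  qed
  \<comment> \<open>Elimination in the two equations \<open>s0\<close>, whose determinant is nonzero
    by \<open>det\<close>.\<close>
  have "s 3 * (J 3 3 * J 4 4 - J 3 4 * J 4 3) = J 4 4 * (J 3 3 * s 3 + J 3 4 * s 4) - J 3 4 * (J 4 3 * s 3 + J 4 4 * s 4)"
    "s 4 * (J 3 3 * J 4 4 - J 3 4 * J 4 3) = J 3 3 * (J 4 3 * s 3 + J 4 4 * s 4) - J 4 3 * (J 3 3 * s 3 + J 3 4 * s 4)"
    by (simp_all add: algebra_simps)
  then have "s 3 * (J 3 3 * J 4 4 - J 3 4 * J 4 3) = 0" "s 4 * (J 3 3 * J 4 4 - J 3 4 * J 4 3) = 0"
    using s0[of 3] s0[of 4] by (simp_all only: insert_iff simp_thms mult_zero_right diff_self)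
  then have "s 3 = 0" "s 4 = 0" using det by simp_all
  then have "u = 0" by (intro G_block[OF d'(1) qd(2)]) (auto simp: u_def s_def)
  then have "u $ 3 = 0" "u $ 4 = 0" by simp_all
  then show ?thesis by (simp add: u_def J_def)
qed

end

text \<open>A cube instead of a ball: the uniqueness argument combines x^1, x^2 of one point with
  x^3, x^4 of another and must stay inside.\<close>

lemma open_cube:
  fixes y :: "real^4"
  shows "open {z. \<forall>k. \<bar>z $ k - y $ k\<bar> < \<eta>}"
proof -
  have "{z. \<forall>k. \<bar>z $ k - y $ k\<bar> < \<eta>} = (\<Inter>k. {z. \<bar>z $ k - y $ k\<bar> < \<eta>})" by blast
  moreover have "open (\<Inter>k. {z :: real^4. \<bar>z $ k - y $ k\<bar> < \<eta>})"
    by (intro open_INT finite ballI open_Collect_less continuous_intros)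
  ultimately show ?thesis by simp
qed

lemma convex_cube_segment:
  fixes z w y :: real
  assumes "\<bar>z - y\<bar> < \<eta>" "\<bar>w - y\<bar> < \<eta>" "t \<in> {0..1}"
  shows "\<bar>z + t * (w - z) - y\<bar> < \<eta>"
proof -
  have "z + t * (w - z) - y = (1 - t) * (z - y) + t * (w - y)" by (simp add: algebra_simps)
  also have "\<bar>\<dots>\<bar> \<le> (1 - t) * \<bar>z - y\<bar> + t * \<bar>w - y\<bar>"
    using assms(3) by (intro order_trans[OF abs_triangle_ineq]) (simp add: abs_mult)
  also have "\<dots> < \<eta>" using assms by (intro convex_bound_lt) auto
  finally show ?thesis .
qed

text \<open>The segment from z to w stays in the cube and changes only coordinates in A, in whose
  directions F has derivative 0.\<close>

lemma constant_on_cube_slice: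
  fixes F :: "real^4 \<Rightarrow> real"
  assumes "\<And>z. (\<And>k. \<bar>z $ k - y $ k\<bar> < \<eta>) \<Longrightarrow> F differentiable at z"
    and "\<And>z i. (\<And>k. \<bar>z $ k - y $ k\<bar> < \<eta>) \<Longrightarrow> i \<in> A \<Longrightarrow> dpart i F z = 0"
    and z: "\<And>k. \<bar>z $ k - y $ k\<bar> < \<eta>" and w: "\<And>k. \<bar>w $ k - y $ k\<bar> < \<eta>"
    and eq: "\<And>k. k \<notin> A \<Longrightarrow> z $ k = w $ k"
  shows "F z = F w"
proof -
  let ?c = "\<lambda>t. z + t *\<^sub>R (w - z)"
  have "((\<lambda>t. F (?c t)) has_derivative (\<lambda>_. 0)) (at t within {0..1})" if t: "t \<in> {0..1}" for t
  proof -
    have ct: "\<bar>?c t $ k - y $ k\<bar> < \<eta>" for k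
      using convex_cube_segment[OF z[of k] w[of k] t] by simp
    have 1: "(?c has_derivative (\<lambda>s. s *\<^sub>R (w - z))) (at t within {0..1})"
      by (rule has_derivative_eq_rhs[OF has_derivative_add[OF has_derivative_const
              has_derivative_scaleR_left[OF has_derivative_ident]]]) simp
    have "((s *\<^sub>R (w - z)) $ i) *\<^sub>R dpart i F (?c t) = 0" for s i
      using assms(2)[OF ct, of i] eq[of i] by (cases "i \<in> A") simp_all
    then have "(\<lambda>s. \<Sum>i\<in>UNIV. ((s *\<^sub>R (w - z)) $ i) *\<^sub>R dpart i F (?c t)) = (\<lambda>_. 0)"
      by (intro ext sum.neutral) blast
    then show ?thesis
      using has_derivative_compose[OF 1 has_derivative_dpart[OF assms(1)[OF ct]]] by simp
  qed
  from has_derivative_zero_constant[OF convex_real_interval(5) this]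
  obtain C where "\<And>t. t \<in> {0..1} \<Longrightarrow> F (?c t) = C" by blast
  from this[of 0] this[of 1] show ?thesis by simp
qed

context riemannian_mfd
begin

lemma coordinates_conormal:
  assumes d: "d \<in> \<A>"
  shows "conormal_pair \<A> (fst d) (\<lambda>q. snd d q $ 1) (\<lambda>q. snd d q $ 2)"
  unfolding conormal_pair_def
proof (intro conjI ballI allI impI coordinate_smooth[OF d])
  fix c p and a b :: real
  assume c: "c \<in> \<A>" and p: "p \<in> fst c \<inter> fst d"
    and ab: "\<forall>i. a * pd c i (\<lambda>q. snd d q $ 1) p + b * pd c i (\<lambda>q. snd d q $ 2) p = 0"
  define J where "J i k = pd c i (\<lambda>q. snd d q $ k) p" for i k
  have J: "a * J i 1 + b * J i 2 = 0" for i using ab by (simp add: J_def)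
  define w :: "real^4" where "w = (\<chi> k. if k = 1 then a else if k = 2 then b else 0)"
  have "w = 0"
    by (rule jacobian_kernel[OF c d p]) (use J in \<open>simp add: J_def w_def sum_4 mult.commute\<close>)
  then have "w $ 1 = 0" "w $ 2 = 0" by simp_all
  then show "a = 0" "b = 0" by (simp_all add: w_def)
qed

text \<open>By \<open>cross_block_zero\<close> the coordinates 3 and 4 of d' do not vary with x^1,
  x^2 of d, so on a small cube they are functions of x^3, x^4.\<close>

lemma second_family_unique:
  assumes d: "d \<in> \<A>" "doubly_biorthogonal G d" and d': "d' \<in> \<A>" "doubly_biorthogonal G d'"
    and p: "p \<in> fst d \<inter> fst d'"
    and levels: "\<And>q r. q \<in> fst d \<inter> fst d' \<Longrightarrow> r \<in> fst d \<inter> fst d' \<Longrightarrow>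
      (snd d q $ 1 = snd d r $ 1 \<and> snd d q $ 2 = snd d r $ 2) \<longleftrightarrow>
      (snd d' q $ 1 = snd d' r $ 1 \<and> snd d' q $ 2 = snd d' r $ 2)"
  obtains V where "open V" "p \<in> V" "V \<subseteq> fst d \<inter> fst d'"
    "surfaces V (\<lambda>q. snd d q $ 3) (\<lambda>q. snd d q $ 4) = surfaces V (\<lambda>q. snd d' q $ 3) (\<lambda>q. snd d' q $ 4)"
proof -
  let ?S = "snd d ` (fst d \<inter> fst d')" and ?y = "snd d p"
  have S: "open ?S" "?y \<in> ?S" using open_chart_image[OF is_chart[OF d(1)] open_chart[OF d'(1)]] p by auto
  then obtain \<epsilon> where \<epsilon>: "\<epsilon> > 0" "ball ?y \<epsilon> \<subseteq> ?S" using open_contains_ball by blast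
  \<comment> \<open>The sum of the four coordinate differences bounds the norm, so the cube of half
    side \<epsilon> / 4 lies in the ball.\<close>
  define \<eta> where "\<eta> = \<epsilon> / 4"
  let ?B = "{z. \<forall>k. \<bar>z $ k - ?y $ k\<bar> < \<eta>}"
  have B: "z \<in> ?S" if "\<And>k. \<bar>z $ k - ?y $ k\<bar> < \<eta>" for z
  proof -
    have "norm (z - ?y) \<le> (\<Sum>k\<in>UNIV. \<bar>(z - ?y) $ k\<bar>)" by (rule norm_le_l1_cart)
    also have "\<dots> < (\<Sum>k\<in>(UNIV::4 set). \<eta>)" using that by (intro sum_strict_mono) auto
    finally show ?thesis using \<epsilon>(2) by (auto simp: \<eta>_def dist_norm norm_minus_commute subset_iff)
  qed
  define V where "V = fst d \<inter> snd d -` ?B \<inter> fst d'"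
  have "homeomorphism (fst d) (snd d ` fst d) (snd d) (inv_into (fst d) (snd d))"
    using is_chart[OF d(1)] by (simp add: is_chart_def)
  then have "continuous_on (fst d) (snd d)" by (simp add: homeomorphism_def)
  then have "open (fst d \<inter> snd d -` ?B)"
    by (rule continuous_open_preimage[OF _ open_chart[OF d(1)] open_cube])
  then have V: "open V" "p \<in> V" "V \<subseteq> fst d \<inter> fst d'"
    unfolding V_def using p \<epsilon>(1) open_chart[OF d'(1)] by (auto simp: \<eta>_def)
  have inB: "\<bar>snd d q $ k - ?y $ k\<bar> < \<eta>" if "q \<in> V" for q k using that by (auto simp: V_def)
  let ?F = "\<lambda>a. in_chart d (\<lambda>q. snd d' q $ a)"
  have F: "?F a differentiable at z" "i \<in> {1, 2} \<Longrightarrow> dpart i (?F a) z = 0"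
    if a: "a \<in> {3, 4}" and z: "\<And>k. \<bar>z $ k - ?y $ k\<bar> < \<eta>" for a z i
  proof -
    obtain q where q: "q \<in> fst d \<inter> fst d'" "z = snd d q" using B[OF z] by blast
    show "?F a differentiable at z"
      unfolding q(2) by (rule smooth_fun_differentiable(1)[OF coordinate_smooth[OF d'(1)] open_chart[OF d'(1)] d(1) q(1)])
    assume i: "i \<in> {1, 2}"
    have "snd d' r $ 1 = snd d' q $ 1 \<and> snd d' r $ 2 = snd d' q $ 2"
      if "r \<in> fst d \<inter> fst d'" "snd d r $ 1 = snd d q $ 1" "snd d r $ 2 = snd d q $ 2" for r
      using levels[OF that(1) q(1)] that(2,3) by blast
    from cross_block_zero[OF d d' q(1) this i] have "pd d i (\<lambda>q. snd d' q $ a) q = 0" using a by blast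
    then show "dpart i (?F a) z = 0" by (simp only: q(2) pd_eq_dpart)
  qed
  have fwd: "snd d' q $ a = snd d' r $ a"
    if qr: "q \<in> V" "r \<in> V" and eq: "snd d q $ 3 = snd d r $ 3" "snd d q $ 4 = snd d r $ 4" and a: "a \<in> {3, 4}" for q r a
  proof -
    have "?F a (snd d q) = ?F a (snd d r)"
    proof (rule constant_on_cube_slice[where A = "{1, 2}" and y = ?y and \<eta> = \<eta>, OF F[OF a] inB[OF qr(1)] inB[OF qr(2)]])
      fix k :: 4 assume "k \<notin> {1, 2}"
      then show "snd d q $ k = snd d r $ k" using exhaust_4[of k] eq by auto
    qed
    then show ?thesis using qr V(3) is_chart[OF d(1)] by (simp add: subset_iff)
  qed
  \<comment> \<open>V is a cube only in the coordinates of d, so \<open>fwd\<close> cannot simply be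
    reversed. The point s with x^1, x^2 of q and x^3, x^4 of r has all coordinates in d' in common
    with q; hence s = q.\<close>
  have bwd: "snd d q $ a = snd d r $ a"
    if qr: "q \<in> V" "r \<in> V" and eq: "snd d' q $ 3 = snd d' r $ 3" "snd d' q $ 4 = snd d' r $ 4" and a: "a \<in> {3, 4}" for q r a
  proof -
    define z :: "real^4" where "z = (\<chi> k. if k = 1 \<or> k = 2 then snd d q $ k else snd d r $ k)"
    have zB: "\<bar>z $ k - ?y $ k\<bar> < \<eta>" for k using inB[OF qr(1)] inB[OF qr(2)] by (simp add: z_def)
    obtain s where s: "s \<in> fst d \<inter> fst d'" "z = snd d s" using B[OF zB] by blast
    have sV: "s \<in> V" using s zB by (auto simp: V_def)
    have z: "snd d s $ 1 = snd d q $ 1" "snd d s $ 2 = snd d q $ 2" "snd d s $ 3 = snd d r $ 3" "snd d s $ 4 = snd d r $ 4"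
      unfolding s(2)[symmetric] by (simp_all add: z_def)
    have q': "q \<in> fst d \<inter> fst d'" using qr(1) V(3) by blast
    have "snd d' s $ 1 = snd d' q $ 1" "snd d' s $ 2 = snd d' q $ 2"
      using levels[OF s(1) q'] z(1,2) by auto
    moreover have "snd d' s $ 3 = snd d' q $ 3" "snd d' s $ 4 = snd d' q $ 4"
      using fwd[OF sV qr(2) z(3,4)] eq by simp_all
    ultimately have "snd d' s = snd d' q" by (simp add: vec_eq_iff forall_4)
    then have "s = q" using s(1) q' chart_inv[OF is_chart[OF d'(1)]] by (metis IntD2)
    then show ?thesis using z(3,4) a by auto
  qed
  have "surfaces V (\<lambda>q. snd d q $ 3) (\<lambda>q. snd d q $ 4) = surfaces V (\<lambda>q. snd d' q $ 3) (\<lambda>q. snd d' q $ 4)"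
    unfolding surfaces_eq_iff using fwd bwd by blast
  with V show thesis by (rule that)
qed

section \<open>From the equation to biorthogonal coordinates\<close>

text \<open>With x^1 = f and x^2 = g the second derivatives disappear. The equation for the
  coordinate fields 3 and 4 then says that rows 3 and 4 of the metric, as one-forms, have vanishing
  exterior derivative on the orthogonal frame. So the frame commutes, and the inverse of its flow
  map is the new chart.\<close>

lemma pde_imp_biorthogonal:
  assumes W: "open W" and fg: "conormal_pair \<A> W f g" and pde: "biorthogonality_pde \<A> G W f g" and p: "p \<in> W"
  obtains U \<F>\<^sub>2 where "p \<in> U" "U \<subseteq> W" "biorthogonal_system \<A> G U (surfaces U f g) \<F>\<^sub>2"
proof -
  obtain c where c: "c \<in> \<A>" "p \<in> fst c" "fst c \<subseteq> W"
    and c1: "\<And>q. q \<in> fst c \<Longrightarrow> snd c q $ 1 = f q" and c2: "\<And>q. q \<in> fst c \<Longrightarrow> snd c q $ 2 = g q"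
    by (rule adapted_chart[OF W fg p]) (rule that)
  note ic = is_chart[OF c(1)]
  let ?S = "snd c ` fst c" and ?y = "snd c p"
  have S: "open ?S" "?y \<in> ?S" using open_chart_image[OF ic open_UNIV] c(2) by auto
  define H where "H i j = in_chart c (\<lambda>q. G c q $ i $ j)" for i j
  have H: "H i j (snd c q) = G c q $ i $ j" if "q \<in> fst c" for i j q
    using that ic by (simp add: H_def)
  interpret block_metric ?S H
  proof
    show "open ?S" by (rule S(1))
    show "smooth_on ?S (H i j)" for i j using G_smooth[OF c(1)] by (simp add: H_def)
    fix y and v :: "real^4"
    assume "y \<in> ?S" and v: "v $ 1 = 0" "v $ 2 = 0"
      "(\<Sum>k\<in>UNIV. H 3 k y * v $ k) = 0" "(\<Sum>k\<in>UNIV. H 4 k y * v $ k) = 0"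
    then obtain q where "q \<in> fst c" "y = snd c q" by blast
    then show "v = 0" using v by (intro G_block[OF c(1)]) (simp_all add: H)
  qed
  let ?e = "ortho_frame H"
  have coord: "pd c i (\<lambda>q. snd c q $ a) q = axis i 1 $ a" if q: "q \<in> fst c" for i a q
  proof -
    have "pd c i (\<lambda>q. snd c q $ a) q = dpart i (\<lambda>y. y $ a) (snd c q)"
      unfolding pd_eq_dpart
    proof (rule dpart_cong_open[OF S(1)])
      show "snd c q \<in> ?S" using q by blast
      show "in_chart c (\<lambda>q. snd c q $ a) y = y $ a" if "y \<in> ?S" for y using that ic by auto
    qed
    then show ?thesis
      using dpart_eqI[OF bounded_linear_imp_has_derivative[OF bounded_linear_vec_nth[of a]], of i "snd c q"] by simp
  qed
  have df: "pd c i f q = axis i 1 $ 1" "pd c i g q = axis i 1 $ 2" if q: "q \<in> fst c" for i q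
  proof -
    have "q \<in> fst c \<inter> UNIV" using q by simp
    note cong = pd_cong_open[OF ic open_UNIV this]
    have "pd c i (\<lambda>q. snd c q $ 1) q = pd c i f q" "pd c i (\<lambda>q. snd c q $ 2) q = pd c i g q"
      by (rule cong; simp add: c1 c2)+
    then show "pd c i f q = axis i 1 $ 1" "pd c i g q = axis i 1 $ 2" using coord[OF q] by simp_all
  qed
  have comm: "(\<Sum>l\<in>UNIV. (?e 1 y $ l) *\<^sub>R dpart l (?e 2) y) = (\<Sum>l\<in>UNIV. (?e 2 y $ l) *\<^sub>R dpart l (?e 1) y)"
    if y: "y \<in> ?S" for y
  proof (rule ortho_frame_commutes[OF y])
    fix \<alpha> :: 4 assume \<alpha>: "\<alpha> \<in> {3, 4}"
    obtain q where q: "q \<in> fst c" "y = snd c q" using y by blast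
    define X where "X = grad G c f q"
    define Z where "Z = grad G c g q"
    have low: "(\<Sum>k\<in>UNIV. G c q $ i $ k * X $ k) = axis i 1 $ 1" "(\<Sum>k\<in>UNIV. G c q $ i $ k * Z $ k) = axis i 1 $ 2" for i
      unfolding X_def Z_def lower_grad[OF c(1) q(1)] df[OF q(1)] by simp_all
    have ax: "axis 3 (1::real) $ (1::4) = 0" "axis 4 (1::real) $ (1::4) = 0" "axis 3 (1::real) $ (2::4) = 0"
      "axis 4 (1::real) $ (2::4) = 0" "axis 1 (1::real) $ (1::4) = 1" "axis 2 (1::real) $ (1::4) = 0"
      "axis 1 (1::real) $ (2::4) = 0" "axis 2 (1::real) $ (2::4) = 1" by (simp_all add: axis_def)
    have ortho: "(\<Sum>k\<in>UNIV. G c q $ \<alpha> $ k * ?e j y $ k) = 0" if "j \<in> {1, 2}" "\<alpha> \<in> {3, 4}" for j \<alpha>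
      using ortho_frame_ortho[OF y that] q by (simp add: H)
    \<comment> \<open>Subtracting the frame combination with the same components 1 and 2 leaves a
      vector to which \<open>G_block\<close> applies. Both gradients are of this kind.\<close>
    have span: "V = V $ 1 *\<^sub>R ?e 1 y + V $ 2 *\<^sub>R ?e 2 y"
      if "(\<Sum>k\<in>UNIV. G c q $ 3 $ k * V $ k) = 0" "(\<Sum>k\<in>UNIV. G c q $ 4 $ k * V $ k) = 0" for V
    proof -
      let ?v = "V - (V $ 1 *\<^sub>R ?e 1 y + V $ 2 *\<^sub>R ?e 2 y)"
      have "(\<Sum>k\<in>UNIV. G c q $ \<beta> $ k * ?v $ k) = (\<Sum>k\<in>UNIV. G c q $ \<beta> $ k * V $ k)
          - (V $ 1 * (\<Sum>k\<in>UNIV. G c q $ \<beta> $ k * ?e 1 y $ k) + V $ 2 * (\<Sum>k\<in>UNIV. G c q $ \<beta> $ k * ?e 2 y $ k))" for \<beta>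
        by (simp add: algebra_simps sum.distrib sum_subtractf sum_distrib_left)
      then have "?v = 0"
        using that ortho by (intro G_block[OF c(1) q(1)]) (simp_all add: ortho_frame_nth)
      then show ?thesis by simp
    qed
    have X: "X = X $ 1 *\<^sub>R ?e 1 y + X $ 2 *\<^sub>R ?e 2 y" by (rule span) (simp_all add: low ax)
    have Z: "Z = Z $ 1 *\<^sub>R ?e 1 y + Z $ 2 *\<^sub>R ?e 2 y" by (rule span) (simp_all add: low ax)
    \<comment> \<open>Lowering a X + b Z gives a df + b dg, whose components 1 and 2 are a and
      b.\<close>
    have det: "X $ 1 * Z $ 2 - X $ 2 * Z $ 1 \<noteq> 0"
    proof (rule det2_nonzero)
      fix a b assume ab: "a * X $ 1 + b * Z $ 1 = 0" "a * X $ 2 + b * Z $ 2 = 0"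
      let ?v = "a *\<^sub>R X + b *\<^sub>R Z"
      have 1: "(\<Sum>k\<in>UNIV. G c q $ i $ k * ?v $ k) = a * axis i 1 $ 1 + b * axis i 1 $ 2" for i
        unfolding low[symmetric] by (simp add: algebra_simps sum.distrib sum_distrib_left)
      have v: "?v = 0" by (rule G_block[OF c(1) q(1)]) (use ab in \<open>simp_all only: 1 ax, simp_all\<close>)
      have "a * axis i 1 $ (1::4) + b * axis i 1 $ (2::4) = 0" for i
        unfolding 1[symmetric] v by simp
      from this[of 1] this[of 2] show "a = 0 \<and> b = 0" by (simp add: ax)
    qed
    let ?t = "\<lambda>k l. dpart l (H \<alpha> k) y - dpart k (H \<alpha> l) y"
    have pdG: "pd c l (\<lambda>q. G c q $ \<alpha> $ k) q = dpart l (H \<alpha> k) y" for k l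
      by (simp add: pd_eq_dpart H_def q(2))
    have dd0: "dirderiv c V (pd c \<alpha> f) q = 0" "dirderiv c V (pd c \<alpha> g) q = 0" for V
    proof -
      have "q \<in> fst c \<inter> UNIV" using q by simp
      note cong = dirderiv_cong_open[OF ic open_UNIV this]
      have "dirderiv c V (pd c \<alpha> f) q = dirderiv c V (\<lambda>q. 0) q" "dirderiv c V (pd c \<alpha> g) q = dirderiv c V (\<lambda>q. 0) q"
        by (rule cong; use \<alpha> in \<open>auto simp: df ax\<close>)+
      then show "dirderiv c V (pd c \<alpha> f) q = 0" "dirderiv c V (pd c \<alpha> g) q = 0" by (simp_all add: dirderiv_def)
    qed
    \<comment> \<open>The test vector is the coordinate field \<alpha>, tangent to the
      surfaces.\<close>
    have "(\<Sum>i\<in>UNIV. axis \<alpha> 1 $ i * pd c i f q) = 0 \<and> (\<Sum>i\<in>UNIV. axis \<alpha> 1 $ i * pd c i g q) = 0"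
      using sum_axis_scaleR[of \<alpha> "\<lambda>i. pd c i f q"] sum_axis_scaleR[of \<alpha> "\<lambda>i. pd c i g q"] \<alpha> q
      by (auto simp: df ax)
    then have "(\<Sum>i\<in>UNIV. axis \<alpha> 1 $ i * bracket_form G c f g i q) = 0"
      using pde c(1,3) q(1) unfolding biorthogonality_pde_def bracket_form_def by blast
    then have "bracket_form G c f g \<alpha> q = 0"
      using sum_axis_scaleR[of \<alpha> "\<lambda>i. bracket_form G c f g i q"] by simp
    then have "(\<Sum>k\<in>UNIV. X $ k * dirderiv c Z (\<lambda>q. G c q $ \<alpha> $ k) q)
        - (\<Sum>k\<in>UNIV. Z $ k * dirderiv c X (\<lambda>q. G c q $ \<alpha> $ k) q) = 0"
      unfolding bracket_form_eq[OF c(1) q(1)] dd0 X_def[symmetric] Z_def[symmetric] by simp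
    moreover have "(\<Sum>k\<in>UNIV. Z $ k * dirderiv c X (\<lambda>q. G c q $ \<alpha> $ k) q)
        = (\<Sum>k\<in>UNIV. \<Sum>l\<in>UNIV. X $ k * Z $ l * dpart k (H \<alpha> l) y)"
      unfolding dirderiv_def pdG sum_distrib_left by (subst sum.swap) (simp add: mult_ac)
    moreover have "(\<Sum>k\<in>UNIV. X $ k * dirderiv c Z (\<lambda>q. G c q $ \<alpha> $ k) q)
        = (\<Sum>k\<in>UNIV. \<Sum>l\<in>UNIV. X $ k * Z $ l * dpart l (H \<alpha> k) y)"
      unfolding dirderiv_def pdG sum_distrib_left by (simp add: mult_ac)
    ultimately have "(\<Sum>k\<in>UNIV. \<Sum>l\<in>UNIV. X $ k * Z $ l * ?t k l) = 0"
      by (simp only: right_diff_distrib sum_subtractf)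
    moreover have "X $ 1 * ?e 1 y $ k + X $ 2 * ?e 2 y $ k = X $ k"
      "Z $ 1 * ?e 1 y $ k + Z $ 2 * ?e 2 y $ k = Z $ k" for k
      using arg_cong[OF X, of "\<lambda>v. v $ k"] arg_cong[OF Z, of "\<lambda>v. v $ k"] by simp_all
    ultimately have "(\<Sum>k\<in>UNIV. \<Sum>l\<in>UNIV. (X $ 1 * ?e 1 y $ k + X $ 2 * ?e 2 y $ k) *
        (Z $ 1 * ?e 1 y $ l + Z $ 2 * ?e 2 y $ l) * ?t k l) = 0" by (simp only:)
    then show "(\<Sum>k\<in>UNIV. \<Sum>l\<in>UNIV. ?e 1 y $ k * ?e 2 y $ l * ?t k l) = 0"
      using det by (subst (asm) sum_antisym_form) auto
  qed
  let ?I = "{1, 2} :: 4 set"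
  have comm': "(\<Sum>l\<in>UNIV. (?e i y $ l) *\<^sub>R dpart l (?e j) y) = (\<Sum>l\<in>UNIV. (?e j y $ l) *\<^sub>R dpart l (?e i) y)"
    if "i \<in> ?I" "j \<in> ?I" "y \<in> ?S" for i j y
    using that comm[OF that(3)] by auto
  obtain \<delta> \<psi> where \<delta>: "\<delta> > 0" and \<psi>: "smooth_on (ball 0 \<delta>) \<psi>" "\<And>x. x \<in> ball 0 \<delta> \<Longrightarrow> \<psi> x \<in> ?S"
    and fp: "\<And>x. x \<in> ball 0 \<delta> \<Longrightarrow> \<psi> x = ?y + rad ?I 0 x + rop ?I 0 (\<lambda>j y. ?e j (\<psi> y)) x"
    and flow: "\<And>i x. i \<in> ?I \<Longrightarrow> x \<in> ball 0 \<delta> \<Longrightarrow> dpart i \<psi> x = ?e i (\<psi> x)"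
    by (rule commuting_frame_flow[of ?S ?y ?I ?e, OF S ortho_frame_smooth comm']) (assumption+, rule that)
  let ?B = "ball 0 \<delta> :: (real^4) set"
  have 0: "0 \<in> ?B" using \<delta> by simp
  have e\<psi>: "smooth_on ?B (\<lambda>y. ?e j (\<psi> y))" for j
    by (rule smooth_on_compose[OF open_ball S(1) ortho_frame_smooth \<psi>])
  have \<psi>0: "\<psi> 0 = ?y" using fp[OF 0] by (simp add: rop_def rad_def vec_eq_iff)
  \<comment> \<open>The frame has constant components 1 and 2, so the flow acts on these coordinates
    by translation; the new x^1, x^2 therefore differ from f, g by constants.\<close>
  have \<psi>12: "\<psi> x $ a = ?y $ a + x $ a" if x: "x \<in> ?B" and a: "a \<in> {1, 2}" for x a
  proof -
    have "rint ?I 0 (\<lambda>y. ?e j (\<psi> y)) x $ a = (if j = a then 1 else 0)" if j: "j \<in> ?I" for j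
    proof -
      have "rint ?I 0 (\<lambda>y. ?e j (\<psi> y)) x $ a = rint ?I 0 (\<lambda>y. ?e j (\<psi> y) $ a) x"
        by (rule rint_nth[OF smooth_on_continuous[OF e\<psi>] x])
      also have "(\<lambda>y. ?e j (\<psi> y) $ a) = (\<lambda>y. if j = a then 1 else 0)"
        using j a by (auto simp: ortho_frame_nth)
      finally show ?thesis by (simp add: rint_def)
    qed
    then have "rop ?I 0 (\<lambda>j y. ?e j (\<psi> y)) x $ a = x $ a"
      using a by (auto simp: rop_def)
    then show ?thesis using arg_cong[OF fp[OF x], of "\<lambda>v. v $ a"] a by (auto simp: rad_def)
  qed
  have d\<psi>: "\<psi> differentiable at x" if "x \<in> ?B" for x
    by (rule smooth_on_differentiable[OF \<psi>(1) open_ball that])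
  have d\<psi>12: "dpart i \<psi> x $ a = axis i 1 $ a" if x: "x \<in> ?B" and a: "a \<in> {1, 2}" for i x a
  proof -
    have "dpart i \<psi> x $ a = dpart i (\<lambda>x. ?y $ a + x $ a) x"
      unfolding dpart_nth[OF d\<psi>[OF x], symmetric] by (rule dpart_cong_open[OF open_ball x]) (rule \<psi>12[OF _ a])
    also have "\<dots> = axis i 1 $ a"
      using dpart_eqI[OF has_derivative_add[OF has_derivative_const
          bounded_linear_imp_has_derivative[OF bounded_linear_vec_nth[of a]]], of i "?y $ a" x] by simp
    finally show ?thesis .
  qed
  \<comment> \<open>At 0 the coefficients x_j of the integral operator vanish, and with them its
    derivatives in directions outside I.\<close>
  have d\<psi>0: "dpart i \<psi> 0 = axis i 1" if i: "i \<notin> ?I" for i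
  proof -
    let ?h = "\<lambda>j y. ?e j (\<psi> y)"
    have hC: "Ck_on (Suc 0) ?B (?h j)" for j using e\<psi> by (simp add: smooth_on_def)
    have A: "((\<lambda>x. ?y + rad ?I 0 x) has_derivative rad ?I 0) (at 0)"
      by (rule has_derivative_eq_rhs[OF has_derivative_add[OF has_derivative_const
              bounded_linear_imp_has_derivative[OF bounded_linear_rad]]]) simp
    have "dpart i \<psi> 0 = dpart i (\<lambda>x. (?y + rad ?I 0 x) + rop ?I 0 ?h x) 0"
      by (rule dpart_cong_open[OF open_ball 0]) (rule fp)
    also have "\<dots> = dpart i (\<lambda>x. ?y + rad ?I 0 x) 0 + dpart i (rop ?I 0 ?h) 0"
      using A by (intro dpart_add rop_dpart(1)[OF hC 0]) (auto simp: differentiable_def)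
    also have "dpart i (\<lambda>x. ?y + rad ?I 0 x) 0 = axis i 1" using dpart_eqI[OF A] i by (simp add: rad_axis)
    also have "dpart i (rop ?I 0 ?h) 0 = 0"
      using rop_dpart(2)[where I = ?I and m = 0 and i = i and h = ?h, OF hC 0] i by (simp add: rop_def)
    finally show ?thesis by simp
  qed
  \<comment> \<open>The Jacobian at 0 is triangular: components 1 and 2 of the relation give v_1 =
    v_2 = 0, and directions 3 and 4 are mapped to themselves.\<close>
  have inj: "v = 0" if v: "(\<Sum>i\<in>UNIV. (v $ i) *\<^sub>R dpart i \<psi> 0) = 0" for v :: "real^4"
  proof -
    have comp: "(\<Sum>i\<in>UNIV. v $ i * dpart i \<psi> 0 $ a) = 0" for a
      using arg_cong[OF v, of "\<lambda>w. w $ a"] by simp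
    have v12: "v $ a = 0" if a: "a \<in> {1, 2}" for a
      using comp[of a] a unfolding d\<psi>12[OF 0 a] by (auto simp: sum_4 axis_def)
    have "v $ a = 0" if a: "a \<in> {3, 4}" for a
      using comp[of a] a v12 d\<psi>0[of 3] d\<psi>0[of 4] by (auto simp: sum_4 axis_def)
    with v12 show ?thesis by (simp add: vec_eq_iff forall_4)
  qed
  obtain O' O'' \<phi> where O': "open O'" "O' \<subseteq> ?B" "0 \<in> O'" "open O''"
    and hom: "homeomorphism O' O'' \<psi> \<phi>" and \<phi>: "smooth_on O'' \<phi>"
    using smooth_inverse_function[OF open_ball \<psi>(1) 0 inj] by metis
  have O''S: "O'' \<subseteq> ?S" using hom O'(2) \<psi>(2) by (auto simp: homeomorphism_def)
  define d where "d = ({q \<in> fst c. snd c q \<in> O''}, \<lambda>q. \<phi> (snd c q))"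
  have d: "d \<in> \<A>"
    unfolding d_def
    by (rule chart_compose[OF c(1) O'(4) O''S O'(1) homeomorphism_symD[OF hom] \<phi> smooth_on_subset[OF \<psi>(1) O'(2)]])
  have in_d: "q \<in> fst c" "snd d q \<in> O'" "\<psi> (snd d q) = snd c q" if "q \<in> fst d" for q
    using that hom by (auto simp: d_def homeomorphism_def)
  have inB: "snd d q \<in> ?B" if "q \<in> fst d" for q using in_d(2)[OF that] O'(2) by blast
  have pd\<psi>: "pd d i (\<lambda>q. snd c q $ a) q = dpart i \<psi> (snd d q) $ a" if q: "q \<in> fst d" for i a q
  proof -
    have "in_chart d (\<lambda>q. snd c q $ a) z = \<psi> z $ a" if z: "z \<in> snd d ` fst d" for z
    proof -
      obtain r where r: "r \<in> fst d" "z = snd d r" using z by blast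
      then show ?thesis using in_chart_snd[OF is_chart[OF d] r(1)] in_d(3)[OF r(1)] by simp
    qed
    then have "pd d i (\<lambda>q. snd c q $ a) q = dpart i (\<lambda>z. \<psi> z $ a) (snd d q)"
      unfolding pd_eq_dpart using open_chart_image[OF is_chart[OF d] open_UNIV] q
      by (intro dpart_cong_open[of "snd d ` fst d"]) auto
    then show ?thesis using dpart_nth[OF d\<psi>[OF inB[OF q]], of i a] by simp
  qed
  have "doubly_biorthogonal G d"
  proof -
    \<comment> \<open>Seen in the chart c, the coordinate field \<alpha> of d is a frame field and
      the field \<beta> has no components 1 and 2; the frame is orthogonal to all such
      vectors.\<close>
    have "G d q $ \<alpha> $ \<beta> = 0" if q: "q \<in> fst d" and \<alpha>: "\<alpha> \<in> {1, 2}" and \<beta>: "\<beta> \<in> {3, 4}" for q \<alpha> \<beta>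
    proof -
      let ?x = "snd d q"
      have qc: "q \<in> fst c" "q \<in> fst d \<inter> fst c" using q in_d(1)[OF q] by auto
      have x: "?x \<in> ?B" "\<psi> ?x = snd c q" by (rule inB[OF q], rule in_d(3)[OF q])
      have "G d q $ \<alpha> $ \<beta> = (\<Sum>a\<in>UNIV. \<Sum>b\<in>UNIV. ?e \<alpha> (snd c q) $ a * dpart \<beta> \<psi> ?x $ b * G c q $ a $ b)"
        unfolding G_transform[OF d c(1) qc(2)] pd\<psi>[OF q] flow[OF \<alpha> x(1)] x(2) ..
      also have "\<dots> = (\<Sum>b\<in>UNIV. dpart \<beta> \<psi> ?x $ b * (\<Sum>a\<in>UNIV. H b a (snd c q) * ?e \<alpha> (snd c q) $ a))"
        unfolding H[OF qc(1)] sum_distrib_left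
        by (subst sum.swap) (simp add: mult_ac G_sym[OF c(1) qc(1)])
      also have "\<dots> = 0"
      proof (rule sum.neutral, rule ballI)
        fix b :: 4
        show "dpart \<beta> \<psi> ?x $ b * (\<Sum>a\<in>UNIV. H b a (snd c q) * ?e \<alpha> (snd c q) $ a) = 0"
        proof (cases "b \<in> {1, 2}")
          case True
          then have "dpart \<beta> \<psi> ?x $ b = 0" using d\<psi>12[OF x(1) True, of \<beta>] \<beta> by (auto simp: axis_def)
          then show ?thesis by simp
        next
          case False
          then have "b \<in> {3, 4}" using exhaust_4[of b] by auto
          then show ?thesis using ortho_frame_ortho[of "snd c q" \<alpha> b] \<alpha> qc(1) by simp
        qed
      qed
      finally show ?thesis .
    qed
    then show ?thesis by (auto simp: doubly_biorthogonal_def)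
  qed
  moreover have "surfaces (fst d) f g = surfaces (fst d) (\<lambda>q. snd d q $ 1) (\<lambda>q. snd d q $ 2)"
  proof -
    have "f q = ?y $ 1 + snd d q $ 1" "g q = ?y $ 2 + snd d q $ 2" if q: "q \<in> fst d" for q
    proof -
      show "f q = ?y $ 1 + snd d q $ 1" "g q = ?y $ 2 + snd d q $ 2"
        using \<psi>12[OF inB[OF q], of 1] \<psi>12[OF inB[OF q], of 2] c1 c2 in_d[OF q] by simp_all
    qed
    then show ?thesis unfolding surfaces_eq_iff by simp
  qed
  ultimately have "biorthogonal_system \<A> G (fst d) (surfaces (fst d) f g)
      (surfaces (fst d) (\<lambda>q. snd d q $ 3) (\<lambda>q. snd d q $ 4))"
    unfolding biorthogonal_system_def using d by (intro exI[of _ "snd d"]) simp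
  moreover have "p \<in> fst d"
  proof -
    have "\<psi> 0 \<in> O''" using hom O'(3) unfolding homeomorphism_def by blast
    then show ?thesis using c(2) \<psi>0 by (simp add: d_def)
  qed
  moreover have "fst d \<subseteq> W" using c(3) in_d(1) by blast
  ultimately show thesis using that by blast
qed

end

text \<open>Existence and uniqueness of the second family are local: the flow is built only near a
  point, and a level set of x^3, x^4 can meet the overlap of two charts in several pieces.\<close>

theorem proposition5p1:
  fixes \<A> :: "'a::{t2_space, second_countable_topology} chart set"
    and G :: "'a tensor2"
  assumes "smooth_structure \<A>"
    and "riemannian_metric \<A> G"
  shows
    "(\<forall>U \<F>\<^sub>1 \<F>\<^sub>2. biorthogonal_system \<A> G U \<F>\<^sub>1 \<F>\<^sub>2 \<longrightarrow>
        (\<exists>f g. conormal_pair \<A> U f g \<and> biorthogonality_pde \<A> G U f g \<and> \<F>\<^sub>1 = surfaces U f g)) \<and>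
     (\<forall>W f g. open W \<and> conormal_pair \<A> W f g \<longrightarrow>
        (biorthogonality_pde \<A> G W f g \<longleftrightarrow>
          (\<forall>p\<in>W. \<exists>U \<F>\<^sub>2. p \<in> U \<and> U \<subseteq> W \<and> biorthogonal_system \<A> G U (surfaces U f g) \<F>\<^sub>2))) \<and>
     (\<forall>W f g U U' \<F>\<^sub>2 \<F>\<^sub>2' p. open W \<and> conormal_pair \<A> W f g \<and> U \<subseteq> W \<and> U' \<subseteq> W \<and>
        biorthogonal_system \<A> G U (surfaces U f g) \<F>\<^sub>2 \<and>
        biorthogonal_system \<A> G U' (surfaces U' f g) \<F>\<^sub>2' \<and> p \<in> U \<inter> U' \<longrightarrow>
        (\<exists>V. open V \<and> p \<in> V \<and> V \<subseteq> U \<inter> U' \<and>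
             restrict_family V \<F>\<^sub>2 = restrict_family V \<F>\<^sub>2'))"
proof -
  interpret riemannian_mfd \<A> G
    by unfold_locales (use assms in auto)
  have coords: "\<exists>f g. conormal_pair \<A> U f g \<and> biorthogonality_pde \<A> G U f g \<and> \<F>\<^sub>1 = surfaces U f g"
    if b: "biorthogonal_system \<A> G U \<F>\<^sub>1 \<F>\<^sub>2" for U \<F>\<^sub>1 \<F>\<^sub>2
  proof -
    obtain x where x: "(U, x) \<in> \<A>" "doubly_biorthogonal G (U, x)"
      and F1: "\<F>\<^sub>1 = surfaces U (\<lambda>p. x p $ 1) (\<lambda>p. x p $ 2)"
      using b unfolding biorthogonal_system_def by blast
    let ?f = "\<lambda>p. x p $ 1" and ?g = "\<lambda>p. x p $ 2"
    have "conormal_pair \<A> U ?f ?g"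
      using coordinates_conormal[OF x(1)] by simp
    moreover from this have "biorthogonality_pde \<A> G U ?f ?g"
      using biorthogonal_imp_pde[OF x, of ?f ?g] by simp
    ultimately show ?thesis using F1 by blast
  qed
  have local: "biorthogonality_pde \<A> G W f g \<longleftrightarrow>
      (\<forall>p\<in>W. \<exists>U \<F>\<^sub>2. p \<in> U \<and> U \<subseteq> W \<and> biorthogonal_system \<A> G U (surfaces U f g) \<F>\<^sub>2)"
    if W: "open W" and fg: "conormal_pair \<A> W f g" for W f g
  proof
    assume "biorthogonality_pde \<A> G W f g"
    then show "\<forall>p\<in>W. \<exists>U \<F>\<^sub>2. p \<in> U \<and> U \<subseteq> W \<and> biorthogonal_system \<A> G U (surfaces U f g) \<F>\<^sub>2"
      using pde_imp_biorthogonal[OF W fg] by metis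
  next
    assume loc: "\<forall>p\<in>W. \<exists>U \<F>\<^sub>2. p \<in> U \<and> U \<subseteq> W \<and> biorthogonal_system \<A> G U (surfaces U f g) \<F>\<^sub>2"
    \<comment> \<open>The equation is a pointwise condition, so a neighbourhood of each point
      suffices.\<close>
    have "\<exists>U. p \<in> U \<and> biorthogonality_pde \<A> G U f g" if p: "p \<in> W" for p
    proof -
      obtain U \<F>\<^sub>2 where U: "p \<in> U" "U \<subseteq> W" "biorthogonal_system \<A> G U (surfaces U f g) \<F>\<^sub>2"
        using loc p by blast
      obtain x where x: "(U, x) \<in> \<A>" "doubly_biorthogonal G (U, x)"
        and eq: "surfaces U f g = surfaces U (\<lambda>p. x p $ 1) (\<lambda>p. x p $ 2)"
        using U(3) unfolding biorthogonal_system_def by blast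
      have "biorthogonality_pde \<A> G U f g"
        using biorthogonal_imp_pde[OF x, of f g] conormal_pair_subset[OF fg U(2)] eq
        unfolding surfaces_eq_iff by auto
      then show ?thesis using U(1) by blast
    qed
    then show "biorthogonality_pde \<A> G W f g"
      unfolding biorthogonality_pde_def by (meson IntD1 IntD2 IntI)
  qed
  have unique: "\<exists>V. open V \<and> p \<in> V \<and> V \<subseteq> U \<inter> U' \<and> restrict_family V \<F>\<^sub>2 = restrict_family V \<F>\<^sub>2'"
    if b: "biorthogonal_system \<A> G U (surfaces U f g) \<F>\<^sub>2"
      "biorthogonal_system \<A> G U' (surfaces U' f g) \<F>\<^sub>2'" and p: "p \<in> U \<inter> U'"
    for f g U U' \<F>\<^sub>2 \<F>\<^sub>2' p
  proof -
    obtain x where x: "(U, x) \<in> \<A>" "doubly_biorthogonal G (U, x)"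
      and eq: "surfaces U f g = surfaces U (\<lambda>p. x p $ 1) (\<lambda>p. x p $ 2)"
      and F2: "\<F>\<^sub>2 = surfaces U (\<lambda>p. x p $ 3) (\<lambda>p. x p $ 4)"
      using b(1) unfolding biorthogonal_system_def by blast
    obtain x' where x': "(U', x') \<in> \<A>" "doubly_biorthogonal G (U', x')"
      and eq': "surfaces U' f g = surfaces U' (\<lambda>p. x' p $ 1) (\<lambda>p. x' p $ 2)"
      and F2': "\<F>\<^sub>2' = surfaces U' (\<lambda>p. x' p $ 3) (\<lambda>p. x' p $ 4)"
      using b(2) unfolding biorthogonal_system_def by blast
    have "(x q $ 1 = x r $ 1 \<and> x q $ 2 = x r $ 2) \<longleftrightarrow> (x' q $ 1 = x' r $ 1 \<and> x' q $ 2 = x' r $ 2)"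
      if "q \<in> U \<inter> U'" "r \<in> U \<inter> U'" for q r
      using eq[unfolded surfaces_eq_iff, rule_format, of q r] eq'[unfolded surfaces_eq_iff, rule_format, of q r] that
      by blast
    then obtain V where V: "open V" "p \<in> V" "V \<subseteq> U \<inter> U'"
      "surfaces V (\<lambda>q. x q $ 3) (\<lambda>q. x q $ 4) = surfaces V (\<lambda>q. x' q $ 3) (\<lambda>q. x' q $ 4)"
      using second_family_unique[OF x x', of p] p by auto
    then have "restrict_family V \<F>\<^sub>2 = restrict_family V \<F>\<^sub>2'"
      unfolding F2 F2' using restrict_family_surfaces[of V U] restrict_family_surfaces[of V U'] by simp
    then show ?thesis using V by blast
  qed
  show ?thesis
  proof (intro conjI allI impI; (elim conjE)?)
    fix U \<F>\<^sub>1 \<F>\<^sub>2 assume "biorthogonal_system \<A> G U \<F>\<^sub>1 \<F>\<^sub>2"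
    then show "\<exists>f g. conormal_pair \<A> U f g \<and> biorthogonality_pde \<A> G U f g \<and> \<F>\<^sub>1 = surfaces U f g"
      by (rule coords)
  next
    fix W f g assume "open W" "conormal_pair \<A> W f g"
    then show "biorthogonality_pde \<A> G W f g \<longleftrightarrow>
        (\<forall>p\<in>W. \<exists>U \<F>\<^sub>2. p \<in> U \<and> U \<subseteq> W \<and> biorthogonal_system \<A> G U (surfaces U f g) \<F>\<^sub>2)"
      by (rule local)
  next
    fix f g U U' \<F>\<^sub>2 \<F>\<^sub>2' p
    assume "biorthogonal_system \<A> G U (surfaces U f g) \<F>\<^sub>2"
      "biorthogonal_system \<A> G U' (surfaces U' f g) \<F>\<^sub>2'" "p \<in> U \<inter> U'"
    then show "\<exists>V. open V \<and> p \<in> V \<and> V \<subseteq> U \<inter> U' \<and> restrict_family V \<F>\<^sub>2 = restrict_family V \<F>\<^sub>2'"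
      by (rule unique)
  qed
qed

end
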